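(* (1) For the formal potential $\mathcal V_1(x)=\frac{(1+t)x^2}{2}+\frac12\log(1-tx^2)=\frac{x^2}2-\sum_{n\ge2}\frac{t^nx^{2n}}{2n}$, $$\mathcal S(t)=0,\qquad\mathcal R(t)=\frac{1+5t-\sqrt{(1+t)(1-7t)}}{8t(1+t)},$$ $$\mathcal F_0(t)=\frac{1-22t+49t^2-(1-19t)\sqrt{(1+t)(1-7t)}}{128t^2}-\frac18\log(1+t)-\frac38\log\frac{1-3t+\sqrt{(1+t)(1-7t)}}{2}$$ $$=\frac{t^2}{2}+\frac{5t^3}{6}+\frac{23t^4}{8}+\frac{51t^5}{5}+\frac{124t^6}{3}+\frac{2515t^7}{14}+\frac{13245t^8}{16}+O(t^9).$$ (2) For the formal potential $\mathcal V_2(x)=\frac{x^2}{2}+\sqrt t\,x+\log(1-\sqrt t\,x)=\frac{x^2}{2}-\sum_{n\ge2}\frac{t^{n/2}x^n}{n}$, $$\mathcal S(t)=\frac{1-5t-\sqrt{1-10t+t^2}}{6\sqrt t},\qquad\mathcal R(t)=\frac{1+14t+t^2-(1+t)\sqrt{1-10t+t^2}}{18t},$$ $$\mathcal F_0(t)=\frac{1-32t+96t^2+76t^3+t^4-(1-27t-27t^2+t^3)\sqrt{1-10t+t^2}}{216t^2}-\log\frac{1+t+\sqrt{1-10t+t^2}}{2}$$ $$=\frac t2+\frac{3t^2}{4}+\frac{8t^3}{3}+12t^4+\frac{312t^5}{5}+\frac{1076t^6}{3}+\frac{15528t^7}{7}+14508t^8+O(t^9).$$ (3) For the formal potential $\mathcal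 V_3(x)=\frac{(1+t)x^2}{2}+\sqrt t\,x+\log(1-\sqrt t\,x)=\frac{x^2}2-\sum_{n\ge3}\frac{t^{n/2}x^n}{n}$, $$\mathcal S(t)=\frac{1-4t-\sqrt{1-8t-8t^2}}{6(1+t)\sqrt t},\qquad\mathcal R(t)=\frac{1+16t+16t^2-(1+2t)\sqrt{1-8t-8t^2}}{18t(1+t)^2},$$ $$\mathcal F_0(t)=\frac{1-28t+6t^2+176t^3+142t^4-(1-24t-78t^2-52t^3)\sqrt{1-8t-8t^2}}{216t^2(1+t)^2}+\frac12\log(1+t)-\log\frac{1+2t+\sqrt{1-8t-8t^2}}{2}$$ $$=\frac{t^2}{2}+\frac{3t^3}{2}+\frac{47t^4}{8}+\frac{139t^5}{5}+\frac{430t^6}{3}+\frac{11175t^7}{14}+\frac{75149t^8}{16}+O(t^9).$$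
   Context: For a formal potential $\frac{x^2}2-\sum_{n\ge1}\frac{a_n}{n}x^n$ with indeterminate $a_n$, let $\mathcal A=\mathbb Q[[a_1,a_2,\dots]]$ and $\mathcal A^+$ the series with zero constant term. $(\mathcal R,\mathcal S)\in(1+\mathcal A^+)\times\mathcal A^+$ is the unique solution of $$\mathcal R=1+\sum_{n\ge1}a_n\sum_{j\ge1}\binom{n-1}{j-1}\binom{n-j}{j}\mathcal R^j\mathcal S^{n-2j},\qquad \mathcal S=\sum_{n\ge1}a_n\sum_{j\ge0}\binom{n-1}{2j}\binom{2j}{j}\mathcal R^j\mathcal S^{n-2j-1}.$$ With $\mathcal H_N$ the $N\times N$ Hermitian matrices, put $$\mathcal Z=\frac{\int_{\mathcal H_N}\exp\!\big(-N\,\mathrm{Tr}(M^2/2)+N\sum_{n\ge1}\frac{a_n}{n}\mathrm{Tr}(M^n)\big)dM}{\int_{\mathcal H_N}\exp(-N\,\mathrm{Tr}(M^2/2))dM},$$ expanded in powers of the $a_n$ and integrated coefficientwise; $\log\mathcal Z=\sum_{g\ge0}N^{2-2g}\mathcal F_g$ with $\mathcal F_g\in\mathcal A$, and $\mathcal F_0$ is the formal planar limit. For a specific potential whose coefficients $a_n$ depend on $t$, the series $\mathcal R(t),\mathcal S(t),\mathcal F_0(t)\in\mathbb Q[[t^{1/2}]]$ are obtained by substituting those coefficients: in (1), $a_{2n}=t^n$ for $n\ge2$ and all other $a_n=0$; in (2), $a_n=t^{n/2}$ for $n\ge2$ and $a_1=0$; in (3), $a_n=t^{n/2}$ for $n\ge3$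 and $a_1=a_2=0$. Square roots and logarithms are expanded at $t=0$ with $\sqrt1=1$, $\log1=0$. *)

theory Defs
  imports
    "HOL-Analysis.Analysis"
    "HOL-Computational_Algebra.Formal_Laurent_Series"
    "HOL-Library.Multiset"
    "HOL-Library.Groups_Big_Fun"
    "Jordan_Normal_Form.Matrix"
begin

section \<open>Formal power series in infinitely many variables\<close>

text \<open>
  The ring of all formal power series in the variables \<open>a\<^sub>1\<close>, \<open>a\<^sub>2\<close>, ... . A monomial is a finite
  multiset of natural numbers, in which the element \<open>k\<close> stands for the variable with index
  \<open>Suc k\<close>; thus there is no variable with index \<open>0\<close>.
\<close>

typedef 'a mfps = "UNIV :: (nat multiset \<Rightarrow> 'a) set"
  morphisms mcoeff Abs_mfps ..

lemma mcoeff_Abs_mfps [simp]: "mcoeff (Abs_mfps f) m = f m"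
  by (simp add: Abs_mfps_inverse)

lemma mfps_eqI: "(\<And>m. mcoeff f m = mcoeff g m) \<Longrightarrow> f = g"
  by (metis ext mcoeff_inject)

lemma finite_submultisets: "finite {k :: 'b multiset. k \<subseteq># m}"
proof (induction m)
  case empty
  then show ?case by simp
next
  case (add x m)
  have "k \<in> {k. k \<subseteq># m} \<union> add_mset x ` {k. k \<subseteq># m}" if "k \<subseteq># add_mset x m" for k
  proof (cases "x \<in># k")
    case True
    then obtain k' where "k = add_mset x k'" by (meson multi_member_split)
    with that show ?thesis by auto
  next
    case False
    with that have "k \<subseteq># m"
      by (metis diff_single_trivial subset_eq_diff_conv add_mset_add_single)
    then show ?thesis by simp
  qed
  then have "{k. k \<subseteq># add_mset x m} \<subseteq> {k. k \<subseteq># m} \<union> add_mset x ` {k. k \<subseteq># m}"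
    by blast
  with add.IH show ?case by (meson finite_UnI finite_imageI finite_subset)
qed

instantiation mfps :: (comm_ring_1) comm_ring_1
begin

definition zero_mfps :: "'a mfps" where "0 = Abs_mfps (\<lambda>_. 0)"
definition one_mfps :: "'a mfps" where "1 = Abs_mfps (\<lambda>m. if m = {#} then 1 else 0)"
definition plus_mfps :: "'a mfps \<Rightarrow> 'a mfps \<Rightarrow> 'a mfps"
  where "f + g = Abs_mfps (\<lambda>m. mcoeff f m + mcoeff g m)"
definition uminus_mfps :: "'a mfps \<Rightarrow> 'a mfps"
  where "- f = Abs_mfps (\<lambda>m. - mcoeff f m)"
definition minus_mfps :: "'a mfps \<Rightarrow> 'a mfps \<Rightarrow> 'a mfps"
  where "f - g = Abs_mfps (\<lambda>m. mcoeff f m - mcoeff g m)"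
definition times_mfps :: "'a mfps \<Rightarrow> 'a mfps \<Rightarrow> 'a mfps"
  where "f * g = Abs_mfps (\<lambda>m. \<Sum>k | k \<subseteq># m. mcoeff f k * mcoeff g (m - k))"

instance
proof
  fix f g h :: "'a mfps"
  show "f * g * h = f * (g * h)"
  proof (rule mfps_eqI)
    fix m
    have "mcoeff (f * g * h) m =
        (\<Sum>(k, j)\<in>Sigma {k. k \<subseteq># m} (\<lambda>k. {j. j \<subseteq># k}).
          mcoeff f j * mcoeff g (k - j) * mcoeff h (m - k))"
      by (simp add: times_mfps_def sum_distrib_right sum.Sigma finite_submultisets)
    also have "\<dots> = (\<Sum>(j, i)\<in>Sigma {j. j \<subseteq># m} (\<lambda>j. {i. i \<subseteq># m - j}).
          mcoeff f j * mcoeff g i * mcoeff h (m - j - i))"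
    proof -
      have "k - j \<subseteq># m - j \<and> j \<subseteq># m \<and> j + (k - j) = k \<and> m - j - (k - j) = m - k"
        if "k \<subseteq># m" "j \<subseteq># k" for k j
        using that unfolding subseteq_mset_def multiset_eq_iff count_diff count_union
        by (smt (verit) add_diff_cancel_left' diff_diff_left diff_le_mono le_add_diff_inverse le_trans)
      moreover have "j + i \<subseteq># m" if "j \<subseteq># m" "i \<subseteq># m - j" for j i
        using that unfolding subseteq_mset_def count_diff count_union
        by (metis add_le_mono1 add.commute le_add_diff_inverse2)
      ultimately show ?thesis
        by (intro sum.reindex_bij_witness[where i = "\<lambda>(j, i). (j + i, j)"
              and j = "\<lambda>(k, j). (j, k - j)"]) auto
    qed
    also have "\<dots> = mcoeff (f * (g * h)) m"
      by (simp add: times_mfps_def sum_distrib_left sum.Sigma finite_submultisets mult.assoc)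
    finally show "mcoeff (f * g * h) m = mcoeff (f * (g * h)) m" .
  qed
  show "f * g = g * f"
  proof (rule mfps_eqI)
    fix m
    show "mcoeff (f * g) m = mcoeff (g * f) m"
      unfolding times_mfps_def mcoeff_Abs_mfps
      by (rule sum.reindex_bij_witness[where i = "\<lambda>k. m - k" and j = "\<lambda>k. m - k"])
         (auto simp: mult.commute subset_mset.diff_diff_right)
  qed
  show "1 * f = f"
  proof (rule mfps_eqI)
    fix m
    have "mcoeff (1 * f) m = (\<Sum>k | k \<subseteq># m. if k = {#} then mcoeff f m else 0)"
      unfolding times_mfps_def one_mfps_def mcoeff_Abs_mfps by (rule sum.cong) auto
    then show "mcoeff (1 * f) m = mcoeff f m"
      by (simp add: finite_submultisets)
  qed
  show "(f + g) * h = f * h + g * h"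
    by (rule mfps_eqI) (simp add: times_mfps_def plus_mfps_def sum.distrib algebra_simps)
  show "(0 :: 'a mfps) \<noteq> 1"
  proof
    assume "(0 :: 'a mfps) = 1"
    then have "mcoeff (0 :: 'a mfps) {#} = mcoeff 1 {#}" by simp
    then show False by (simp add: zero_mfps_def one_mfps_def)
  qed
qed (auto intro!: mfps_eqI simp: plus_mfps_def zero_mfps_def uminus_mfps_def minus_mfps_def algebra_simps)

end

definition mconst :: "'a \<Rightarrow> 'a::comm_ring_1 mfps"
  where "mconst c = Abs_mfps (\<lambda>m. if m = {#} then c else 0)"

text \<open>The variable with index \<open>n\<close>, for \<open>n \<ge> 1\<close>.\<close>

definition avar :: "nat \<Rightarrow> 'a::comm_ring_1 mfps"
  where "avar n = Abs_mfps (\<lambda>m. if m = {#n - 1#} then 1 else 0)"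

definition map_mfps :: "('a \<Rightarrow> 'b) \<Rightarrow> 'a mfps \<Rightarrow> 'b mfps"
  where "map_mfps h f = Abs_mfps (\<lambda>m. h (mcoeff f m))"

definition locally_finite :: "('i \<Rightarrow> 'a::zero mfps) \<Rightarrow> bool"
  where "locally_finite f \<longleftrightarrow> (\<forall>m. finite {i. mcoeff (f i) m \<noteq> 0})"

text \<open>
  The coefficientwise sum of a family. It is meaningful for locally finite families only: \<open>Sum_any\<close>
  is the sum over the support, and \<open>0\<close> if the support is infinite.
\<close>

definition msum :: "('i \<Rightarrow> 'a::comm_monoid_add mfps) \<Rightarrow> 'a mfps"
  where "msum f = Abs_mfps (\<lambda>m. Sum_any (\<lambda>i. mcoeff (f i) m))"

text \<open>For series with constant term \<open>0\<close>, respectively \<open>1\<close>.\<close>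

definition mexp :: "'a::field_char_0 mfps \<Rightarrow> 'a mfps"
  where "mexp f = msum (\<lambda>k. mconst (1 / fact k) * f ^ k)"

definition mlog :: "'a::field_char_0 mfps \<Rightarrow> 'a mfps"
  where "mlog f = msum (\<lambda>k. mconst ((- 1) ^ k / of_nat (Suc k)) * (f - 1) ^ Suc k)"

text \<open>
  Substitution of the one-variable series \<open>c n\<close> for the variable with index \<open>n\<close>, for \<open>n \<ge> 1\<close>. The
  support of the sum is finite for each \<open>d\<close> if \<open>c n\<close> is divisible by the \<open>n\<close>-th power of
  \<open>fps_X\<close> for all \<open>n\<close>.
\<close>

definition msubst :: "(nat \<Rightarrow> 'a::comm_ring_1 fps) \<Rightarrow> 'a mfps \<Rightarrow> 'a fps"
  where "msubst c f =
    Abs_fps (\<lambda>d. Sum_any (\<lambda>m. mcoeff f m * fps_nth (\<Prod>k\<in>#m. c (Suc k)) d))"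


section \<open>The series R and S\<close>

text \<open>
  The inner sums are finite: the first binomial coefficient vanishes for \<open>j > n\<close>. For those \<open>j\<close>
  for which one of the subtractions is truncated the summand vanishes as well.
\<close>

definition RS_system :: "rat mfps \<Rightarrow> rat mfps \<Rightarrow> bool"
  where "RS_system R S \<longleftrightarrow>
    mcoeff R {#} = 1 \<and> mcoeff S {#} = 0 \<and>
    R = 1 + msum (\<lambda>i. let n = Suc i in avar n *
          (\<Sum>j=1..n. of_nat (((n - 1) choose (j - 1)) * ((n - j) choose j)) * R ^ j * S ^ (n - 2 * j))) \<and>
    S = msum (\<lambda>i. let n = Suc i in avar n *
          (\<Sum>j=0..n. of_nat (((n - 1) choose (2 * j)) * ((2 * j) choose j)) * R ^ j * S ^ (n - 2 * j - 1)))"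

definition series_R :: "rat mfps"
  where "series_R = fst (THE (R, S). RS_system R S)"

definition series_S :: "rat mfps"
  where "series_S = snd (THE (R, S). RS_system R S)"


section \<open>The formal Hermitian matrix integral and its genus expansion\<close>

text \<open>
  Linear coordinates on the space of Hermitian matrices of size \<open>N\<close>: \<open>x (i, i)\<close> is the
  \<open>i\<close>-th diagonal entry, and for \<open>i < j\<close> the numbers \<open>x (i, j)\<close> and \<open>x (j, i)\<close> are the real and the
  imaginary part of the entry at \<open>(i, j)\<close>.
\<close>

definition hermitian_mat :: "nat \<Rightarrow> (nat \<times> nat \<Rightarrow> real) \<Rightarrow> complex mat"
  where "hermitian_mat N x = mat N N (\<lambda>(i, j).
    if i = j then complex_of_real (x (i, i))
    else if i < j then Complex (x (i, j)) (x (j, i))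
    else Complex (x (j, i)) (- x (i, j)))"

text \<open>Only quotients of such integrals are used, so the normalisation of the measure is irrelevant.\<close>

definition hermitian_integral :: "nat \<Rightarrow> (complex mat \<Rightarrow> complex) \<Rightarrow> complex"
  where "hermitian_integral N f =
    (LINT x | PiM ({..<N} \<times> {..<N}) (\<lambda>_. lborel). f (hermitian_mat N x))"

definition mat_trace :: "'a::comm_monoid_add mat \<Rightarrow> 'a"
  where "mat_trace A = (\<Sum>i<dim_row A. A $$ (i, i))"

definition gaussian_weight :: "nat \<Rightarrow> complex mat \<Rightarrow> complex"
  where "gaussian_weight N M = exp (- of_nat N * (mat_trace (M ^\<^sub>m 2) / 2))"

definition formal_interaction :: "nat \<Rightarrow> complex mat \<Rightarrow> complex mfps"
  where "formal_interaction N M = mconst (of_nat N) *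
    msum (\<lambda>i. let n = Suc i in avar n * mconst (mat_trace (M ^\<^sub>m n) / of_nat n))"

definition formal_partition_function :: "nat \<Rightarrow> complex mfps"
  where "formal_partition_function N = Abs_mfps (\<lambda>m.
    hermitian_integral N (\<lambda>M. gaussian_weight N M * mcoeff (mexp (formal_interaction N M)) m) /
    hermitian_integral N (gaussian_weight N))"

definition genus_expansion :: "(nat \<Rightarrow> rat mfps) \<Rightarrow> bool"
  where "genus_expansion F \<longleftrightarrow> locally_finite F \<and>
    (\<forall>N\<ge>1. mlog (formal_partition_function N) =
      msum (\<lambda>g. mconst (of_nat N powi (2 - 2 * int g)) * map_mfps of_rat (F g)))"

definition planar_free_energy :: "rat mfps"
  where "planar_free_energy = (THE F. genus_expansion F) 0"


section \<open>Specific potentials\<close>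

text \<open>
  Specialised coefficients are series in \<open>fps_X\<close>, which stands for the square root of \<open>t\<close>.
\<close>

definition coeffs_even :: "nat \<Rightarrow> rat fps"
  where "coeffs_even n = (if even n \<and> n \<ge> 4 then fps_X ^ n else 0)"

definition coeffs_from :: "nat \<Rightarrow> nat \<Rightarrow> rat fps"
  where "coeffs_from n0 n = (if n \<ge> n0 then fps_X ^ n else 0)"

definition fps_sqrt :: "'a::field_char_0 fps \<Rightarrow> 'a fps"
  where "fps_sqrt f = fps_radical (\<lambda>_ _. 1) 2 f"

definition fps_log :: "'a::field_char_0 fps \<Rightarrow> 'a fps"
  where "fps_log f = fps_ln 1 oo (f - 1)"

text \<open>
  The formal potential with coefficients \<open>c\<close> as a series in \<open>x\<close>; the field of Laurent series is used
  as coefficient domain so that \<open>fps_log\<close> applies to such series.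
\<close>

definition formal_potential :: "(nat \<Rightarrow> rat fps) \<Rightarrow> rat fls fps"
  where "formal_potential c = fps_X\<^sup>2 / 2 -
    Abs_fps (\<lambda>n. if n \<ge> 1 then fps_to_fls (c n) / of_nat n else 0)"

end

(*
  Gaussian integration by parts gives the loop equations of the matrix integral. They determine the
  coefficients of N^-2 log Z recursively as rational polynomials in N^-2, which yields existence and
  uniqueness of the genus expansion; in the limit of large N the planar free energy satisfies the planar
  loop equation. After substituting the specific coefficients this equation still has a unique
  solution, so a resolvent guessed from its rational parametrisation is the right one. The system for
  R and S counts three-step walks, and its solution comes from the same parametrisation. Finally,
  since a_n is homogeneous of degree n in the square root of t, the Euler operator applied to the free
  energy is the second moment minus one, and the closed forms follow by integrating this identity.
*)
theory Submission
  imports Defs "HOL-Probability.Distributions"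
begin

section \<open>Derivations, exponential and logarithm of series in infinitely many variables\<close>

text \<open>The recursion closes because \<open>a_n\<close> is given degree \<open>n\<close>: each
  coefficient of the loop equation for \<open>G = N^-2 log Z\<close> expresses one coefficient of
  \<open>G\<close> through coefficients of smaller degree. Rationality and polynomiality in
  \<open>N^-2\<close> thus follow without counting maps. After substitution the obstacle is the
  infinite sum of \<open>a_n W (m + n - 1)\<close>, which reaches upward in the moment index. Up to
  finitely many terms the \<open>a_n\<close> are geometric, so this sum obeys a one-step or two-step
  recursion, and the infinite system collapses to a single algebraic identity for the resolvent.
  Potentials (2) and (3) share one curve in \<open>T = t\<close> or \<open>T = t / (1 + t)\<close>
  and are treated together, with a parameter \<open>h\<close> equal to 0 or 1. Division is mostly
  avoided: inverses are named series (\<open>e\<close>, \<open>k\<close>, \<open>v\<close>,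
  \<open>Y\<close>) with a relation such as \<open>k * (g * (3 * g - 1)) = 1\<close>, and a rational
  identity becomes a polynomial identity up to an explicit multiple of the relation. The numerical
  expansions come from the polynomial formula for the Euler derivative of the free energy, not from
  the closed forms, whose denominators vanish at \<open>t = 0\<close>.\<close>

lemma mcoeff_zero [simp]: "mcoeff 0 m = 0"
  by (simp add: zero_mfps_def)

lemma mcoeff_one: "mcoeff 1 m = (if m = {#} then 1 else 0)"
  by (simp add: one_mfps_def)

lemma mcoeff_add [simp]: "mcoeff (f + g) m = mcoeff f m + mcoeff g m"
  by (simp add: plus_mfps_def)

lemma mcoeff_diff [simp]: "mcoeff (f - g) m = mcoeff f m - mcoeff g m"
  by (simp add: minus_mfps_def)

lemma mcoeff_uminus [simp]: "mcoeff (- f) m = - mcoeff f m"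
  by (simp add: uminus_mfps_def)

lemma mcoeff_mult: "mcoeff (f * g) m = (\<Sum>k | k \<subseteq># m. mcoeff f k * mcoeff g (m - k))"
  by (simp add: times_mfps_def)

lemma mcoeff_sum [simp]: "mcoeff (sum f A) m = (\<Sum>i\<in>A. mcoeff (f i) m)"
  by (induction A rule: infinite_finite_induct) auto

lemma mcoeff_mconst: "mcoeff (mconst c) m = (if m = {#} then c else 0)"
  by (simp add: mconst_def)

lemma mcoeff_mconst_mult [simp]: "mcoeff (mconst c * f) m = c * mcoeff f m"
proof -
  have "mcoeff (mconst c * f) m = (\<Sum>k | k \<subseteq># m. if k = {#} then c * mcoeff f m else 0)"
    unfolding mcoeff_mult mcoeff_mconst by (rule sum.cong) auto
  then show ?thesis
    by (simp add: finite_submultisets)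
qed

lemma of_nat_eq_mconst: "of_nat n = (mconst (of_nat n) :: 'a::comm_ring_1 mfps)"
  by (induction n) (auto intro!: mfps_eqI simp: mcoeff_one mcoeff_mconst)

lemma mconst_mult: "mconst (a * b) = mconst a * mconst b"
  by (rule mfps_eqI) (simp add: mcoeff_mconst)

lemma mconst_1: "mconst 1 = 1"
  by (rule mfps_eqI) (simp add: mcoeff_mconst mcoeff_one)

lemma mcoeff_avar_mult:
  "mcoeff (avar (Suc k) * f) m = (if k \<in># m then mcoeff f (m - {#k#}) else 0)"
proof -
  have "mcoeff (avar (Suc k) * f) m
      = (\<Sum>j | j \<subseteq># m. if j = {#k#} then mcoeff f (m - {#k#}) else 0)"
    unfolding mcoeff_mult avar_def by (rule sum.cong) auto
  then show ?thesis
    by (simp add: finite_submultisets)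
qed

lemma mcoeff_mult_empty [simp]: "mcoeff (f * g) {#} = mcoeff f {#} * mcoeff g {#}"
proof -
  have "{k. k \<subseteq># {#}} = {{#} :: nat multiset}"
    by auto
  then show ?thesis
    by (simp add: mcoeff_mult)
qed

lemma mcoeff_power_empty [simp]: "mcoeff (f ^ n) {#} = mcoeff f {#} ^ n"
  by (induction n) (auto simp: mcoeff_one)

text \<open>Without a constant term every factor uses up at least one variable, so \<open>n\<close>
  factors need a monomial of size at least \<open>n\<close>. This makes the series for
  \<open>mexp\<close> and \<open>mlog\<close> locally finite.\<close>

lemma mcoeff_power_eq_0:
  assumes "mcoeff f {#} = 0" "size m < n"
  shows "mcoeff (f ^ n) m = 0"
  using assms(2)
proof (induction n arbitrary: m)
  case (Suc n)
  have "mcoeff f k * mcoeff (f ^ n) (m - k) = 0" if "k \<subseteq># m" for k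
  proof (cases "k = {#}")
    case False
    then have "size (m - k) < size m"
      using that by (metis add_diff_cancel_left' diff_less nonempty_has_size size_Diff_submset
          size_mset_mono le_less_trans less_le_trans)
    then show ?thesis
      using Suc.IH[of "m - k"] Suc.prems by simp
  qed (use assms in auto)
  then show ?case
    by (simp add: mcoeff_mult)
qed simp

lemma locally_finiteI_size:
  fixes f :: "nat \<Rightarrow> 'a::zero mfps"
  assumes "\<And>i m. size m < i \<Longrightarrow> mcoeff (f i) m = 0"
  shows "locally_finite f"
  unfolding locally_finite_def
proof
  fix m
  have "{i. mcoeff (f i) m \<noteq> 0} \<subseteq> {..size m}"
    using assms by (auto intro: leI)
  then show "finite {i. mcoeff (f i) m \<noteq> 0}"
    by (rule finite_subset) simp
qed

lemma mcoeff_msum: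
  assumes "finite A" "\<And>i. i \<notin> A \<Longrightarrow> mcoeff (f i) m = 0"
  shows "mcoeff (msum f) m = (\<Sum>i\<in>A. mcoeff (f i) m)"
  unfolding msum_def mcoeff_Abs_mfps
  by (rule Sum_any.expand_superset) (use assms in auto)

text \<open>The factor \<open>avar (Suc k)\<close> kills every index outside \<open>m\<close>, so
  for an arbitrary family \<open>f\<close> only finitely many summands reach a given
  coefficient.\<close>

lemma mcoeff_msum_avar:
  "mcoeff (msum (\<lambda>k. avar (Suc k) * f k)) m = (\<Sum>k\<in>set_mset m. mcoeff (f k) (m - {#k#}))"
proof -
  have "mcoeff (msum (\<lambda>k. avar (Suc k) * f k)) m
      = (\<Sum>k\<in>set_mset m. mcoeff (avar (Suc k) * f k) m)"
    by (rule mcoeff_msum) (auto simp: mcoeff_avar_mult)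
  then show ?thesis
    by (simp add: mcoeff_avar_mult)
qed

lemma msum_mult_left:
  fixes f :: "'i \<Rightarrow> 'a::comm_ring_1 mfps"
  assumes "locally_finite f"
  shows "g * msum f = msum (\<lambda>i. g * f i)"
proof (rule mfps_eqI)
  fix m :: "nat multiset"
  define A where "A = (\<Union>k\<in>{k. k \<subseteq># m}. {i. mcoeff (f i) k \<noteq> 0})"
  have A: "finite A"
    using assms by (auto simp: A_def finite_submultisets locally_finite_def)
  have A': "mcoeff (f i) (m - k) = 0" if "i \<notin> A" "k \<subseteq># m" for i k
    using that by (auto simp: A_def)
  have "mcoeff (g * msum f) m
      = (\<Sum>k | k \<subseteq># m. mcoeff g k * (\<Sum>i\<in>A. mcoeff (f i) (m - k)))"
    unfolding mcoeff_mult by (intro sum.cong refl) (use A A' in \<open>simp add: mcoeff_msum[of A]\<close>)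
  also have "\<dots> = (\<Sum>i\<in>A. mcoeff (g * f i) m)"
    unfolding mcoeff_mult sum_distrib_left by (rule sum.swap)
  also have "\<dots> = mcoeff (msum (\<lambda>i. g * f i)) m"
    by (rule mcoeff_msum[symmetric]) (use A A' in \<open>auto simp: mcoeff_mult\<close>)
  finally show "mcoeff (g * msum f) m = mcoeff (msum (\<lambda>i. g * f i)) m" .
qed

lemma msum_Suc:
  fixes f :: "nat \<Rightarrow> 'a::comm_ring_1 mfps"
  assumes "locally_finite f"
  shows "msum f = f 0 + msum (\<lambda>i. f (Suc i))"
proof (rule mfps_eqI)
  fix m
  have "finite {i. mcoeff (f i) m \<noteq> 0}"
    using assms by (auto simp: locally_finite_def)
  then obtain N where N: "\<And>i. mcoeff (f i) m \<noteq> 0 \<Longrightarrow> i < N"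
    by (auto simp: finite_nat_set_iff_bounded)
  have "mcoeff (msum f) m = (\<Sum>i<Suc N. mcoeff (f i) m)"
    by (rule mcoeff_msum) (use N less_SucI in \<open>auto, blast\<close>)
  also have "\<dots> = mcoeff (f 0) m + (\<Sum>i<N. mcoeff (f (Suc i)) m)"
    by (simp only: sum.lessThan_Suc_shift)
  also have "(\<Sum>i<N. mcoeff (f (Suc i)) m) = mcoeff (msum (\<lambda>i. f (Suc i))) m"
    by (rule mcoeff_msum[symmetric]) (use N Suc_lessD in \<open>auto, blast\<close>)
  finally show "mcoeff (msum f) m = mcoeff (f 0 + msum (\<lambda>i. f (Suc i))) m"
    by simp
qed

text \<open>The partial derivative with respect to the variable with index \<open>Suc k\<close>.\<close>

definition mderiv :: "nat \<Rightarrow> 'a::comm_ring_1 mfps \<Rightarrow> 'a mfps"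
  where "mderiv k f = Abs_mfps (\<lambda>m. of_nat (Suc (count m k)) * mcoeff f (add_mset k m))"

lemma mcoeff_mderiv: "mcoeff (mderiv k f) m = of_nat (Suc (count m k)) * mcoeff f (add_mset k m)"
  by (simp add: mderiv_def)

lemma mderiv_diff: "mderiv k (f - g) = mderiv k f - mderiv k g"
  by (rule mfps_eqI) (simp add: mcoeff_mderiv algebra_simps)

lemma mderiv_mconst [simp]: "mderiv k (mconst c) = 0"
  by (rule mfps_eqI) (simp add: mcoeff_mderiv mcoeff_mconst)

lemma mderiv_1 [simp]: "mderiv k 1 = 0"
  by (rule mfps_eqI) (simp add: mcoeff_mderiv mcoeff_one)

lemma mderiv_msum:
  fixes f :: "'i \<Rightarrow> 'a::comm_ring_1 mfps"
  assumes "locally_finite f"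
  shows "mderiv k (msum f) = msum (\<lambda>i. mderiv k (f i))"
proof (rule mfps_eqI)
  fix m
  define A where "A = {i. mcoeff (f i) (add_mset k m) \<noteq> 0}"
  have "finite A"
    using assms by (auto simp: A_def locally_finite_def)
  then show "mcoeff (mderiv k (msum f)) m = mcoeff (msum (\<lambda>i. mderiv k (f i))) m"
    unfolding mcoeff_mderiv
    by (subst (1 2) mcoeff_msum[of A]) (auto simp: A_def sum_distrib_left mcoeff_mderiv)
qed

text \<open>Submultisets without \<open>k\<close> have weight zero, and all others are
  \<open>add_mset k j\<close> for a unique \<open>j\<close>. This is the index shift behind the
  Leibniz rule.\<close>

lemma sum_count_submultisets:
  fixes h :: "nat multiset \<Rightarrow> 'a::comm_ring_1"
  shows "(\<Sum>j | j \<subseteq># add_mset k m. of_nat (count j k) * h j)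
       = (\<Sum>j | j \<subseteq># m. of_nat (Suc (count j k)) * h (add_mset k j))"
proof -
  have "(\<Sum>j | j \<subseteq># add_mset k m. of_nat (count j k) * h j)
      = (\<Sum>j \<in> add_mset k ` {j. j \<subseteq># m}. of_nat (count j k) * h j)"
  proof (intro sum.mono_neutral_right ballI)
    fix j assume j: "j \<in> {j. j \<subseteq># add_mset k m} - add_mset k ` {j. j \<subseteq># m}"
    have "k \<notin># j"
    proof
      assume "k \<in># j"
      then obtain j' where "j = add_mset k j'"
        by (meson multi_member_split)
      with j show False
        by auto
    qed
    then show "of_nat (count j k) * h j = 0"
      by (simp add: not_in_iff)
  qed (auto simp: finite_submultisets)
  also have "\<dots> = (\<Sum>j | j \<subseteq># m. of_nat (Suc (count j k)) * h (add_mset k j))"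
    by (subst sum.reindex) (auto simp: inj_on_def)
  finally show ?thesis .
qed

text \<open>The multiplicity of \<open>k\<close> in \<open>add_mset k m\<close> splits over the two
  parts of each decomposition; each half is then shifted by
  \<open>sum_count_submultisets\<close>.\<close>

lemma mderiv_mult: "mderiv k (f * g) = mderiv k f * g + f * mderiv k g"
proof (rule mfps_eqI)
  fix m
  let ?M = "add_mset k m"
  have "mcoeff (mderiv k (f * g)) m
      = (\<Sum>j | j \<subseteq># ?M. of_nat (Suc (count m k)) * (mcoeff f j * mcoeff g (?M - j)))"
    by (simp only: mcoeff_mderiv mcoeff_mult sum_distrib_left)
  also have "\<dots> = (\<Sum>j | j \<subseteq># ?M. of_nat (count j k) * (mcoeff f j * mcoeff g (?M - j))) +
      (\<Sum>j | j \<subseteq># ?M. of_nat (count (?M - j) k) * (mcoeff f j * mcoeff g (?M - j)))"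
  proof -
    have "Suc (count m k) = count j k + count (?M - j) k" if "j \<subseteq># ?M" for j
      using that by (metis count_add_mset count_union subset_mset.add_diff_inverse)
    then have "of_nat (Suc (count m k)) * x
        = of_nat (count j k) * x + of_nat (count (?M - j) k) * (x :: 'a)" if "j \<subseteq># ?M" for j x
      using that by (metis distrib_right of_nat_add)
    then show ?thesis
      unfolding sum.distrib[symmetric] by (intro sum.cong refl) blast
  qed
  also have "(\<Sum>j | j \<subseteq># ?M. of_nat (count (?M - j) k) * (mcoeff f j * mcoeff g (?M - j)))
      = (\<Sum>j | j \<subseteq># ?M. of_nat (count j k) * (mcoeff f (?M - j) * mcoeff g j))"
    by (rule sum.reindex_bij_witness[where i = "\<lambda>j. ?M - j" and j = "\<lambda>j. ?M - j"])
       (auto simp: subset_mset.diff_diff_right)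
  also have "\<dots> = (\<Sum>j | j \<subseteq># m. mcoeff f (m - j) * mcoeff (mderiv k g) j)"
    unfolding sum_count_submultisets by (simp add: mcoeff_mderiv mult_ac)
  also have "\<dots> = (\<Sum>j | j \<subseteq># m. mcoeff f j * mcoeff (mderiv k g) (m - j))"
    by (rule sum.reindex_bij_witness[where i = "\<lambda>j. m - j" and j = "\<lambda>j. m - j"])
       (auto simp: subset_mset.diff_diff_right)
  also have "(\<Sum>j | j \<subseteq># ?M. of_nat (count j k) * (mcoeff f j * mcoeff g (?M - j)))
      = (\<Sum>j | j \<subseteq># m. mcoeff (mderiv k f) j * mcoeff g (m - j))"
    unfolding sum_count_submultisets by (simp add: mcoeff_mderiv mult_ac)
  finally show "mcoeff (mderiv k (f * g)) m = mcoeff (mderiv k f * g + f * mderiv k g) m"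
    by (simp add: mcoeff_mult)
qed

lemma mderiv_mconst_mult: "mderiv k (mconst c * f) = mconst c * mderiv k f"
  by (simp add: mderiv_mult)

lemma mderiv_power: "mderiv k (f ^ Suc n) = of_nat (Suc n) * (f ^ n * mderiv k f)"
proof (induction n)
  case (Suc n)
  have "mderiv k (f ^ Suc (Suc n)) = mderiv k (f ^ Suc n) * f + f ^ Suc n * mderiv k f"
    by (simp only: power_Suc2 mderiv_mult)
  then show ?case
    by (simp only: Suc.IH) (simp add: algebra_simps)
qed simp

lemma mderiv_mexp:
  fixes f :: "'a::field_char_0 mfps"
  assumes "mcoeff f {#} = 0"
  shows "mderiv k (mexp f) = mderiv k f * mexp f"
proof -
  have lf: "locally_finite (\<lambda>i. mconst (1 / fact i) * f ^ i)"
    by (rule locally_finiteI_size) (simp add: mcoeff_power_eq_0 assms)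
  have "mderiv k (mexp f) = msum (\<lambda>i. mderiv k (mconst (1 / fact i) * f ^ i))"
    unfolding mexp_def by (rule mderiv_msum[OF lf])
  also have "\<dots> = msum (\<lambda>i. mderiv k (mconst (1 / fact (Suc i)) * f ^ Suc i))"
  proof -
    have "locally_finite (\<lambda>i. mderiv k (mconst (1 / fact i) * f ^ i))"
      unfolding locally_finite_def
    proof
      fix m
      \<comment> \<open>Differentiation looks at a monomial with one more element, which moves the
        truncation bound up by one.\<close>
      have "{i. mcoeff (mderiv k (mconst (1 / fact i) * f ^ i)) m \<noteq> 0} \<subseteq> {..size (add_mset k m)}"
        by (rule subsetI, rule ccontr) (auto simp: mcoeff_mderiv mcoeff_power_eq_0 assms)
      then show "finite {i. mcoeff (mderiv k (mconst (1 / fact i) * f ^ i)) m \<noteq> 0}"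
        by (rule finite_subset) simp
    qed
    from msum_Suc[OF this] show ?thesis
      by (simp add: mconst_1)
  qed
  also have "\<dots> = msum (\<lambda>i. mderiv k f * (mconst (1 / fact i) * f ^ i))"
  proof (intro arg_cong[of _ _ msum] ext)
    fix i
    have "mderiv k (mconst (1 / fact (Suc i)) * f ^ Suc i)
        = (mconst (1 / fact (Suc i)) * of_nat (Suc i)) * (f ^ i * mderiv k f)"
      by (simp only: mderiv_mconst_mult mderiv_power mult.assoc)
    also have "mconst (1 / fact (Suc i)) * of_nat (Suc i) = mconst (1 / fact i :: 'a)"
    proof -
      have "1 / fact (Suc i) * of_nat (Suc i) = (1 / fact i :: 'a)"
        by (simp add: field_simps del: of_nat_Suc)
      then show ?thesis
        by (metis of_nat_eq_mconst mconst_mult)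
    qed
    finally show "mderiv k (mconst (1 / fact (Suc i)) * f ^ Suc i)
        = mderiv k f * (mconst (1 / fact i) * f ^ i)"
      by (simp add: mult_ac)
  qed
  also have "\<dots> = mderiv k f * mexp f"
    unfolding mexp_def by (rule msum_mult_left[OF lf, symmetric])
  finally show ?thesis .
qed

lemma mcoeff_mexp_empty:
  fixes f :: "'a::field_char_0 mfps"
  assumes "mcoeff f {#} = 0"
  shows "mcoeff (mexp f) {#} = 1"
  unfolding mexp_def by (subst mcoeff_msum[of "{0}"]) (auto simp: assms mcoeff_one mcoeff_mconst)

lemma mcoeff_mlog_empty:
  fixes f :: "'a::field_char_0 mfps"
  assumes "mcoeff f {#} = 1"
  shows "mcoeff (mlog f) {#} = 0"
  unfolding mlog_def by (subst mcoeff_msum[of "{}"]) (auto simp: assms mcoeff_one)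

text \<open>Multiplying the geometric series by \<open>- h\<close> shifts it by one index, so
  everything but the first term cancels. This supplies inverses of series with constant term
  1.\<close>

lemma mfps_geometric:
  assumes "mcoeff h {#} = 0"
  shows "(1 + h) * msum (\<lambda>i. (- h) ^ i) = (1 :: 'a::comm_ring_1 mfps)"
proof -
  have lf: "locally_finite (\<lambda>i. (- h) ^ i)"
    by (rule locally_finiteI_size) (simp add: mcoeff_power_eq_0 assms)
  have "msum (\<lambda>i. (- h) ^ i) = 1 + (- h) * msum (\<lambda>i. (- h) ^ i)"
    unfolding msum_mult_left[OF lf] by (subst msum_Suc[OF lf]) simp
  then show ?thesis
    by (simp add: algebra_simps)
qed

text \<open>Termwise differentiation gives the geometric series in \<open>1 - f\<close>, which
  inverts \<open>f\<close>. The statement is kept free of division.\<close>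

lemma mderiv_mlog:
  fixes f :: "'a::field_char_0 mfps"
  assumes "mcoeff f {#} = 1"
  shows "f * mderiv k (mlog f) = mderiv k f"
proof -
  define h where "h = f - 1"
  have h0: "mcoeff h {#} = 0"
    by (simp add: h_def assms mcoeff_one)
  have lf: "locally_finite (\<lambda>i. mconst ((- 1) ^ i / of_nat (Suc i)) * h ^ Suc i)"
    by (rule locally_finiteI_size)
      (simp add: mcoeff_power_eq_0 h0 del: power_Suc)
  have lf': "locally_finite (\<lambda>i. (- h) ^ i)"
    by (rule locally_finiteI_size) (simp add: mcoeff_power_eq_0 h0)
  have "mderiv k (mlog f) = msum (\<lambda>i. mderiv k (mconst ((- 1) ^ i / of_nat (Suc i)) * h ^ Suc i))"
    unfolding mlog_def h_def[symmetric] by (rule mderiv_msum[OF lf])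
  also have "\<dots> = msum (\<lambda>i. mderiv k f * (- h) ^ i)"
  proof (intro arg_cong[of _ _ msum] ext)
    fix i
    have dh: "mderiv k h = mderiv k f"
      by (simp add: h_def mderiv_diff)
    have "mderiv k (mconst ((- 1) ^ i / of_nat (Suc i)) * h ^ Suc i)
        = (mconst ((- 1) ^ i / of_nat (Suc i)) * of_nat (Suc i)) * (h ^ i * mderiv k f)"
      by (simp only: mderiv_mconst_mult mderiv_power mult.assoc dh)
    also have "mconst ((- 1) ^ i / of_nat (Suc i)) * of_nat (Suc i) = (mconst ((- 1) ^ i) :: 'a mfps)"
      unfolding of_nat_eq_mconst mconst_mult[symmetric] by (simp del: of_nat_Suc)
    also have "mconst ((- 1) ^ i) = (- 1 :: 'a mfps) ^ i"
    proof -
      have "mconst (- 1) = (- 1 :: 'a mfps)"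
        by (rule mfps_eqI) (simp add: mcoeff_mconst mcoeff_one)
      then show ?thesis
        by (induction i) (simp_all only: power_0 power_Suc mconst_mult mconst_1)
    qed
    finally show "mderiv k (mconst ((- 1) ^ i / of_nat (Suc i)) * h ^ Suc i)
        = mderiv k f * (- h) ^ i"
      by (simp add: power_minus[of h] mult_ac)
  qed
  also have "\<dots> = mderiv k f * msum (\<lambda>i. (- h) ^ i)"
    by (rule msum_mult_left[OF lf', symmetric])
  finally have *: "mderiv k (mlog f) = mderiv k f * msum (\<lambda>i. (- h) ^ i)" .
  have "f * msum (\<lambda>i. (- h) ^ i) = 1"
    using mfps_geometric[OF h0] by (simp add: h_def)
  then show ?thesis
    unfolding * by (metis mult.left_commute mult.right_neutral)
qed

section \<open>Gaussian integration by parts\<close>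

text \<open>All moments are read off from those of a normal density. In the recursion the truncated
  \<open>k - 1\<close> is harmless at \<open>k = 0\<close>, since the factor \<open>k\<close>
  vanishes there.\<close>

lemma gaussian_moment:
  fixes c :: real
  assumes "c > 0"
  shows integrable_gaussian_moment: "integrable lborel (\<lambda>x. exp (- (c * x\<^sup>2 / 2)) * x ^ k)"
    and gaussian_moment_Suc: "(LINT x|lborel. exp (- (c * x\<^sup>2 / 2)) * x ^ Suc k)
      = real k / c * (LINT x|lborel. exp (- (c * x\<^sup>2 / 2)) * x ^ (k - 1))"
    and gaussian_integral_pos: "(LINT x|lborel. exp (- (c * x\<^sup>2 / 2))) > 0"
proof -
  \<comment> \<open>With this standard deviation the weight is a constant \<open>K\<close> times the
    centred normal density.\<close>
  define \<sigma> where "\<sigma> = 1 / sqrt c"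
  have \<sigma>: "\<sigma> > 0" "\<sigma>\<^sup>2 = 1 / c"
    using assms by (auto simp: \<sigma>_def power_divide)
  define K where "K = sqrt (2 * pi * \<sigma>\<^sup>2)"
  have K: "K > 0"
    using \<sigma> assms by (simp add: K_def)
  have dens: "exp (- (c * x\<^sup>2 / 2)) = K * normal_density 0 \<sigma> x" for x
    using K \<sigma> assms by (simp add: normal_density_def K_def field_simps)
  have ev: "has_bochner_integral lborel (\<lambda>x. exp (- (c * x\<^sup>2 / 2)) * x ^ (2 * j))
      (K * (fact (2 * j) / ((2 * c) ^ j * fact j)))" for j
    using has_bochner_integral_mult_right[OF normal_moment_even[OF \<sigma>(1), of 0 j], of K]
    by (simp add: dens \<sigma> mult.assoc)
  have od: "has_bochner_integral lborel (\<lambda>x. exp (- (c * x\<^sup>2 / 2)) * x ^ (2 * j + 1)) 0" for j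
    using has_bochner_integral_mult_right[OF normal_moment_odd[OF \<sigma>(1), of 0 j], of K]
    by (simp add: dens mult.assoc)
  show "integrable lborel (\<lambda>x. exp (- (c * x\<^sup>2 / 2)) * x ^ k)"
  proof (cases "even k")
    case True
    then obtain j where "k = 2 * j" by blast
    then show ?thesis using ev has_bochner_integral_iff by blast
  next
    case False
    then obtain j where "k = 2 * j + 1" by (blast elim: oddE)
    then show ?thesis using od has_bochner_integral_iff by blast
  qed
  have ev': "(LINT x|lborel. exp (- (c * x\<^sup>2 / 2)) * x ^ (2 * j))
      = K * (fact (2 * j) / ((2 * c) ^ j * fact j))" for j
    using ev has_bochner_integral_iff by blast
  have od': "(LINT x|lborel. exp (- (c * x\<^sup>2 / 2)) * x ^ (2 * j + 1)) = 0" for j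
    using od has_bochner_integral_iff by blast
  show "(LINT x|lborel. exp (- (c * x\<^sup>2 / 2))) > 0"
    using ev'[of 0] K by simp
  show "(LINT x|lborel. exp (- (c * x\<^sup>2 / 2)) * x ^ Suc k)
      = real k / c * (LINT x|lborel. exp (- (c * x\<^sup>2 / 2)) * x ^ (k - 1))"
  proof (cases "even k")
    case True
    then obtain j where k: "k = 2 * j" by blast
    show ?thesis
    proof (cases j)
      case 0
      then show ?thesis using od'[of 0] k by simp
    next
      case (Suc i)
      then have "k - 1 = 2 * i + 1" "Suc k = 2 * j + 1"
        using k by auto
      then show ?thesis
        by (simp only: od' mult_zero_right)
    qed
  next
    case False
    then obtain j where k: "k = 2 * j + 1" by (blast elim: oddE)
    have "Suc k = 2 * Suc j" "k - 1 = 2 * j"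
      using k by auto
    moreover have "K * (fact (2 * Suc j) / ((2 * c) ^ Suc j * fact (Suc j)))
        = real k / c * (K * (fact (2 * j) / ((2 * c) ^ j * fact j)))"
    proof -
      define P F G where "P = (2 * c) ^ j" "F = (fact (2 * j) :: real)" "G = (fact j :: real)"
      have pos: "P > 0" "G > 0"
        using assms by (auto simp: P_F_G_def)
      have "fact (2 * Suc j) = (2 * real j + 2) * (2 * real j + 1) * F"
        "(2 * c) ^ Suc j * fact (Suc j) = (2 * c * P) * ((real j + 1) * G)"
        by (auto simp: P_F_G_def algebra_simps)
      moreover have "K * ((2 * real j + 2) * (2 * real j + 1) * F / ((2 * c * P) * ((real j + 1) * G)))
          = real (2 * j + 1) / c * (K * (F / (P * G)))"
        using pos assms by (simp add: divide_simps add_nonneg_eq_0_iff)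
      ultimately show ?thesis
        by (simp only: k P_F_G_def)
    qed
    ultimately show ?thesis
      by (simp only: ev')
  qed
qed

section \<open>Gaussian integrals of polynomials in the real coordinates\<close>

definition index_set :: "nat \<Rightarrow> (nat \<times> nat) set"
  where "index_set N = {..<N} \<times> {..<N}"

lemma finite_index_set [simp]: "finite (index_set N)"
  by (simp add: index_set_def)

text \<open>In the trace of the square each diagonal coordinate occurs squared once and each
  off-diagonal coordinate twice, because the entries at \<open>(i, j)\<close> and
  \<open>(j, i)\<close> share it.\<close>

definition gauss_coeff :: "nat \<Rightarrow> nat \<times> nat \<Rightarrow> real"
  where "gauss_coeff N p = (if fst p = snd p then real N else 2 * real N)"

definition monomial_fun :: "nat \<Rightarrow> (nat \<times> nat \<Rightarrow> nat) \<Rightarrow> (nat \<times> nat \<Rightarrow> real) \<Rightarrow> complex"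
  where "monomial_fun N \<kappa> x = (\<Prod>p\<in>index_set N. of_real (x p) ^ \<kappa> p)"

text \<open>Inductive, so that integrability and integration by parts reduce to a single monomial,
  where the integral is a product of one-dimensional moments.\<close>

inductive polynomial_fun :: "nat \<Rightarrow> ((nat \<times> nat \<Rightarrow> real) \<Rightarrow> complex) \<Rightarrow> bool" for N where
  zero: "polynomial_fun N (\<lambda>x. 0)"
| monomial: "polynomial_fun N f \<Longrightarrow> polynomial_fun N (\<lambda>x. c * monomial_fun N \<kappa> x + f x)"

lemma monomial_fun_mult:
  "monomial_fun N \<kappa> x * monomial_fun N \<kappa>' x = monomial_fun N (\<lambda>p. \<kappa> p + \<kappa>' p) x"
  by (simp add: monomial_fun_def prod.distrib[symmetric] power_add)

lemma polynomial_fun_add: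
  assumes "polynomial_fun N f" "polynomial_fun N g"
  shows "polynomial_fun N (\<lambda>x. f x + g x)"
  using assms(1)
proof induction
  case (monomial f c \<kappa>)
  then show ?case
    using polynomial_fun.monomial[of N "\<lambda>x. f x + g x" c \<kappa>] by (simp add: add.assoc)
qed (use assms in simp)

lemma polynomial_fun_monomial_mult:
  assumes "polynomial_fun N f"
  shows "polynomial_fun N (\<lambda>x. c * monomial_fun N \<kappa> x * f x)"
  using assms
proof induction
  case (monomial f d \<kappa>')
  have "c * monomial_fun N \<kappa> x * (d * monomial_fun N \<kappa>' x + f x)
      = (c * d) * monomial_fun N (\<lambda>p. \<kappa> p + \<kappa>' p) x + c * monomial_fun N \<kappa> x * f x" for x
    by (simp add: monomial_fun_mult[symmetric] algebra_simps)
  then show ?case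
    using polynomial_fun.monomial[OF monomial.IH] by simp
qed (simp add: polynomial_fun.zero)

lemma polynomial_fun_mult:
  assumes "polynomial_fun N f" "polynomial_fun N g"
  shows "polynomial_fun N (\<lambda>x. f x * g x)"
  using assms(1)
proof induction
  case (monomial f c \<kappa>)
  have "polynomial_fun N (\<lambda>x. c * monomial_fun N \<kappa> x * g x + f x * g x)"
    by (intro polynomial_fun_add polynomial_fun_monomial_mult assms monomial)
  then show ?case
    by (simp add: algebra_simps)
qed (simp add: polynomial_fun.zero)

lemma polynomial_fun_const: "polynomial_fun N (\<lambda>x. c)"
proof -
  have "polynomial_fun N (\<lambda>x. c * monomial_fun N (\<lambda>_. 0) x + 0)"
    by (intro polynomial_fun.intros)
  then show ?thesis
    by (simp add: monomial_fun_def)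
qed

lemma monomial_fun_single:
  assumes "p \<in> index_set N"
  shows "monomial_fun N (\<lambda>q. if q = p then k else 0) x = of_real (x p) ^ k"
proof -
  have "monomial_fun N (\<lambda>q. if q = p then k else 0) x
      = (\<Prod>q\<in>index_set N. if q = p then of_real (x p) ^ k else 1)"
    unfolding monomial_fun_def by (intro prod.cong) auto
  then show ?thesis
    using assms by simp
qed

lemma polynomial_fun_coordinate:
  assumes "p \<in> index_set N"
  shows "polynomial_fun N (\<lambda>x. of_real (x p))"
proof -
  have "polynomial_fun N (\<lambda>x. 1 * monomial_fun N (\<lambda>q. if q = p then 1 else 0) x + 0)"
    by (intro polynomial_fun.intros)
  then show ?thesis
    using assms by (simp add: monomial_fun_single)
qed

lemma polynomial_fun_sum:
  "(\<And>a. a \<in> A \<Longrightarrow> polynomial_fun N (f a)) \<Longrightarrow> polynomial_fun N (\<lambda>x. \<Sum>a\<in>A. f a x)"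
  by (induction A rule: infinite_finite_induct) (auto intro: polynomial_fun_add polynomial_fun.zero)

definition coord_measure :: "nat \<Rightarrow> (nat \<times> nat \<Rightarrow> real) measure"
  where "coord_measure N = PiM (index_set N) (\<lambda>_. lborel)"

definition coord_weight :: "nat \<Rightarrow> (nat \<times> nat \<Rightarrow> real) \<Rightarrow> complex"
  where "coord_weight N x = (\<Prod>p\<in>index_set N. of_real (exp (- (gauss_coeff N p * (x p)\<^sup>2 / 2))))"

definition gauss_integral :: "nat \<Rightarrow> ((nat \<times> nat \<Rightarrow> real) \<Rightarrow> complex) \<Rightarrow> complex"
  where "gauss_integral N f = (LINT x|coord_measure N. coord_weight N x * f x)"

definition moment1 :: "nat \<Rightarrow> nat \<times> nat \<Rightarrow> nat \<Rightarrow> complex"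
  where "moment1 N p k = of_real (LINT x|lborel. exp (- (gauss_coeff N p * x\<^sup>2 / 2)) * x ^ k)"

context
  fixes N :: nat
  assumes N: "N \<ge> 1"
begin

lemma gauss_coeff_pos: "gauss_coeff N p > 0"
  using N by (simp add: gauss_coeff_def)

lemma moment1_integrable:
  "integrable lborel (\<lambda>x. complex_of_real (exp (- (gauss_coeff N p * x\<^sup>2 / 2)) * x ^ k))"
  by (rule integrable_of_real, rule integrable_gaussian_moment, rule gauss_coeff_pos)

lemma weighted_monomial_eq: "coord_weight N x * monomial_fun N \<kappa> x
    = (\<Prod>p\<in>index_set N. complex_of_real (exp (- (gauss_coeff N p * (x p)\<^sup>2 / 2)) * (x p) ^ \<kappa> p))"
  by (simp add: coord_weight_def monomial_fun_def prod.distrib[symmetric])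

lemma integrable_weighted_monomial:
  "integrable (coord_measure N) (\<lambda>x. coord_weight N x * monomial_fun N \<kappa> x)"
proof -
  interpret product_sigma_finite "\<lambda>_::nat \<times> nat. lborel :: real measure" ..
  show ?thesis
    unfolding weighted_monomial_eq coord_measure_def
    by (rule product_integrable_prod[OF finite_index_set moment1_integrable])
qed

lemma gauss_integral_monomial:
  "gauss_integral N (monomial_fun N \<kappa>) = (\<Prod>p\<in>index_set N. moment1 N p (\<kappa> p))"
proof -
  interpret product_sigma_finite "\<lambda>_::nat \<times> nat. lborel :: real measure" ..
  have "gauss_integral N (monomial_fun N \<kappa>) = (\<Prod>p\<in>index_set N.
      LINT x|lborel. complex_of_real (exp (- (gauss_coeff N p * x\<^sup>2 / 2)) * x ^ \<kappa> p))"
    unfolding gauss_integral_def weighted_monomial_eq coord_measure_def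
    by (rule product_integral_prod[OF finite_index_set moment1_integrable])
  also have "\<dots> = (\<Prod>p\<in>index_set N. moment1 N p (\<kappa> p))"
    unfolding moment1_def
    by (subst integral_of_real) (rule integrable_gaussian_moment gauss_coeff_pos refl)+
  finally show ?thesis .
qed

lemma integrable_weighted_polynomial:
  assumes "polynomial_fun N f"
  shows "integrable (coord_measure N) (\<lambda>x. coord_weight N x * f x)"
  using assms
proof induction
  case (monomial f c \<kappa>)
  have "integrable (coord_measure N)
      (\<lambda>x. c * (coord_weight N x * monomial_fun N \<kappa> x) + coord_weight N x * f x)"
    by (intro Bochner_Integration.integrable_add integrable_mult_right
        integrable_weighted_monomial monomial)
  then show ?case
    by (simp add: algebra_simps)
qed simp

lemma gauss_integral_add:
  assumes "polynomial_fun N f" "polynomial_fun N g"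
  shows "gauss_integral N (\<lambda>x. f x + g x) = gauss_integral N f + gauss_integral N g"
  unfolding gauss_integral_def distrib_left
  by (rule Bochner_Integration.integral_add) (auto intro: integrable_weighted_polynomial assms)

lemma gauss_integral_cmult: "gauss_integral N (\<lambda>x. c * f x) = c * gauss_integral N f"
  unfolding gauss_integral_def by (subst mult.left_commute) simp

lemma gauss_integral_sum:
  assumes "\<And>a. a \<in> A \<Longrightarrow> polynomial_fun N (f a)"
  shows "gauss_integral N (\<lambda>x. \<Sum>a\<in>A. f a x) = (\<Sum>a\<in>A. gauss_integral N (f a))"
  unfolding gauss_integral_def sum_distrib_left
  by (rule Bochner_Integration.integral_sum) (auto intro: integrable_weighted_polynomial assms)

lemma gauss_integral_1_nonzero: "gauss_integral N (\<lambda>x. 1) \<noteq> 0"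
proof -
  have "monomial_fun N (\<lambda>_. 0) = (\<lambda>x. 1)"
    by (simp add: fun_eq_iff monomial_fun_def)
  then have "gauss_integral N (\<lambda>x. 1) = (\<Prod>p\<in>index_set N. moment1 N p 0)"
    using gauss_integral_monomial[of "\<lambda>_. 0"] by simp
  moreover have "moment1 N p 0 \<noteq> 0" for p
    using gaussian_integral_pos[OF gauss_coeff_pos, of p] by (simp add: moment1_def)
  ultimately show ?thesis
    by simp
qed

end

text \<open>A relation that carries polynomiality of both functions, so that integrability is at
  hand wherever a derivative is integrated.\<close>

definition partial_deriv ::
  "nat \<Rightarrow> nat \<times> nat \<Rightarrow> ((nat \<times> nat \<Rightarrow> real) \<Rightarrow> complex) \<Rightarrow> ((nat \<times> nat \<Rightarrow> real) \<Rightarrow> complex) \<Rightarrow> bool"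
  where "partial_deriv N p f f' \<longleftrightarrow> polynomial_fun N f \<and> polynomial_fun N f' \<and>
    (\<forall>x. ((\<lambda>t. f (x(p := t))) has_vector_derivative f' x) (at (x p)))"

lemma partial_deriv_unique:
  assumes "partial_deriv N p f f'" "partial_deriv N p f f''"
  shows "f' = f''"
  using assms unfolding partial_deriv_def by (metis ext vector_derivative_unique_at)

lemma partial_deriv_const: "partial_deriv N p (\<lambda>x. c) (\<lambda>x. 0)"
  by (simp add: partial_deriv_def polynomial_fun_const)

lemma partial_deriv_add:
  assumes "partial_deriv N p f f'" "partial_deriv N p g g'"
  shows "partial_deriv N p (\<lambda>x. f x + g x) (\<lambda>x. f' x + g' x)"
  using assms unfolding partial_deriv_def
  by (auto intro: polynomial_fun_add has_vector_derivative_add)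

lemma partial_deriv_mult:
  assumes "partial_deriv N p f f'" "partial_deriv N p g g'"
  shows "partial_deriv N p (\<lambda>x. f x * g x) (\<lambda>x. f' x * g x + f x * g' x)"
  unfolding partial_deriv_def
proof (intro conjI allI)
  fix x
  have "((\<lambda>t. f (x(p := t)) * g (x(p := t))) has_vector_derivative
      f (x(p := x p)) * g' x + f' x * g (x(p := x p))) (at (x p))"
    by (rule has_vector_derivative_mult) (use assms in \<open>auto simp: partial_deriv_def\<close>)
  then show "((\<lambda>t. f (x(p := t)) * g (x(p := t))) has_vector_derivative f' x * g x + f x * g' x) (at (x p))"
    by (simp add: add.commute)
qed (use assms in \<open>auto simp: partial_deriv_def intro: polynomial_fun_add polynomial_fun_mult\<close>)

lemma partial_deriv_coordinate:
  assumes "q \<in> index_set N"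
  shows "partial_deriv N p (\<lambda>x. of_real (x q)) (\<lambda>x. if p = q then 1 else 0)"
proof -
  have "((\<lambda>t. complex_of_real ((x(p := t)) q)) has_vector_derivative (if p = q then 1 else 0)) (at (x p))"
    for x
  proof (cases "p = q")
    case True
    have "((\<lambda>t. complex_of_real t) has_vector_derivative of_real 1) (at (x p))"
      by (rule has_vector_derivative_of_real) (auto intro!: derivative_eq_intros)
    then show ?thesis
      using True by simp
  qed simp
  then show ?thesis
    using assms by (auto simp: partial_deriv_def polynomial_fun_coordinate polynomial_fun_const)
qed

lemma monomial_fun_upd:
  assumes "p \<in> index_set N"
  shows "monomial_fun N \<kappa> (x(p := t)) = of_real t ^ \<kappa> p * (\<Prod>q\<in>index_set N - {p}. of_real (x q) ^ \<kappa> q)"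
proof -
  have "monomial_fun N \<kappa> (x(p := t))
      = of_real t ^ \<kappa> p * (\<Prod>q\<in>index_set N - {p}. of_real ((x(p := t)) q) ^ \<kappa> q)"
    unfolding monomial_fun_def by (subst prod.remove[OF _ assms]) auto
  also have "(\<Prod>q\<in>index_set N - {p}. complex_of_real ((x(p := t)) q) ^ \<kappa> q)
      = (\<Prod>q\<in>index_set N - {p}. of_real (x q) ^ \<kappa> q)"
    by (intro prod.cong) auto
  finally show ?thesis .
qed

lemma monomial_fun_alt:
  assumes "p \<in> index_set N"
  shows "monomial_fun N \<kappa> x = of_real (x p) ^ \<kappa> p * (\<Prod>q\<in>index_set N - {p}. of_real (x q) ^ \<kappa> q)"
  using monomial_fun_upd[OF assms, of \<kappa> x "x p"] by simp

lemma partial_deriv_monomial: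
  assumes "p \<in> index_set N"
  shows "partial_deriv N p (monomial_fun N \<kappa>)
    (\<lambda>x. of_nat (\<kappa> p) * monomial_fun N (\<kappa>(p := \<kappa> p - 1)) x)"
  unfolding partial_deriv_def
proof (intro conjI allI)
  have "polynomial_fun N (\<lambda>x. 1 * monomial_fun N \<kappa> x + 0)"
    by (intro polynomial_fun.intros)
  then show "polynomial_fun N (monomial_fun N \<kappa>)"
    by simp
  have "polynomial_fun N (\<lambda>x. of_nat (\<kappa> p) * monomial_fun N (\<kappa>(p := \<kappa> p - 1)) x + 0)"
    by (intro polynomial_fun.intros)
  then show "polynomial_fun N (\<lambda>x. of_nat (\<kappa> p) * monomial_fun N (\<kappa>(p := \<kappa> p - 1)) x)"
    by simp
next
  fix x
  define P where "P = (\<Prod>q\<in>index_set N - {p}. complex_of_real (x q) ^ \<kappa> q)"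
  have "((\<lambda>t. t ^ \<kappa> p) has_real_derivative real (\<kappa> p) * x p ^ (\<kappa> p - 1)) (at (x p))"
    by (auto intro!: derivative_eq_intros)
  then have "((\<lambda>t. complex_of_real (t ^ \<kappa> p)) has_vector_derivative
      of_real (real (\<kappa> p) * x p ^ (\<kappa> p - 1))) (at (x p))"
    by (rule has_vector_derivative_of_real)
  then have "((\<lambda>t. complex_of_real (t ^ \<kappa> p) * P) has_vector_derivative
      of_real (real (\<kappa> p) * x p ^ (\<kappa> p - 1)) * P) (at (x p))"
    by (rule has_vector_derivative_mult_left)
  moreover have "(\<Prod>q\<in>index_set N - {p}. complex_of_real (x q) ^ (\<kappa>(p := \<kappa> p - 1)) q) = P"
    unfolding P_def by (intro prod.cong) auto
  then have "monomial_fun N (\<kappa>(p := \<kappa> p - 1)) x = of_real (x p) ^ (\<kappa> p - 1) * P"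
    using monomial_fun_alt[OF assms, of "\<kappa>(p := \<kappa> p - 1)" x] by simp
  ultimately show "((\<lambda>t. monomial_fun N \<kappa> (x(p := t))) has_vector_derivative
      of_nat (\<kappa> p) * monomial_fun N (\<kappa>(p := \<kappa> p - 1)) x) (at (x p))"
    by (simp add: monomial_fun_upd[OF assms] P_def mult.assoc)
qed

text \<open>The integral factorises over coordinates and only the factor at \<open>p\<close>
  changes, by the moment recursion in one dimension.\<close>

lemma gauss_integral_coordinate_monomial:
  assumes N: "N \<ge> 1" and p: "p \<in> index_set N"
  shows "gauss_integral N (\<lambda>x. of_real (x p) * monomial_fun N \<kappa> x)
    = of_real (1 / gauss_coeff N p) *
      gauss_integral N (\<lambda>x. of_nat (\<kappa> p) * monomial_fun N (\<kappa>(p := \<kappa> p - 1)) x)"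
proof -
  have *: "gauss_integral N (monomial_fun N \<kappa>')
      = moment1 N p (\<kappa>' p) * (\<Prod>q\<in>index_set N - {p}. moment1 N q (\<kappa>' q))" for \<kappa>'
    unfolding gauss_integral_monomial[OF N] by (rule prod.remove) (use p in auto)
  have "(\<lambda>x. of_real (x p) * monomial_fun N \<kappa> x) = monomial_fun N (\<kappa>(p := Suc (\<kappa> p)))"
  proof
    fix x
    have "(\<Prod>q\<in>index_set N - {p}. complex_of_real (x q) ^ (\<kappa>(p := Suc (\<kappa> p))) q)
        = (\<Prod>q\<in>index_set N - {p}. of_real (x q) ^ \<kappa> q)"
      by (intro prod.cong) auto
    then show "of_real (x p) * monomial_fun N \<kappa> x = monomial_fun N (\<kappa>(p := Suc (\<kappa> p))) x"
      using monomial_fun_alt[OF p, of \<kappa> x] monomial_fun_alt[OF p, of "\<kappa>(p := Suc (\<kappa> p))" x]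
      by simp
  qed
  moreover have "(\<Prod>q\<in>index_set N - {p}. moment1 N q ((\<kappa>(p := k)) q))
      = (\<Prod>q\<in>index_set N - {p}. moment1 N q (\<kappa> q))" for k
    by (intro prod.cong) auto
  moreover have "moment1 N p (Suc (\<kappa> p))
      = of_real (1 / gauss_coeff N p) * (of_nat (\<kappa> p) * moment1 N p (\<kappa> p - 1))"
    unfolding moment1_def
    by (subst gaussian_moment_Suc[OF gauss_coeff_pos[OF N]]) simp
  ultimately show ?thesis
    unfolding gauss_integral_cmult[OF N] by (simp add: *)
qed

text \<open>Induction over the monomials of \<open>f\<close> produces some derivative for which the
  formula holds; uniqueness of derivatives identifies it with \<open>f'\<close>.\<close>

lemma gauss_integral_coordinate_mult:
  assumes N: "N \<ge> 1" and p: "p \<in> index_set N" and f: "partial_deriv N p f f'"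
  shows "gauss_integral N (\<lambda>x. of_real (x p) * f x)
    = of_real (1 / gauss_coeff N p) * gauss_integral N f'"
proof -
  have "polynomial_fun N f"
    using f by (simp add: partial_deriv_def)
  then have "\<exists>g. partial_deriv N p f g \<and> gauss_integral N (\<lambda>x. of_real (x p) * f x)
      = of_real (1 / gauss_coeff N p) * gauss_integral N g"
  proof induction
    case zero
    show ?case
      by (rule exI[of _ "\<lambda>x. 0"]) (simp add: partial_deriv_const gauss_integral_def)
  next
    case (monomial f c \<kappa>)
    then obtain g where g: "partial_deriv N p f g" "gauss_integral N (\<lambda>x. of_real (x p) * f x)
      = of_real (1 / gauss_coeff N p) * gauss_integral N g"
      by blast
    let ?m = "monomial_fun N \<kappa>"
    let ?m' = "\<lambda>x. of_nat (\<kappa> p) * monomial_fun N (\<kappa>(p := \<kappa> p - 1)) x"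
    have m: "partial_deriv N p (\<lambda>x. c * ?m x) (\<lambda>x. c * ?m' x)"
      using partial_deriv_mult[OF partial_deriv_const[of N p c] partial_deriv_monomial[OF p]] by simp
    have "gauss_integral N (\<lambda>x. of_real (x p) * (c * ?m x + f x))
        = gauss_integral N (\<lambda>x. c * (of_real (x p) * ?m x) + of_real (x p) * f x)"
      by (simp add: algebra_simps)
    also have "\<dots> = c * gauss_integral N (\<lambda>x. of_real (x p) * ?m x)
        + gauss_integral N (\<lambda>x. of_real (x p) * f x)"
      by (subst gauss_integral_add[OF N])
        (use partial_deriv_monomial[OF p, of \<kappa>] monomial in
          \<open>auto simp: gauss_integral_cmult[OF N] partial_deriv_def
            intro!: polynomial_fun_mult polynomial_fun_const polynomial_fun_coordinate p\<close>)
    also have "\<dots> = of_real (1 / gauss_coeff N p) *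
        (gauss_integral N (\<lambda>x. c * ?m' x) + gauss_integral N g)"
      unfolding g(2) gauss_integral_coordinate_monomial[OF N p] gauss_integral_cmult[OF N, of c]
      by (simp add: algebra_simps)
    also have "gauss_integral N (\<lambda>x. c * ?m' x) + gauss_integral N g
        = gauss_integral N (\<lambda>x. c * ?m' x + g x)"
      by (rule gauss_integral_add[OF N, symmetric]) (use m g(1) in \<open>auto simp: partial_deriv_def\<close>)
    finally show ?case
      using partial_deriv_add[OF m g(1)] by blast
  qed
  then show ?thesis
    using partial_deriv_unique[OF f] by blast
qed

section \<open>The Schwinger-Dyson equation for Hermitian matrices\<close>

text \<open>Coefficient of \<open>x (i, j)\<close> in the matrix entry at \<open>(i, j)\<close>;
  \<open>entry_coeff2\<close> is that of \<open>x (j, i)\<close>. Above the diagonal the entry is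
  \<open>x (i, j) + \<i> * x (j, i)\<close>, and below it the conjugate, in which the two
  coordinates exchange roles.\<close>

definition entry_coeff1 :: "nat \<Rightarrow> nat \<Rightarrow> complex"
  where "entry_coeff1 i j = (if i \<le> j then 1 else - \<i>)"

definition entry_coeff2 :: "nat \<Rightarrow> nat \<Rightarrow> complex"
  where "entry_coeff2 i j = (if i = j then 0 else if i < j then \<i> else 1)"

definition mat_entry :: "nat \<Rightarrow> nat \<Rightarrow> nat \<Rightarrow> (nat \<times> nat \<Rightarrow> real) \<Rightarrow> complex"
  where "mat_entry N i j x = hermitian_mat N x $$ (i, j)"

lemma mat_entry_eq:
  assumes "i < N" "j < N"
  shows "mat_entry N i j x = entry_coeff1 i j * of_real (x (i, j)) + entry_coeff2 i j * of_real (x (j, i))"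
  using assms by (cases i j rule: linorder_cases)
    (simp_all add: mat_entry_def hermitian_mat_def entry_coeff1_def entry_coeff2_def complex_eq_iff)

text \<open>
  \<open>entry_deriv N i j f g\<close>: the function \<open>g\<close> is the derivative of \<open>f\<close> with respect to the matrix
  entry at \<open>(j, i)\<close>, the entries being treated as independent complex variables.
\<close>

definition entry_deriv ::
  "nat \<Rightarrow> nat \<Rightarrow> nat \<Rightarrow> ((nat \<times> nat \<Rightarrow> real) \<Rightarrow> complex) \<Rightarrow> ((nat \<times> nat \<Rightarrow> real) \<Rightarrow> complex) \<Rightarrow> bool"
  where "entry_deriv N i j f g \<longleftrightarrow>
    (\<exists>f1 f2. partial_deriv N (i, j) f f1 \<and> partial_deriv N (j, i) f f2 \<and>
      g = (\<lambda>x. if i = j then f1 x else (entry_coeff1 i j * f1 x + entry_coeff2 i j * f2 x) / 2))"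

lemma entry_deriv_polynomial:
  assumes "entry_deriv N i j f g"
  shows "polynomial_fun N f" "polynomial_fun N g"
proof -
  obtain f1 f2 where f: "partial_deriv N (i, j) f f1" "partial_deriv N (j, i) f f2"
    and g: "g = (\<lambda>x. if i = j then f1 x else (entry_coeff1 i j * f1 x + entry_coeff2 i j * f2 x) / 2)"
    using assms unfolding entry_deriv_def by blast
  show "polynomial_fun N f"
    using f by (simp add: partial_deriv_def)
  show "polynomial_fun N g"
  proof (cases "i = j")
    case True
    then show ?thesis
      using f g by (simp add: partial_deriv_def)
  next
    case False
    have "polynomial_fun N (\<lambda>x. (entry_coeff1 i j / 2) * f1 x + (entry_coeff2 i j / 2) * f2 x)"
      using f by (intro polynomial_fun_add polynomial_fun_mult polynomial_fun_const)
        (auto simp: partial_deriv_def)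
    then show ?thesis
      using g False by (simp add: add_divide_distrib)
  qed
qed

lemma entry_deriv_const: "entry_deriv N i j (\<lambda>x. c) (\<lambda>x. 0)"
  unfolding entry_deriv_def by (intro exI conjI, rule partial_deriv_const, rule partial_deriv_const) simp

lemma entry_deriv_add:
  assumes "entry_deriv N i j f f'" "entry_deriv N i j g g'"
  shows "entry_deriv N i j (\<lambda>x. f x + g x) (\<lambda>x. f' x + g' x)"
proof -
  obtain f1 f2 where f: "partial_deriv N (i, j) f f1" "partial_deriv N (j, i) f f2"
    and f': "f' = (\<lambda>x. if i = j then f1 x else (entry_coeff1 i j * f1 x + entry_coeff2 i j * f2 x) / 2)"
    using assms(1) unfolding entry_deriv_def by blast
  obtain g1 g2 where g: "partial_deriv N (i, j) g g1" "partial_deriv N (j, i) g g2"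
    and g': "g' = (\<lambda>x. if i = j then g1 x else (entry_coeff1 i j * g1 x + entry_coeff2 i j * g2 x) / 2)"
    using assms(2) unfolding entry_deriv_def by blast
  show ?thesis
    unfolding entry_deriv_def
    by (intro exI conjI, rule partial_deriv_add[OF f(1) g(1)], rule partial_deriv_add[OF f(2) g(2)])
      (simp add: f' g' fun_eq_iff distrib_left add_divide_distrib)
qed

lemma entry_deriv_mult:
  assumes "entry_deriv N i j f f'" "entry_deriv N i j g g'"
  shows "entry_deriv N i j (\<lambda>x. f x * g x) (\<lambda>x. f' x * g x + f x * g' x)"
proof -
  obtain f1 f2 where f: "partial_deriv N (i, j) f f1" "partial_deriv N (j, i) f f2"
    and f': "f' = (\<lambda>x. if i = j then f1 x else (entry_coeff1 i j * f1 x + entry_coeff2 i j * f2 x) / 2)"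
    using assms(1) unfolding entry_deriv_def by blast
  obtain g1 g2 where g: "partial_deriv N (i, j) g g1" "partial_deriv N (j, i) g g2"
    and g': "g' = (\<lambda>x. if i = j then g1 x else (entry_coeff1 i j * g1 x + entry_coeff2 i j * g2 x) / 2)"
    using assms(2) unfolding entry_deriv_def by blast
  show ?thesis
    unfolding entry_deriv_def
    by (intro exI conjI, rule partial_deriv_mult[OF f(1) g(1)], rule partial_deriv_mult[OF f(2) g(2)])
      (simp add: f' g' fun_eq_iff algebra_simps add_divide_distrib)
qed

lemma entry_deriv_cmult:
  assumes "entry_deriv N i j f f'"
  shows "entry_deriv N i j (\<lambda>x. c * f x) (\<lambda>x. c * f' x)"
  using entry_deriv_mult[OF entry_deriv_const[of N i j c] assms] by simp

lemma entry_deriv_sum: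
  "(\<And>a. a \<in> A \<Longrightarrow> entry_deriv N i j (f a) (g a))
    \<Longrightarrow> entry_deriv N i j (\<lambda>x. \<Sum>a\<in>A. f a x) (\<lambda>x. \<Sum>a\<in>A. g a x)"
  by (induction A rule: infinite_finite_induct) (auto intro: entry_deriv_add entry_deriv_const)

text \<open>A Wirtinger derivative: off the diagonal the combination with the factor 1/2 sends the
  entry at \<open>(j, i)\<close> to 1 and its conjugate at \<open>(i, j)\<close> to 0.\<close>

lemma entry_deriv_entry:
  assumes "i < N" "j < N" "k < N" "l < N"
  shows "entry_deriv N i j (mat_entry N k l) (\<lambda>x. if i = l \<and> j = k then 1 else 0)"
proof -
  define f' where "f' = (\<lambda>p. entry_coeff1 k l * (if p = (k, l) then 1 else 0)
      + entry_coeff2 k l * (if p = (l, k) then 1 else 0))"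
  have "partial_deriv N p (\<lambda>x. entry_coeff1 k l * of_real (x (k, l)) + entry_coeff2 k l * of_real (x (l, k)))
      (\<lambda>x. (0 * of_real (x (k, l)) + entry_coeff1 k l * (if p = (k, l) then 1 else 0))
         + (0 * of_real (x (l, k)) + entry_coeff2 k l * (if p = (l, k) then 1 else 0)))" for p
    by (intro partial_deriv_add partial_deriv_mult partial_deriv_const partial_deriv_coordinate)
      (use assms in \<open>auto simp: index_set_def\<close>)
  moreover have "mat_entry N k l
      = (\<lambda>x. entry_coeff1 k l * of_real (x (k, l)) + entry_coeff2 k l * of_real (x (l, k)))"
    using assms by (simp add: fun_eq_iff mat_entry_eq)
  ultimately have "partial_deriv N p (mat_entry N k l) (\<lambda>x. f' p)" for p
    by (simp add: f'_def)
  moreover have "(if i = l \<and> j = k then 1 else 0)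
      = (if i = j then f' (i, j) else (entry_coeff1 i j * f' (i, j) + entry_coeff2 i j * f' (j, i)) / 2)"
    unfolding f'_def entry_coeff1_def entry_coeff2_def
    by (cases "i = k"; cases "j = l"; cases "i = l"; cases "j = k"; cases i j rule: linorder_cases) auto
  ultimately show ?thesis
    unfolding entry_deriv_def by blast
qed

text \<open>The variance \<open>1 / (2 N)\<close> of an off-diagonal coordinate absorbs the factor
  1/2 in \<open>entry_deriv\<close>, so the same \<open>1 / N\<close> appears on and off the
  diagonal. An entry is correlated only with its transposed entry.\<close>

lemma gauss_integral_entry_mult:
  assumes N: "N \<ge> 1" and ij: "i < N" "j < N" and f: "entry_deriv N i j f g"
  shows "gauss_integral N (\<lambda>x. mat_entry N i j x * f x) = gauss_integral N g / of_nat N"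
proof -
  obtain f1 f2 where f12: "partial_deriv N (i, j) f f1" "partial_deriv N (j, i) f f2"
    and g: "g = (\<lambda>x. if i = j then f1 x else (entry_coeff1 i j * f1 x + entry_coeff2 i j * f2 x) / 2)"
    using f unfolding entry_deriv_def by blast
  have I: "(i, j) \<in> index_set N" "(j, i) \<in> index_set N"
    using ij by (auto simp: index_set_def)
  have pf: "polynomial_fun N f1" "polynomial_fun N f2" "polynomial_fun N f"
    using f12 by (auto simp: partial_deriv_def)
  have "gauss_integral N (\<lambda>x. mat_entry N i j x * f x)
      = gauss_integral N (\<lambda>x. entry_coeff1 i j * (of_real (x (i, j)) * f x)
          + entry_coeff2 i j * (of_real (x (j, i)) * f x))"
    using ij by (simp add: mat_entry_eq algebra_simps)
  also have "\<dots> = entry_coeff1 i j * gauss_integral N (\<lambda>x. of_real (x (i, j)) * f x)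
      + entry_coeff2 i j * gauss_integral N (\<lambda>x. of_real (x (j, i)) * f x)"
    by (subst gauss_integral_add[OF N])
      (auto simp: gauss_integral_cmult[OF N] intro!: polynomial_fun_mult polynomial_fun_const
        polynomial_fun_coordinate I pf)
  also have "\<dots> = entry_coeff1 i j * (of_real (1 / gauss_coeff N (i, j)) * gauss_integral N f1)
      + entry_coeff2 i j * (of_real (1 / gauss_coeff N (j, i)) * gauss_integral N f2)"
    by (simp only: gauss_integral_coordinate_mult[OF N I(1) f12(1)]
        gauss_integral_coordinate_mult[OF N I(2) f12(2)])
  also have "\<dots> = gauss_integral N g / of_nat N"
  proof (cases "i = j")
    case True
    then show ?thesis
      by (simp add: g entry_coeff1_def entry_coeff2_def gauss_coeff_def)
  next
    case False
    have "gauss_integral N g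
        = gauss_integral N (\<lambda>x. (entry_coeff1 i j / 2) * f1 x + (entry_coeff2 i j / 2) * f2 x)"
      using False by (simp add: g add_divide_distrib)
    also have "\<dots> = entry_coeff1 i j / 2 * gauss_integral N f1 + entry_coeff2 i j / 2 * gauss_integral N f2"
      by (subst gauss_integral_add[OF N])
        (simp_all only: gauss_integral_cmult[OF N] polynomial_fun_mult polynomial_fun_const pf)
    finally show ?thesis
      using False N by (simp add: gauss_coeff_def field_simps)
  qed
  finally show ?thesis .
qed

section \<open>Entries and traces of matrix powers\<close>

definition power_entry :: "nat \<Rightarrow> nat \<Rightarrow> nat \<Rightarrow> nat \<Rightarrow> (nat \<times> nat \<Rightarrow> real) \<Rightarrow> complex"
  where "power_entry N n i j x = (hermitian_mat N x ^\<^sub>m n) $$ (i, j)"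

definition power_trace :: "nat \<Rightarrow> nat \<Rightarrow> (nat \<times> nat \<Rightarrow> real) \<Rightarrow> complex"
  where "power_trace N n x = mat_trace (hermitian_mat N x ^\<^sub>m n)"

lemma hermitian_mat_carrier [simp]: "hermitian_mat N x \<in> carrier_mat N N"
  by (simp add: hermitian_mat_def)

lemma hermitian_pow_carrier [simp]: "hermitian_mat N x ^\<^sub>m n \<in> carrier_mat N N"
  by (rule pow_carrier_mat) simp

lemma power_entry_0: "i < N \<Longrightarrow> j < N \<Longrightarrow> power_entry N 0 i j x = (if i = j then 1 else 0)"
  by (simp add: power_entry_def hermitian_mat_def)

lemma power_entry_Suc:
  assumes "i < N" "j < N"
  shows "power_entry N (Suc n) i j x = (\<Sum>u<N. power_entry N n i u x * mat_entry N u j x)"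
proof -
  have *: "dim_row (hermitian_mat N x ^\<^sub>m n) = N" "dim_col (hermitian_mat N x ^\<^sub>m n) = N"
    "dim_row (hermitian_mat N x) = N" "dim_col (hermitian_mat N x) = N"
    using hermitian_pow_carrier[of N x n] hermitian_mat_carrier[of N x] by blast+
  show ?thesis
    using assms * by (simp add: power_entry_def mat_entry_def scalar_prod_def atLeast0LessThan)
qed

lemma power_trace_eq: "power_trace N n x = (\<Sum>k<N. power_entry N n k k x)"
  unfolding power_trace_def mat_trace_def power_entry_def
  using hermitian_pow_carrier[of N x n] by (metis carrier_matD(1))

lemma power_entry_add:
  assumes "i < N" "j < N"
  shows "power_entry N (a + b) i j x = (\<Sum>u<N. power_entry N a i u x * power_entry N b u j x)"
  using assms(2)
proof (induction b arbitrary: j)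
  case 0
  have "(\<Sum>u<N. power_entry N a i u x * power_entry N 0 u j x)
      = (\<Sum>u<N. if u = j then power_entry N a i j x else 0)"
    by (rule sum.cong) (use 0 in \<open>auto simp: power_entry_0\<close>)
  then show ?case
    using 0 by simp
next
  case (Suc b)
  have "power_entry N (a + Suc b) i j x
      = (\<Sum>v<N. \<Sum>u<N. power_entry N a i u x * power_entry N b u v x * mat_entry N v j x)"
    using assms Suc by (simp add: power_entry_Suc sum_distrib_right)
  also have "\<dots> = (\<Sum>u<N. \<Sum>v<N. power_entry N a i u x * power_entry N b u v x * mat_entry N v j x)"
    by (rule sum.swap)
  also have "\<dots> = (\<Sum>u<N. power_entry N a i u x * power_entry N (Suc b) u j x)"
    using Suc by (intro sum.cong) (auto simp: power_entry_Suc sum_distrib_left mult.assoc)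
  finally show ?case .
qed

text \<open>Differentiating the factor at position \<open>a\<close> cuts the word of length
  \<open>n\<close> into words of length \<open>a\<close> and \<open>n - 1 - a\<close>.\<close>

lemma entry_deriv_power_entry:
  assumes "i < N" "j < N" "k < N" "l < N"
  shows "entry_deriv N i j (power_entry N n k l)
    (\<lambda>x. \<Sum>a<n. power_entry N a k j x * power_entry N (n - 1 - a) i l x)"
  using assms(4)
proof (induction n arbitrary: l)
  case 0
  have "power_entry N 0 k l = (\<lambda>x. if k = l then 1 else 0)"
    using assms 0 by (simp add: fun_eq_iff power_entry_0)
  then show ?case
    using entry_deriv_const by simp
next
  case (Suc n)
  let ?D = "\<lambda>u x. \<Sum>a<n. power_entry N a k j x * power_entry N (n - 1 - a) i u x"
  have "entry_deriv N i j (\<lambda>x. \<Sum>u<N. power_entry N n k u x * mat_entry N u l x)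
      (\<lambda>x. \<Sum>u<N. ?D u x * mat_entry N u l x + power_entry N n k u x * (if i = l \<and> j = u then 1 else 0))"
    by (intro entry_deriv_sum entry_deriv_mult Suc.IH entry_deriv_entry) (use assms Suc.prems in auto)
  also have "(\<lambda>x. \<Sum>u<N. power_entry N n k u x * mat_entry N u l x) = power_entry N (Suc n) k l"
    using assms Suc.prems by (simp add: fun_eq_iff power_entry_Suc)
  also have "(\<lambda>x. \<Sum>u<N. ?D u x * mat_entry N u l x + power_entry N n k u x * (if i = l \<and> j = u then 1 else 0))
      = (\<lambda>x. \<Sum>a<Suc n. power_entry N a k j x * power_entry N (Suc n - 1 - a) i l x)"
  proof
    fix x
    have "(\<Sum>u<N. ?D u x * mat_entry N u l x)
        = (\<Sum>u<N. \<Sum>a<n. power_entry N a k j x * (power_entry N (n - 1 - a) i u x * mat_entry N u l x))"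
      by (simp add: sum_distrib_right mult.assoc)
    also have "\<dots> = (\<Sum>a<n. \<Sum>u<N. power_entry N a k j x * (power_entry N (n - 1 - a) i u x * mat_entry N u l x))"
      by (rule sum.swap)
    also have "\<dots> = (\<Sum>a<n. power_entry N a k j x * power_entry N (Suc n - 1 - a) i l x)"
    proof (intro sum.cong refl)
      fix a assume "a \<in> {..<n}"
      then have "Suc n - 1 - a = Suc (n - 1 - a)"
        by auto
      then show "(\<Sum>u<N. power_entry N a k j x * (power_entry N (n - 1 - a) i u x * mat_entry N u l x))
          = power_entry N a k j x * power_entry N (Suc n - 1 - a) i l x"
        using assms Suc.prems by (simp only: power_entry_Suc sum_distrib_left)
    qed
    finally have 1: "(\<Sum>u<N. ?D u x * mat_entry N u l x)
        = (\<Sum>a<n. power_entry N a k j x * power_entry N (Suc n - 1 - a) i l x)" .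
    have "(\<Sum>u<N. power_entry N n k u x * (if i = l \<and> j = u then 1 else 0))
        = (\<Sum>u<N. if u = j then power_entry N n k j x * (if i = l then 1 else 0) else 0)"
      by (intro sum.cong) auto
    also have "\<dots> = power_entry N n k j x * power_entry N 0 i l x"
      using assms Suc.prems by (simp add: power_entry_0)
    finally show "(\<Sum>u<N. ?D u x * mat_entry N u l x + power_entry N n k u x * (if i = l \<and> j = u then 1 else 0))
        = (\<Sum>a<Suc n. power_entry N a k j x * power_entry N (Suc n - 1 - a) i l x)"
      unfolding sum.distrib 1 by simp
  qed
  finally show ?case .
qed

text \<open>By cyclicity all \<open>Suc n\<close> positions of the cut give the same power, since
  the two remaining words multiply to the word of length \<open>n\<close>.\<close>

lemma entry_deriv_power_trace:
  assumes "i < N" "j < N"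
  shows "entry_deriv N i j (power_trace N (Suc n)) (\<lambda>x. of_nat (Suc n) * power_entry N n i j x)"
proof -
  have "entry_deriv N i j (\<lambda>x. \<Sum>k<N. power_entry N (Suc n) k k x)
      (\<lambda>x. \<Sum>k<N. \<Sum>a<Suc n. power_entry N a k j x * power_entry N (Suc n - 1 - a) i k x)"
    by (intro entry_deriv_sum entry_deriv_power_entry) (use assms in auto)
  also have "(\<lambda>x. \<Sum>k<N. power_entry N (Suc n) k k x) = power_trace N (Suc n)"
    by (simp add: fun_eq_iff power_trace_eq)
  also have "(\<lambda>x. \<Sum>k<N. \<Sum>a<Suc n. power_entry N a k j x * power_entry N (Suc n - 1 - a) i k x)
      = (\<lambda>x. of_nat (Suc n) * power_entry N n i j x)"
  proof
    fix x
    have "(\<Sum>k<N. \<Sum>a<Suc n. power_entry N a k j x * power_entry N (Suc n - 1 - a) i k x)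
        = (\<Sum>a<Suc n. \<Sum>k<N. power_entry N (Suc n - 1 - a) i k x * power_entry N a k j x)"
      by (subst sum.swap) (simp add: mult.commute)
    also have "\<dots> = (\<Sum>a<Suc n. power_entry N n i j x)"
    proof (intro sum.cong refl)
      fix a assume "a \<in> {..<Suc n}"
      then have "Suc n - 1 - a + a = n"
        by auto
      then show "(\<Sum>k<N. power_entry N (Suc n - 1 - a) i k x * power_entry N a k j x) = power_entry N n i j x"
        using power_entry_add[of i N j "Suc n - 1 - a" a x] assms by simp
    qed
    finally show "(\<Sum>k<N. \<Sum>a<Suc n. power_entry N a k j x * power_entry N (Suc n - 1 - a) i k x)
        = of_nat (Suc n) * power_entry N n i j x"
      by simp
  qed
  finally show ?thesis .
qed

lemma polynomial_fun_power_entry: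
  assumes "k < N" "l < N"
  shows "polynomial_fun N (power_entry N n k l)"
  using entry_deriv_polynomial(1)[OF entry_deriv_power_entry[of k N k k l]] assms by blast

lemma power_trace_0: "power_trace N 0 x = of_nat N"
  by (simp add: power_trace_eq power_entry_0)

lemma polynomial_fun_power_trace: "polynomial_fun N (power_trace N n)"
  unfolding power_trace_eq[abs_def] by (intro polynomial_fun_sum polynomial_fun_power_entry) auto

text \<open>One matrix factor is split off the trace and integrated by parts. The derivative hitting
  the remaining word cuts it into two loops, hence the products of traces; the derivative hitting
  \<open>f\<close> gives the last integral.\<close>

lemma schwinger_dyson:
  assumes N: "N \<ge> 1"
    and f: "\<And>i j. i < N \<Longrightarrow> j < N \<Longrightarrow> entry_deriv N i j f (g i j)"
  shows "of_nat N * gauss_integral N (\<lambda>x. power_trace N (Suc m) x * f x)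
    = (\<Sum>a<m. gauss_integral N (\<lambda>x. power_trace N a x * power_trace N (m - 1 - a) x * f x))
    + gauss_integral N (\<lambda>x. \<Sum>i<N. \<Sum>j<N. power_entry N m j i x * g i j x)"
proof -
  let ?dP = "\<lambda>i j x. \<Sum>a<m. power_entry N a j j x * power_entry N (m - 1 - a) i i x"
  have pf: "polynomial_fun N f"
    using f[of 0 0] N entry_deriv_polynomial by auto
  have pg: "polynomial_fun N (g i j)" if "i < N" "j < N" for i j
    using f[of i j] that entry_deriv_polynomial by auto
  have D: "entry_deriv N i j (\<lambda>x. power_entry N m j i x * f x)
      (\<lambda>x. ?dP i j x * f x + power_entry N m j i x * g i j x)" if "i < N" "j < N" for i j
    by (intro entry_deriv_mult entry_deriv_power_entry f that)
  \<comment> \<open>The split-off factor is the last one of the word; its indices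
    \<open>(i, j)\<close> pair with the rest at \<open>(j, i)\<close>.\<close>
  have "power_trace N (Suc m) x * f x
      = (\<Sum>i<N. \<Sum>j<N. mat_entry N i j x * (power_entry N m j i x * f x))" for x
  proof -
    have "power_trace N (Suc m) x = (\<Sum>j<N. \<Sum>i<N. power_entry N m j i x * mat_entry N i j x)"
      by (simp add: power_trace_eq power_entry_Suc)
    also have "\<dots> = (\<Sum>i<N. \<Sum>j<N. power_entry N m j i x * mat_entry N i j x)"
      by (rule sum.swap)
    finally show ?thesis
      by (simp add: sum_distrib_right sum_distrib_left mult_ac)
  qed
  then have "gauss_integral N (\<lambda>x. power_trace N (Suc m) x * f x)
      = gauss_integral N (\<lambda>x. \<Sum>i<N. \<Sum>j<N. mat_entry N i j x * (power_entry N m j i x * f x))"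
    by simp
  also have "\<dots> = (\<Sum>i<N. \<Sum>j<N. gauss_integral N (\<lambda>x. mat_entry N i j x * (power_entry N m j i x * f x)))"
  proof -
    have "polynomial_fun N (\<lambda>x. mat_entry N i j x * (power_entry N m j i x * f x))"
      if "i < N" "j < N" for i j
      using that entry_deriv_polynomial(1)[OF entry_deriv_entry[of i N j i j]]
      by (intro polynomial_fun_mult pf polynomial_fun_power_entry) auto
    then show ?thesis
      by (subst gauss_integral_sum[OF N]; (intro sum.cong refl)?)
        (auto intro!: polynomial_fun_sum gauss_integral_sum[OF N])
  qed
  also have "\<dots> = (\<Sum>i<N. \<Sum>j<N.
      gauss_integral N (\<lambda>x. ?dP i j x * f x + power_entry N m j i x * g i j x) / of_nat N)"
    by (intro sum.cong refl gauss_integral_entry_mult[OF N _ _ D]) auto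
  finally have "of_nat N * gauss_integral N (\<lambda>x. power_trace N (Suc m) x * f x)
      = (\<Sum>i<N. \<Sum>j<N. gauss_integral N (\<lambda>x. ?dP i j x * f x + power_entry N m j i x * g i j x))"
    using N by (simp add: sum_divide_distrib[symmetric])
  also have "\<dots> = gauss_integral N (\<lambda>x. \<Sum>i<N. \<Sum>j<N. ?dP i j x * f x + power_entry N m j i x * g i j x)"
    using entry_deriv_polynomial(2)[OF D]
    by (subst gauss_integral_sum[OF N]; (intro sum.cong refl)?)
      (auto intro!: polynomial_fun_sum gauss_integral_sum[OF N, symmetric])
  also have "(\<lambda>x. \<Sum>i<N. \<Sum>j<N. ?dP i j x * f x + power_entry N m j i x * g i j x)
      = (\<lambda>x. (\<Sum>a<m. power_trace N a x * power_trace N (m - 1 - a) x * f x)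
          + (\<Sum>i<N. \<Sum>j<N. power_entry N m j i x * g i j x))"
  proof
    fix x
    have "(\<Sum>i<N. \<Sum>j<N. ?dP i j x)
        = (\<Sum>i<N. \<Sum>a<m. \<Sum>j<N. power_entry N a j j x * power_entry N (m - 1 - a) i i x)"
      by (intro sum.cong refl sum.swap)
    also have "\<dots> = (\<Sum>a<m. \<Sum>i<N. \<Sum>j<N. power_entry N a j j x * power_entry N (m - 1 - a) i i x)"
      by (rule sum.swap)
    also have "\<dots> = (\<Sum>a<m. power_trace N a x * power_trace N (m - 1 - a) x)"
      by (simp add: power_trace_eq sum_distrib_left sum_distrib_right)
    finally have "(\<Sum>i<N. \<Sum>j<N. ?dP i j x * f x) = (\<Sum>a<m. power_trace N a x * power_trace N (m - 1 - a) x * f x)"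
      by (simp add: sum_distrib_right[symmetric])
    then show "(\<Sum>i<N. \<Sum>j<N. ?dP i j x * f x + power_entry N m j i x * g i j x)
        = (\<Sum>a<m. power_trace N a x * power_trace N (m - 1 - a) x * f x)
          + (\<Sum>i<N. \<Sum>j<N. power_entry N m j i x * g i j x)"
      by (simp add: sum.distrib)
  qed
  also have "gauss_integral N (\<lambda>x. (\<Sum>a<m. power_trace N a x * power_trace N (m - 1 - a) x * f x)
          + (\<Sum>i<N. \<Sum>j<N. power_entry N m j i x * g i j x))
      = gauss_integral N (\<lambda>x. \<Sum>a<m. power_trace N a x * power_trace N (m - 1 - a) x * f x)
      + gauss_integral N (\<lambda>x. \<Sum>i<N. \<Sum>j<N. power_entry N m j i x * g i j x)"
    by (rule gauss_integral_add[OF N])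
      (auto intro!: polynomial_fun_sum polynomial_fun_mult polynomial_fun_power_trace
        polynomial_fun_power_entry pf pg)
  also have "gauss_integral N (\<lambda>x. \<Sum>a<m. power_trace N a x * power_trace N (m - 1 - a) x * f x)
      = (\<Sum>a<m. gauss_integral N (\<lambda>x. power_trace N a x * power_trace N (m - 1 - a) x * f x))"
    by (rule gauss_integral_sum[OF N]) (intro polynomial_fun_mult polynomial_fun_power_trace pf)
  finally show ?thesis .
qed

lemma gaussian_weight_hermitian_mat: "gaussian_weight N (hermitian_mat N x) = coord_weight N x"
proof -
  \<comment> \<open>Chosen so that the squared modulus of the entry at \<open>(i, j)\<close> is
    \<open>h i j + h j i\<close>; on the diagonal the two summands coincide, hence the factor
    1/2.\<close>
  define h where "h = (\<lambda>i j. (if i = j then 1 / 2 else 1) * complex_of_real ((x (i, j))\<^sup>2))"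
  have "mat_trace (hermitian_mat N x ^\<^sub>m 2) = power_trace N (1 + 1) x"
    by (simp add: power_trace_def numeral_2_eq_2)
  also have "\<dots> = (\<Sum>i<N. \<Sum>j<N. power_entry N 1 i j x * power_entry N 1 j i x)"
    unfolding power_trace_eq by (intro sum.cong refl power_entry_add) auto
  also have "\<dots> = (\<Sum>i<N. \<Sum>j<N. h i j + h j i)"
  proof (intro sum.cong refl)
    fix i j assume "i \<in> {..<N}" "j \<in> {..<N}"
    then have ij: "i < N" "j < N" by auto
    have "power_entry N 1 i j x = mat_entry N i j x" if "i < N" "j < N" for i j
    proof -
      have "power_entry N 1 i j x = (\<Sum>u<N. if u = i then mat_entry N i j x else 0)"
        unfolding One_nat_def power_entry_Suc[OF that]
        by (rule sum.cong) (use that in \<open>auto simp: power_entry_0\<close>)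
      then show ?thesis
        using that by simp
    qed
    then show "power_entry N 1 i j x * power_entry N 1 j i x = h i j + h j i"
      using ij by (auto simp: mat_entry_eq entry_coeff1_def entry_coeff2_def h_def power2_eq_square
          algebra_simps)
  qed
  also have "\<dots> = 2 * (\<Sum>i<N. \<Sum>j<N. h i j)"
  proof -
    have "(\<Sum>i<N. \<Sum>j<N. h j i) = (\<Sum>i<N. \<Sum>j<N. h i j)"
      by (rule sum.swap)
    then show ?thesis
      by (simp add: sum.distrib)
  qed
  also have "\<dots> = 2 * (\<Sum>p\<in>index_set N. h (fst p) (snd p))"
    by (simp add: index_set_def sum.cartesian_product case_prod_unfold)
  finally have "mat_trace (hermitian_mat N x ^\<^sub>m 2) / 2 = (\<Sum>p\<in>index_set N. h (fst p) (snd p))"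
    by simp
  then have "- of_nat N * (mat_trace (hermitian_mat N x ^\<^sub>m 2) / 2)
      = (\<Sum>p\<in>index_set N. - of_nat N * h (fst p) (snd p))"
    by (simp add: sum_distrib_left sum_negf)
  also have "\<dots> = (\<Sum>p\<in>index_set N. of_real (- (gauss_coeff N p * (x p)\<^sup>2 / 2)))"
    by (intro sum.cong) (auto simp: h_def gauss_coeff_def)
  finally show ?thesis
    unfolding gaussian_weight_def coord_weight_def
    by (simp only: exp_sum[OF finite_index_set] exp_of_real)
qed

lemma hermitian_integral_gaussian:
  "hermitian_integral N (\<lambda>M. gaussian_weight N M * f M) = gauss_integral N (\<lambda>x. f (hermitian_mat N x))"
  unfolding hermitian_integral_def gauss_integral_def coord_measure_def index_set_def[symmetric]
    gaussian_weight_hermitian_mat ..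

section \<open>Loop equations\<close>

text \<open>A series with constant term 1 is a unit by the geometric series. It is applied to the
  partition function.\<close>

lemma mfps_cancel:
  assumes "mcoeff f {#} = 1" "f * g = f * (h :: 'a::comm_ring_1 mfps)"
  shows "g = h"
proof -
  have "mcoeff (f - 1) {#} = 0"
    by (simp add: assms mcoeff_one)
  from mfps_geometric[OF this] obtain u where "f * u = 1"
    by auto
  then show ?thesis
    using assms(2) by (metis mult.assoc mult.commute mult_1)
qed

text \<open>The operator \<open>n * d/da_n\<close>. Since the potential contains
  \<open>a_n / n\<close>, it inserts \<open>N\<close> times the trace of the \<open>n\<close>-th
  power into the integral; the factor \<open>n\<close> makes it vanish at index 0.\<close>

definition index_deriv :: "nat \<Rightarrow> 'a::comm_ring_1 mfps \<Rightarrow> 'a mfps"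
  where "index_deriv n F = mconst (of_nat n) * mderiv (n - 1) F"

text \<open>For the free energy this is the generating function of the moments; index \<open>0\<close> is the trace of \<open>1\<close>.\<close>

definition loop_moment :: "nat \<Rightarrow> 'a::comm_ring_1 mfps \<Rightarrow> 'a mfps"
  where "loop_moment n G = (if n = 0 then 1 else index_deriv n G)"

text \<open>The parameter \<open>h\<close> stands for \<open>N^-2\<close> and multiplies the
  connected two-loop functions; \<open>h = 0\<close> is the planar equation, in which products of
  traces factorise. The last sum is the contribution of the interaction.\<close>

definition loop_equation :: "'a::comm_ring_1 \<Rightarrow> 'a mfps \<Rightarrow> bool"
  where "loop_equation h G \<longleftrightarrow> (\<forall>m. loop_moment (Suc m) G =
    (\<Sum>a<m. loop_moment a G * loop_moment (m - 1 - a) G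
      + mconst h * index_deriv a (loop_moment (m - 1 - a) G))
    + msum (\<lambda>k. avar (Suc k) * loop_moment (m + k) G))"

lemma mcoeff_index_deriv:
  "mcoeff (index_deriv (Suc k) F) m = of_nat (Suc k) * of_nat (Suc (count m k)) * mcoeff F (add_mset k m)"
  by (simp add: index_deriv_def mcoeff_mderiv mult.assoc del: of_nat_Suc)

lemma index_deriv_mult: "index_deriv n (f * g) = index_deriv n f * g + f * index_deriv n g"
  by (simp add: index_deriv_def mderiv_mult algebra_simps)

lemma index_deriv_0 [simp]: "index_deriv 0 F = 0"
  by (rule mfps_eqI) (simp add: index_deriv_def)

section \<open>Coefficients of the exponentiated interaction as polynomials in the entries\<close>

definition interaction_power :: "nat \<Rightarrow> nat multiset \<Rightarrow> (nat \<times> nat \<Rightarrow> real) \<Rightarrow> complex"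
  where "interaction_power N m x = mcoeff (mexp (formal_interaction N (hermitian_mat N x))) m"

lemma mcoeff_formal_interaction_empty: "mcoeff (formal_interaction N M) {#} = 0"
  unfolding formal_interaction_def Let_def by (simp add: mcoeff_msum_avar)

lemma mderiv_formal_interaction:
  "mderiv k (formal_interaction N (hermitian_mat N x))
    = mconst (of_nat N * power_trace N (Suc k) x / of_nat (Suc k))"
proof (rule mfps_eqI)
  fix m
  have "mcoeff (mderiv k (formal_interaction N (hermitian_mat N x))) m
      = of_nat (Suc (count m k)) * (of_nat N *
        (\<Sum>l\<in>set_mset (add_mset k m). if add_mset k m - {#l#} = {#}
          then power_trace N (Suc l) x / of_nat (Suc l) else 0))"
    unfolding mcoeff_mderiv formal_interaction_def Let_def
    by (simp only: mcoeff_mconst_mult mcoeff_msum_avar mcoeff_mconst power_trace_def)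
  also have "\<dots> = mcoeff (mconst (of_nat N * power_trace N (Suc k) x / of_nat (Suc k))) m"
  proof (cases "m = {#}")
    case False
    then have "add_mset k m - {#l#} \<noteq> {#}" for l
      by (metis Diff_eq_empty_iff_mset add_mset_eq_single add_mset_subseteq_single_iff size_eq_0_iff_empty)
    then show ?thesis
      using False by (simp add: mcoeff_mconst)
  qed (simp add: mcoeff_mconst)
  finally show "mcoeff (mderiv k (formal_interaction N (hermitian_mat N x))) m
      = mcoeff (mconst (of_nat N * power_trace N (Suc k) x / of_nat (Suc k))) m" .
qed

lemma interaction_power_empty [simp]: "interaction_power N {#} = (\<lambda>x. 1)"
  by (simp add: fun_eq_iff interaction_power_def mcoeff_mexp_empty mcoeff_formal_interaction_empty)

text \<open>The differential equation of the exponential, read coefficientwise. It builds every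
  coefficient from the empty monomial, which permits induction over multisets.\<close>

lemma interaction_power_add_mset:
  "of_nat (Suc (count m k)) * interaction_power N (add_mset k m) x
    = of_nat N * power_trace N (Suc k) x / of_nat (Suc k) * interaction_power N m x"
proof -
  have "of_nat (Suc (count m k)) * interaction_power N (add_mset k m) x
      = mcoeff (mderiv k (mexp (formal_interaction N (hermitian_mat N x)))) m"
    by (simp only: mcoeff_mderiv interaction_power_def)
  also have "\<dots> = of_nat N * power_trace N (Suc k) x / of_nat (Suc k) * interaction_power N m x"
    by (simp only: mderiv_mexp[OF mcoeff_formal_interaction_empty] mderiv_formal_interaction
        mcoeff_mconst_mult interaction_power_def)
  finally show ?thesis .
qed

lemma interaction_power_add_mset':
  "interaction_power N (add_mset k m)
    = (\<lambda>x. (of_nat N / of_nat (Suc k) / of_nat (Suc (count m k))) * (power_trace N (Suc k) x * interaction_power N m x))"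
proof
  fix x
  show "interaction_power N (add_mset k m) x
    = (of_nat N / of_nat (Suc k) / of_nat (Suc (count m k))) * (power_trace N (Suc k) x * interaction_power N m x)"
    using interaction_power_add_mset[of m k N x] by (simp add: field_simps del: of_nat_Suc)
qed

lemma polynomial_fun_interaction_power: "polynomial_fun N (interaction_power N m)"
proof (induction m)
  case empty
  show ?case
    by (simp add: polynomial_fun_const)
next
  case (add k m)
  then show ?case
    unfolding interaction_power_add_mset'
    by (intro polynomial_fun_mult polynomial_fun_const polynomial_fun_power_trace)
qed

text \<open>Chain rule for the exponential: the derivative of the interaction is \<open>N\<close>
  times the sum of \<open>a_(k+1)\<close> times the \<open>k\<close>-th matrix power, since
  differentiating a trace cancels the division by the index.\<close>

lemma entry_deriv_interaction_power:
  assumes "i < N" "j < N"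
  shows "entry_deriv N i j (interaction_power N m)
    (\<lambda>x. \<Sum>k\<in>set_mset m. of_nat N * power_entry N k i j x * interaction_power N (m - {#k#}) x)"
proof (induction m)
  case empty
  show ?case
    by (simp add: entry_deriv_const)
next
  case (add k m)
  let ?e = "interaction_power N" and ?P = "\<lambda>l x. of_nat N * power_entry N l i j x"
  let ?y = "\<lambda>x. of_nat N * power_trace N (Suc k) x / of_nat (Suc k)"
  define c where "c = (of_nat (Suc (count m k)) :: complex)"
  have c: "c \<noteq> 0"
    unfolding c_def by (rule of_nat_neq_0)
  let ?S = "\<lambda>x. \<Sum>l\<in>set_mset m. ?P l x * ?e (m - {#l#}) x"
  have "entry_deriv N i j (\<lambda>x. (of_nat N / of_nat (Suc k)) * power_trace N (Suc k) x)
      (\<lambda>x. (of_nat N / of_nat (Suc k)) * (of_nat (Suc k) * power_entry N k i j x))"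
    by (intro entry_deriv_cmult entry_deriv_power_trace assms)
  then have y: "entry_deriv N i j ?y (?P k)"
    by (simp add: field_simps del: of_nat_Suc)
  have e: "?e (add_mset k m) = (\<lambda>x. (1 / c) * (?y x * ?e m x))"
    unfolding interaction_power_add_mset' c_def by (simp add: fun_eq_iff mult_ac del: of_nat_Suc)
  have "entry_deriv N i j (?e (add_mset k m)) (\<lambda>x. (1 / c) * (?P k x * ?e m x + ?y x * ?S x))"
    unfolding e by (intro entry_deriv_cmult entry_deriv_mult y add.IH)
  moreover have "(1 / c) * (?P k x * ?e m x + ?y x * ?S x)
      = (\<Sum>l\<in>set_mset (add_mset k m). ?P l x * ?e (add_mset k m - {#l#}) x)" for x
  proof -
    \<comment> \<open>Removing \<open>l\<close> different from \<open>k\<close> keeps the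
      multiplicity of \<open>k\<close>, so the recursion has the same constant \<open>c\<close>.
      Removing \<open>k\<close> itself lowers it to \<open>c - 1\<close>, and the missing unit is
      the product-rule term in which \<open>?y\<close> is differentiated.\<close>
    have other: "?y x * ?e (m - {#l#}) x = c * ?e (add_mset k m - {#l#}) x" if "l \<in># m" "l \<noteq> k" for l
      using interaction_power_add_mset[of "m - {#l#}" k N x] that by (simp add: c_def del: of_nat_Suc)
    have same: "?y x * ?e (m - {#k#}) x = (c - 1) * ?e m x" if "k \<in># m"
    proof -
      have "add_mset k (m - {#k#}) = m" "Suc (count (m - {#k#}) k) = count m k"
        using that by auto
      then show ?thesis
        using interaction_power_add_mset[of "m - {#k#}" k N x] by (simp add: c_def)
    qed
    have "?y x * ?S x = (\<Sum>l\<in>set_mset m. ?P l x * (?y x * ?e (m - {#l#}) x))"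
      by (simp add: sum_distrib_left mult_ac)
    also have "\<dots> = (\<Sum>l\<in>set_mset m - {k}. ?P l x * (?y x * ?e (m - {#l#}) x))
        + (c - 1) * (?P k x * ?e m x)"
    proof (cases "k \<in># m")
      case True
      then have "(\<Sum>l\<in>set_mset m. ?P l x * (?y x * ?e (m - {#l#}) x)) = ?P k x * (?y x * ?e (m - {#k#}) x)
          + (\<Sum>l\<in>set_mset m - {k}. ?P l x * (?y x * ?e (m - {#l#}) x))"
        by (intro sum.remove) auto
      then show ?thesis
        unfolding same[OF True] by (simp only: mult_ac add_ac)
    next
      case False
      then show ?thesis
        by (simp add: c_def count_eq_zero_iff)
    qed
    also have "(\<Sum>l\<in>set_mset m - {k}. ?P l x * (?y x * ?e (m - {#l#}) x))
        = c * (\<Sum>l\<in>set_mset m - {k}. ?P l x * ?e (add_mset k m - {#l#}) x)"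
      unfolding sum_distrib_left by (intro sum.cong refl) (use other in auto)
    finally have "?P k x * ?e m x + ?y x * ?S x = c * (?P k x * ?e m x
        + (\<Sum>l\<in>set_mset m - {k}. ?P l x * ?e (add_mset k m - {#l#}) x))"
      by (simp add: algebra_simps)
    also have "?P k x * ?e m x + (\<Sum>l\<in>set_mset m - {k}. ?P l x * ?e (add_mset k m - {#l#}) x)
        = (\<Sum>l\<in>set_mset (add_mset k m). ?P l x * ?e (add_mset k m - {#l#}) x)"
      by (subst sum.remove[of "set_mset (add_mset k m)" k]) auto
    finally show ?thesis
      using c by simp
  qed
  ultimately show ?case
    by simp
qed

context
  fixes N :: nat
  assumes N: "N \<ge> 1"
begin

text \<open>Moments in the interacting ensemble, divided by the Gaussian normalisation only.\<close>

definition weighted_moment :: "((nat \<times> nat \<Rightarrow> real) \<Rightarrow> complex) \<Rightarrow> complex mfps"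
  where "weighted_moment f = Abs_mfps (\<lambda>m.
    gauss_integral N (\<lambda>x. f x * interaction_power N m x) / gauss_integral N (\<lambda>x. 1))"

lemma formal_partition_function_eq: "formal_partition_function N = weighted_moment (\<lambda>x. 1)"
proof -
  have "hermitian_integral N (gaussian_weight N) = gauss_integral N (\<lambda>x. 1)"
    using hermitian_integral_gaussian[of N "\<lambda>x. 1"] by simp
  then show ?thesis
    unfolding formal_partition_function_def weighted_moment_def hermitian_integral_gaussian
    by (simp add: interaction_power_def)
qed

lemma mcoeff_formal_partition_function_empty: "mcoeff (formal_partition_function N) {#} = 1"
  using gauss_integral_1_nonzero[OF N]
  by (simp add: formal_partition_function_eq weighted_moment_def)

text \<open>The factors from \<open>index_deriv\<close> and \<open>mderiv\<close> cancel exactly the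
  divisions by index and multiplicity in \<open>interaction_power_add_mset'\<close>.\<close>

lemma index_deriv_weighted_moment:
  assumes "n \<ge> 1"
  shows "index_deriv n (weighted_moment f) = mconst (of_nat N) * weighted_moment (\<lambda>x. power_trace N n x * f x)"
proof (rule mfps_eqI)
  fix m
  obtain k where n: "n = Suc k"
    using assms by (cases n) auto
  have "gauss_integral N (\<lambda>x. f x * interaction_power N (add_mset k m) x)
      = (of_nat N / of_nat (Suc k) / of_nat (Suc (count m k))) *
        gauss_integral N (\<lambda>x. power_trace N (Suc k) x * f x * interaction_power N m x)"
    unfolding interaction_power_add_mset' gauss_integral_cmult[OF N, symmetric]
    by (intro arg_cong[of _ _ "gauss_integral N"] ext) (simp only: mult_ac)
  then show "mcoeff (index_deriv n (weighted_moment f)) m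
      = mcoeff (mconst (of_nat N) * weighted_moment (\<lambda>x. power_trace N n x * f x)) m"
    unfolding n mcoeff_index_deriv weighted_moment_def
    by (simp add: field_simps del: of_nat_Suc)
qed

text \<open>\<open>schwinger_dyson\<close> is applied to each coefficient of the exponential.
  Differentiating the vertex of index \<open>Suc k\<close> leaves a word of length \<open>k\<close>,
  which is glued to the open word of length \<open>m\<close>.\<close>

lemma weighted_schwinger_dyson:
  "mconst (of_nat N) * weighted_moment (power_trace N (Suc m))
    = (\<Sum>a<m. weighted_moment (\<lambda>x. power_trace N a x * power_trace N (m - 1 - a) x))
    + mconst (of_nat N) * msum (\<lambda>k. avar (Suc k) * weighted_moment (power_trace N (m + k)))"
proof (rule mfps_eqI)
  fix \<mu>
  let ?e = "interaction_power N" and ?I = "gauss_integral N"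
  have "of_nat N * ?I (\<lambda>x. power_trace N (Suc m) x * ?e \<mu> x)
    = (\<Sum>a<m. ?I (\<lambda>x. power_trace N a x * power_trace N (m - 1 - a) x * ?e \<mu> x))
    + ?I (\<lambda>x. \<Sum>i<N. \<Sum>j<N. power_entry N m j i x *
        (\<Sum>k\<in>set_mset \<mu>. of_nat N * power_entry N k i j x * ?e (\<mu> - {#k#}) x))"
    by (intro schwinger_dyson entry_deriv_interaction_power N)
  also have "(\<lambda>x. \<Sum>i<N. \<Sum>j<N. power_entry N m j i x *
        (\<Sum>k\<in>set_mset \<mu>. of_nat N * power_entry N k i j x * ?e (\<mu> - {#k#}) x))
      = (\<lambda>x. \<Sum>k\<in>set_mset \<mu>. of_nat N * (power_trace N (m + k) x * ?e (\<mu> - {#k#}) x))"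
  proof
    fix x
    have tr: "power_trace N (m + k) x = (\<Sum>i<N. \<Sum>j<N. power_entry N m j i x * power_entry N k i j x)" for k
      unfolding power_trace_eq by (subst sum.swap) (simp add: power_entry_add)
    have "(\<Sum>i<N. \<Sum>j<N. power_entry N m j i x *
        (\<Sum>k\<in>set_mset \<mu>. of_nat N * power_entry N k i j x * ?e (\<mu> - {#k#}) x))
      = (\<Sum>i<N. \<Sum>k\<in>set_mset \<mu>. \<Sum>j<N.
          of_nat N * (power_entry N m j i x * power_entry N k i j x * ?e (\<mu> - {#k#}) x))"
      by (subst sum.swap, simp add: sum_distrib_left mult_ac)
    also have "\<dots> = (\<Sum>k\<in>set_mset \<mu>. \<Sum>i<N. \<Sum>j<N.
          of_nat N * (power_entry N m j i x * power_entry N k i j x * ?e (\<mu> - {#k#}) x))"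
      by (rule sum.swap)
    also have "\<dots> = (\<Sum>k\<in>set_mset \<mu>. of_nat N * (power_trace N (m + k) x * ?e (\<mu> - {#k#}) x))"
      unfolding tr by (simp add: sum_distrib_left sum_distrib_right)
    finally show "(\<Sum>i<N. \<Sum>j<N. power_entry N m j i x *
        (\<Sum>k\<in>set_mset \<mu>. of_nat N * power_entry N k i j x * ?e (\<mu> - {#k#}) x)) = \<dots>" .
  qed
  also have "?I (\<lambda>x. \<Sum>k\<in>set_mset \<mu>. of_nat N * (power_trace N (m + k) x * ?e (\<mu> - {#k#}) x))
      = of_nat N * (\<Sum>k\<in>set_mset \<mu>. ?I (\<lambda>x. power_trace N (m + k) x * ?e (\<mu> - {#k#}) x))"
    by (subst gauss_integral_sum[OF N])
      (auto intro!: polynomial_fun_mult polynomial_fun_const polynomial_fun_power_trace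
        polynomial_fun_interaction_power simp: gauss_integral_cmult[OF N] sum_distrib_left)
  finally show "mcoeff (mconst (of_nat N) * weighted_moment (power_trace N (Suc m))) \<mu>
    = mcoeff ((\<Sum>a<m. weighted_moment (\<lambda>x. power_trace N a x * power_trace N (m - 1 - a) x))
    + mconst (of_nat N) * msum (\<lambda>k. avar (Suc k) * weighted_moment (power_trace N (m + k)))) \<mu>"
    unfolding mcoeff_add mcoeff_mconst_mult mcoeff_msum_avar mcoeff_sum weighted_moment_def mcoeff_Abs_mfps
    by (simp add: sum_divide_distrib[symmetric] add_divide_distrib[symmetric])
qed

text \<open>All moments are rewritten through \<open>G\<close>: single traces are
  \<open>N Z W_n\<close>, and products of two traces are \<open>N^2 Z W_a W_b\<close> plus a
  connected part. Cancelling \<open>N^2 Z\<close> in the weighted equation leaves the loop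
  equation.\<close>

lemma loop_equation_formal_partition_function:
  "loop_equation (1 / (of_nat N)\<^sup>2)
    (mconst (1 / (of_nat N)\<^sup>2) * mlog (formal_partition_function N))"
  unfolding loop_equation_def
proof
  fix m
  define Z G where "Z = formal_partition_function N" and "G = mconst (1 / (of_nat N)\<^sup>2) * mlog Z"
  have N0: "(of_nat N :: complex) \<noteq> 0"
    using N by simp
  have Z0: "mcoeff Z {#} = 1"
    unfolding Z_def by (rule mcoeff_formal_partition_function_empty)
  have Zw: "Z = weighted_moment (\<lambda>x. 1)"
    by (simp add: Z_def formal_partition_function_eq)
  define c :: "complex mfps" where "c = mconst (of_nat N)"
  define ci :: "complex mfps" where "ci = mconst (1 / of_nat N)"
  have cc: "c * ci = 1"
    unfolding c_def ci_def mconst_mult[symmetric] using N0 by (simp add: mconst_1)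
  have h: "mconst (1 / (of_nat N)\<^sup>2) = ci * ci"
    unfolding ci_def mconst_mult[symmetric] by (simp add: power2_eq_square)
  \<comment> \<open>The logarithmic derivative of \<open>Z\<close>, with \<open>N^2\<close> undoing
    the scaling in \<open>G\<close>.\<close>
  have dZ: "index_deriv n Z = c * c * Z * index_deriv n G" for n
  proof -
    have "index_deriv n G = mconst (1 / (of_nat N)\<^sup>2) * index_deriv n (mlog Z)"
      by (simp add: G_def index_deriv_def mderiv_mconst_mult mult.left_commute)
    then have "c * c * Z * index_deriv n G = (c * ci) * (c * ci) * (mconst (of_nat n) * (Z * mderiv (n - 1) (mlog Z)))"
      unfolding h by (simp add: index_deriv_def mult_ac)
    then show ?thesis
      by (simp add: cc mderiv_mlog[OF Z0] index_deriv_def)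
  qed
  have c_cancel: "f = g" if "c * f = c * g" for f g
    using that cc by (metis mult.assoc mult.commute mult_1)
  have T: "weighted_moment (power_trace N n) = c * Z * loop_moment n G" for n
  proof (cases "n = 0")
    case True
    have "weighted_moment (power_trace N 0) = c * Z"
      unfolding Zw c_def
      by (rule mfps_eqI) (simp add: weighted_moment_def power_trace_0 gauss_integral_cmult[OF N])
    then show ?thesis
      using True by (simp add: loop_moment_def)
  next
    case False
    then have "c * weighted_moment (power_trace N n) = index_deriv n Z"
      using index_deriv_weighted_moment[of n "\<lambda>x. 1"] by (simp add: Zw c_def)
    also have "\<dots> = c * (c * Z * loop_moment n G)"
      using False by (simp add: dZ loop_moment_def mult_ac)
    finally show ?thesis
      by (rule c_cancel)
  qed
  have index_c: "index_deriv n (c * F) = c * index_deriv n F" for n F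
    by (simp add: index_deriv_def c_def mderiv_mconst_mult mult.left_commute)
  have index_deriv_c: "index_deriv n c = 0" for n
    by (simp add: index_deriv_def c_def)
  \<comment> \<open>Index 0 is separate because \<open>index_deriv 0\<close> is zero and does not
    insert the trace of the identity, which is the constant \<open>N\<close>. For other
    \<open>a\<close> the product rule on \<open>c * Z * loop_moment b G\<close> yields both
    summands.\<close>
  have TT: "weighted_moment (\<lambda>x. power_trace N a x * power_trace N b x)
      = c * c * Z * (loop_moment a G * loop_moment b G) + Z * index_deriv a (loop_moment b G)" for a b
  proof (cases "a = 0")
    case True
    have "weighted_moment (\<lambda>x. power_trace N a x * power_trace N b x) = c * weighted_moment (power_trace N b)"
      unfolding c_def
      by (rule mfps_eqI)
        (simp add: True weighted_moment_def power_trace_0 mult.assoc gauss_integral_cmult[OF N])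
    then show ?thesis
      using True by (simp add: T loop_moment_def mult_ac)
  next
    case False
    then have "c * weighted_moment (\<lambda>x. power_trace N a x * power_trace N b x)
        = index_deriv a (weighted_moment (power_trace N b))"
      using index_deriv_weighted_moment[of a] by (simp add: c_def)
    also have "\<dots> = c * (c * c * Z * (loop_moment a G * loop_moment b G) + Z * index_deriv a (loop_moment b G))"
      using False unfolding T
      by (simp add: index_c index_deriv_mult index_deriv_c dZ mult.assoc distrib_left) (simp add: loop_moment_def mult_ac)
    finally show ?thesis
      by (rule c_cancel)
  qed
  let ?A = "msum (\<lambda>k. avar (Suc k) * loop_moment (m + k) G)"
  let ?S = "\<Sum>a<m. loop_moment a G * loop_moment (m - 1 - a) G
      + ci * ci * index_deriv a (loop_moment (m - 1 - a) G)"
  have "msum (\<lambda>k. avar (Suc k) * weighted_moment (power_trace N (m + k))) = c * Z * ?A"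
  proof -
    have "locally_finite (\<lambda>k. avar (Suc k) * loop_moment (m + k) G)"
      unfolding locally_finite_def
    proof
      fix \<mu>
      have "{k. mcoeff (avar (Suc k) * loop_moment (m + k) G) \<mu> \<noteq> 0} \<subseteq> set_mset \<mu>"
        by (auto simp: mcoeff_avar_mult split: if_splits)
      then show "finite {k. mcoeff (avar (Suc k) * loop_moment (m + k) G) \<mu> \<noteq> 0}"
        by (rule finite_subset) simp
    qed
    then show ?thesis
      unfolding T by (subst msum_mult_left) (simp_all add: mult_ac)
  qed
  then have "c * (c * Z * loop_moment (Suc m) G)
      = (\<Sum>a<m. c * c * Z * (loop_moment a G * loop_moment (m - 1 - a) G)
          + Z * index_deriv a (loop_moment (m - 1 - a) G)) + c * (c * Z * ?A)"
    using weighted_schwinger_dyson[of m] unfolding c_def[symmetric] T TT by simp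
  also have "\<dots> = c * (c * Z * (?S + ?A))"
  proof -
    have "Z * f = c * c * Z * (ci * ci * f)" for f
    proof -
      have "c * c * Z * (ci * ci * f) = (c * ci) * (c * ci) * (Z * f)"
        by (simp only: mult_ac)
      then show ?thesis
        by (simp add: cc)
    qed
    then have "(\<Sum>a<m. c * c * Z * (loop_moment a G * loop_moment (m - 1 - a) G)
          + Z * index_deriv a (loop_moment (m - 1 - a) G)) = c * c * Z * ?S"
      unfolding sum_distrib_left by (intro sum.cong refl) (simp add: distrib_left)
    then show ?thesis
      by (simp add: distrib_left mult.assoc)
  qed
  finally have "c * (c * (Z * loop_moment (Suc m) G)) = c * (c * (Z * (?S + ?A)))"
    by (simp only: mult.assoc)
  from mfps_cancel[OF Z0 c_cancel[OF c_cancel[OF this]]]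
  have "loop_moment (Suc m) G = ?S + ?A" .
  then show "loop_moment (Suc m) (mconst (1 / (of_nat N)\<^sup>2) * mlog (formal_partition_function N)) =
    (\<Sum>a<m. loop_moment a (mconst (1 / (of_nat N)\<^sup>2) * mlog (formal_partition_function N)) *
        loop_moment (m - 1 - a) (mconst (1 / (of_nat N)\<^sup>2) * mlog (formal_partition_function N))
      + mconst (1 / (of_nat N)\<^sup>2) * index_deriv a
        (loop_moment (m - 1 - a) (mconst (1 / (of_nat N)\<^sup>2) * mlog (formal_partition_function N))))
    + msum (\<lambda>k. avar (Suc k) *
        loop_moment (m + k) (mconst (1 / (of_nat N)\<^sup>2) * mlog (formal_partition_function N)))"
    unfolding G_def Z_def h .
qed

end

section \<open>The genus expansion\<close>

text \<open>The grading in which the variable with index \<open>n\<close> has degree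
  \<open>n\<close>. It is the measure of the recursion below and, after substitution, the exponent
  of \<open>fps_X\<close>.\<close>

definition weight :: "nat multiset \<Rightarrow> nat"
  where "weight m = sum_mset (image_mset Suc m)"

lemma weight_empty [simp]: "weight {#} = 0"
  by (simp add: weight_def)

lemma weight_add_mset [simp]: "weight (add_mset k m) = Suc k + weight m"
  by (simp add: weight_def)

lemma weight_union [simp]: "weight (m + n) = weight m + weight n"
  by (simp add: weight_def)

lemma weight_mono: "k \<subseteq># m \<Longrightarrow> weight k \<le> weight m"
  by (metis le_add1 subset_mset.add_diff_inverse weight_union)

lemma weight_remove: "k \<in># m \<Longrightarrow> weight m = Suc k + weight (m - {#k#})"
  by (metis insert_DiffM weight_add_mset)

text \<open>A single polynomial over the rationals has to serve all \<open>N\<close> at once; its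
  coefficients become the genus contributions.\<close>

definition rational_poly :: "(nat \<Rightarrow> complex) \<Rightarrow> bool"
  where "rational_poly f \<longleftrightarrow> (\<exists>p. \<forall>N\<ge>1. f N = of_rat (poly p (1 / (of_nat N)\<^sup>2)))"

lemma rational_poly_of_rat: "rational_poly (\<lambda>N. of_rat c)"
  unfolding rational_poly_def by (rule exI[of _ "[:c:]"]) simp

lemma rational_poly_of_nat: "rational_poly (\<lambda>N. of_nat n)"
  using rational_poly_of_rat[of "of_nat n"] by simp

lemma rational_poly_0: "rational_poly (\<lambda>N. 0)"
  using rational_poly_of_nat[of 0] by simp

lemma rational_poly_1: "rational_poly (\<lambda>N. 1)"
  using rational_poly_of_nat[of 1] by simp

lemma rational_poly_inverse_square: "rational_poly (\<lambda>N. 1 / (of_nat N)\<^sup>2)"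
  unfolding rational_poly_def
  by (rule exI[of _ "[:0, 1:]"]) (simp add: of_rat_divide of_rat_power)

lemma rational_poly_add:
  assumes "rational_poly f" "rational_poly g"
  shows "rational_poly (\<lambda>N. f N + g N)"
proof -
  obtain p q where "\<forall>N\<ge>1. f N = of_rat (poly p (1 / (of_nat N)\<^sup>2))"
      "\<forall>N\<ge>1. g N = of_rat (poly q (1 / (of_nat N)\<^sup>2))"
    using assms unfolding rational_poly_def by blast
  then show ?thesis
    unfolding rational_poly_def by (intro exI[of _ "p + q"]) (simp add: of_rat_add)
qed

lemma rational_poly_mult:
  assumes "rational_poly f" "rational_poly g"
  shows "rational_poly (\<lambda>N. f N * g N)"
proof -
  obtain p q where "\<forall>N\<ge>1. f N = of_rat (poly p (1 / (of_nat N)\<^sup>2))"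
      "\<forall>N\<ge>1. g N = of_rat (poly q (1 / (of_nat N)\<^sup>2))"
    using assms unfolding rational_poly_def by blast
  then show ?thesis
    unfolding rational_poly_def by (intro exI[of _ "p * q"]) (simp add: of_rat_mult)
qed

lemma rational_poly_sum:
  "(\<And>a. a \<in> A \<Longrightarrow> rational_poly (f a)) \<Longrightarrow> rational_poly (\<lambda>N. \<Sum>a\<in>A. f a N)"
  by (induction A rule: infinite_finite_induct) (auto intro: rational_poly_add rational_poly_0)

lemma rational_poly_cong: "(\<And>N. N \<ge> 1 \<Longrightarrow> f N = g N) \<Longrightarrow> rational_poly f \<longleftrightarrow> rational_poly g"
  unfolding rational_poly_def by (metis (no_types, lifting))

lemma mcoeff_loop_equation:
  assumes "loop_equation h G"
  shows "of_nat (Suc k) * of_nat (Suc (count m k)) * mcoeff G (add_mset k m)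
    = (\<Sum>a<k. (\<Sum>j | j \<subseteq># m. mcoeff (loop_moment a G) j * mcoeff (loop_moment (k - 1 - a) G) (m - j))
        + h * mcoeff (index_deriv a (loop_moment (k - 1 - a) G)) m)
    + (\<Sum>l\<in>set_mset m. mcoeff (loop_moment (k + l) G) (m - {#l#}))"
proof -
  have "of_nat (Suc k) * of_nat (Suc (count m k)) * mcoeff G (add_mset k m)
      = mcoeff (loop_moment (Suc k) G) m"
    by (simp add: loop_moment_def mcoeff_index_deriv)
  also have "loop_moment (Suc k) G = (\<Sum>a<k. loop_moment a G * loop_moment (k - 1 - a) G
      + mconst h * index_deriv a (loop_moment (k - 1 - a) G))
      + msum (\<lambda>l. avar (Suc l) * loop_moment (k + l) G)"
    using assms unfolding loop_equation_def by blast
  finally show ?thesis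
    by (simp only: mcoeff_add mcoeff_sum mcoeff_mult[of "loop_moment _ _"] mcoeff_mconst_mult mcoeff_msum_avar)
qed

text \<open>The equation with index \<open>Suc k\<close>, read at the monomial \<open>n\<close>,
  determines the coefficient of \<open>add_mset k n\<close>. In every term on the right, index and
  monomial together have smaller weight than \<open>Suc k + weight n\<close>, also in the term where
  \<open>index_deriv\<close> enlarges the monomial.\<close>

lemma rational_poly_loop_solution:
  assumes G0: "\<And>N. N \<ge> 1 \<Longrightarrow> mcoeff (G N) {#} = 0"
    and G: "\<And>N. N \<ge> 1 \<Longrightarrow> loop_equation (1 / (of_nat N)\<^sup>2) (G N)"
  shows "rational_poly (\<lambda>N. mcoeff (G N) m)"
proof (induction m rule: measure_induct_rule[of weight])
  case (less m)
  show ?case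
  proof (cases m)
    case empty
    then show ?thesis
      using rational_poly_0 rational_poly_cong[of "\<lambda>N. mcoeff (G N) m" "\<lambda>N. 0"] G0 by auto
  next
    case (add k n)
    \<comment> \<open>For positive \<open>a\<close> this coefficient of \<open>loop_moment a\<close>
      is a multiple of the coefficient of \<open>G\<close> at \<open>add_mset (a - 1) j\<close>, of
      weight \<open>a + weight j\<close>.\<close>
    have loop_moment: "rational_poly (\<lambda>N. mcoeff (loop_moment a (G N)) j)"
      if "weight j + a < weight m" for a j
    proof (cases a)
      case 0
      then show ?thesis
        by (simp add: loop_moment_def mcoeff_one rational_poly_0 rational_poly_1)
    next
      case (Suc l)
      then have "rational_poly (\<lambda>N. mcoeff (G N) (add_mset l j))"
        using that by (intro less.IH) simp
      then have "rational_poly (\<lambda>N. of_nat (Suc l) * of_nat (Suc (count j l)) * mcoeff (G N) (add_mset l j))"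
        by (intro rational_poly_mult rational_poly_of_nat)
      then show ?thesis
        using Suc by (simp only: loop_moment_def mcoeff_index_deriv nat.distinct if_False)
    qed
    have "rational_poly (\<lambda>N. mcoeff (index_deriv a (loop_moment b (G N))) n)" if "a + b < k" for a b
    proof (cases a)
      case 0
      then show ?thesis
        by (simp add: rational_poly_0)
    next
      case (Suc l)
      have "rational_poly (\<lambda>N. mcoeff (loop_moment b (G N)) (add_mset l n))"
        by (rule loop_moment) (use Suc add that in auto)
      then have "rational_poly (\<lambda>N. of_nat (Suc l) * of_nat (Suc (count n l)) *
          mcoeff (loop_moment b (G N)) (add_mset l n))"
        by (intro rational_poly_mult rational_poly_of_nat)
      then show ?thesis
        using Suc by (simp only: mcoeff_index_deriv)
    qed
    moreover have "rational_poly (\<lambda>N. mcoeff (loop_moment a (G N)) j)"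
      if "a < k" "j \<subseteq># n" for a j
      by (rule loop_moment) (use weight_mono[OF that(2)] that(1) add in auto)
    moreover have "rational_poly (\<lambda>N. mcoeff (loop_moment (k + l) (G N)) (n - {#l#}))" if "l \<in># n" for l
      by (rule loop_moment) (use weight_remove[OF that] add in auto)
    ultimately have "rational_poly (\<lambda>N.
        (\<Sum>a<k. (\<Sum>j | j \<subseteq># n. mcoeff (loop_moment a (G N)) j * mcoeff (loop_moment (k - 1 - a) (G N)) (n - j))
        + 1 / (of_nat N)\<^sup>2 * mcoeff (index_deriv a (loop_moment (k - 1 - a) (G N))) n)
        + (\<Sum>l\<in>set_mset n. mcoeff (loop_moment (k + l) (G N)) (n - {#l#})))"
      by (intro rational_poly_add rational_poly_mult rational_poly_sum rational_poly_inverse_square) auto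
    also have "?this \<longleftrightarrow> rational_poly (\<lambda>N. of_nat (Suc k) * of_nat (Suc (count n k)) * mcoeff (G N) m)"
      by (rule rational_poly_cong) (simp only: add mcoeff_loop_equation[OF G])
    finally have "rational_poly (\<lambda>N. of_rat (1 / (of_nat (Suc k) * of_nat (Suc (count n k)))) *
        (of_nat (Suc k) * of_nat (Suc (count n k)) * mcoeff (G N) m))"
      by (rule rational_poly_mult[OF rational_poly_of_rat])
    then show ?thesis
      by (simp add: of_rat_divide of_rat_mult del: of_nat_Suc)
  qed
qed

section \<open>Existence, uniqueness and planar limit of the genus expansion\<close>

definition scaled_free_energy :: "nat \<Rightarrow> complex mfps"
  where "scaled_free_energy N = mconst (1 / (of_nat N)\<^sup>2) * mlog (formal_partition_function N)"

lemma scaled_free_energy_empty: "N \<ge> 1 \<Longrightarrow> mcoeff (scaled_free_energy N) {#} = 0"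
  by (simp add: scaled_free_energy_def mcoeff_mlog_empty mcoeff_formal_partition_function_empty)

lemma mcoeff_mlog_partition:
  assumes "N \<ge> 1"
  shows "mcoeff (mlog (formal_partition_function N)) m = (of_nat N)\<^sup>2 * mcoeff (scaled_free_energy N) m"
  using assms by (simp add: scaled_free_energy_def)

lemma power_int_genus:
  fixes x :: "'a::field"
  assumes "x \<noteq> 0"
  shows "x powi (2 - 2 * int g) = x\<^sup>2 * (1 / x\<^sup>2) ^ g"
  using assms by (simp add: power_int_diff power_int_mult power_divide)

lemma genus_expansion_exists: "\<exists>F. genus_expansion F"
proof -
  have "rational_poly (\<lambda>N. mcoeff (scaled_free_energy N) m)" for m
    by (rule rational_poly_loop_solution[OF scaled_free_energy_empty])
      (auto simp: scaled_free_energy_def intro: loop_equation_formal_partition_function)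
  then obtain p where p: "\<And>m N. N \<ge> 1 \<Longrightarrow>
      mcoeff (scaled_free_energy N) m = of_rat (poly (p m) (1 / (of_nat N)\<^sup>2))"
    unfolding rational_poly_def by metis
  \<comment> \<open>Genus \<open>g\<close> collects the coefficients of \<open>(N^-2)^g\<close>;
    each \<open>p m\<close> has finite degree, which is local finiteness of
    \<open>F\<close>.\<close>
  define F :: "nat \<Rightarrow> rat mfps" where "F g = Abs_mfps (\<lambda>m. coeff (p m) g)" for g
  have "locally_finite F"
    unfolding locally_finite_def
  proof
    fix m
    have "{g. mcoeff (F g) m \<noteq> 0} \<subseteq> {..degree (p m)}"
      by (auto simp: F_def le_degree)
    then show "finite {g. mcoeff (F g) m \<noteq> 0}"
      by (rule finite_subset) simp
  qed
  moreover have "mlog (formal_partition_function N)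
      = msum (\<lambda>g. mconst (of_nat N powi (2 - 2 * int g)) * map_mfps of_rat (F g))" if N: "N \<ge> 1" for N
  proof (rule mfps_eqI)
    fix m
    have "mcoeff (msum (\<lambda>g. mconst ((of_nat N :: complex) powi (2 - 2 * int g)) * map_mfps of_rat (F g))) m
        = (\<Sum>g\<le>degree (p m). of_nat N powi (2 - 2 * int g) * of_rat (coeff (p m) g))"
      by (subst mcoeff_msum[of "{..degree (p m)}"])
        (auto simp: map_mfps_def F_def coeff_eq_0)
    also have "\<dots> = (\<Sum>g\<le>degree (p m). (of_nat N)\<^sup>2 * of_rat (coeff (p m) g * (1 / (of_nat N)\<^sup>2) ^ g))"
      by (intro sum.cong refl, subst power_int_genus)
        (use N in \<open>simp_all add: of_rat_mult of_rat_divide of_rat_power mult_ac\<close>)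
    also have "\<dots> = mcoeff (mlog (formal_partition_function N)) m"
      by (simp add: mcoeff_mlog_partition[OF N] p[OF N] poly_altdef of_rat_sum sum_distrib_left)
    finally show "mcoeff (mlog (formal_partition_function N)) m
        = mcoeff (msum (\<lambda>g. mconst (of_nat N powi (2 - 2 * int g)) * map_mfps of_rat (F g))) m" ..
  qed
  ultimately show ?thesis
    unfolding genus_expansion_def by blast
qed

text \<open>Local finiteness makes the contributions of all genera at a fixed monomial the
  coefficients of one polynomial in \<open>N^-2\<close>.\<close>

lemma genus_expansion_poly:
  assumes "genus_expansion F"
  obtains p :: "rat poly" where "\<And>g. mcoeff (F g) m = coeff p g"
    "\<And>N. N \<ge> 1 \<Longrightarrow> mcoeff (scaled_free_energy N) m = of_rat (poly p (1 / (of_nat N)\<^sup>2))"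
proof -
  have fin: "finite {g. mcoeff (F g) m \<noteq> 0}"
    using assms by (auto simp: genus_expansion_def locally_finite_def)
  define p where "p = Abs_poly (\<lambda>g. mcoeff (F g) m)"
  have p: "coeff p g = mcoeff (F g) m" for g
    unfolding p_def using fin by (subst Abs_poly_inverse) (auto simp: MOST_iff_cofinite)
  have "mcoeff (scaled_free_energy N) m = of_rat (poly p (1 / (of_nat N)\<^sup>2))" if N: "N \<ge> 1" for N
  proof -
    have "(of_nat N)\<^sup>2 * mcoeff (scaled_free_energy N) m
        = mcoeff (msum (\<lambda>g. mconst (of_nat N powi (2 - 2 * int g)) * map_mfps of_rat (F g))) m"
      using assms N by (simp add: mcoeff_mlog_partition[symmetric] genus_expansion_def)
    also have "\<dots> = (\<Sum>g\<le>degree p. of_nat N powi (2 - 2 * int g) * of_rat (coeff p g))"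
      by (subst mcoeff_msum[of "{..degree p}"]) (auto simp: map_mfps_def p[symmetric] coeff_eq_0)
    also have "\<dots> = (\<Sum>g\<le>degree p. (of_nat N)\<^sup>2 * of_rat (coeff p g * (1 / (of_nat N)\<^sup>2) ^ g))"
      by (intro sum.cong refl, subst power_int_genus)
        (use N in \<open>simp_all add: of_rat_mult of_rat_divide of_rat_power mult_ac\<close>)
    also have "\<dots> = (of_nat N)\<^sup>2 * of_rat (poly p (1 / (of_nat N)\<^sup>2))"
      by (simp add: poly_altdef of_rat_sum sum_distrib_left)
    finally show ?thesis
      using N by simp
  qed
  then show thesis
    using p that by metis
qed

lemma infinite_inverse_squares: "infinite ((\<lambda>N. 1 / (of_nat N)\<^sup>2 :: rat) ` {1..})"
proof -
  have "inj_on (\<lambda>N. 1 / (of_nat N)\<^sup>2 :: rat) {1..}"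
  proof (rule inj_onI)
    fix x y :: nat
    assume "x \<in> {1..}" "y \<in> {1..}" "1 / (of_nat x)\<^sup>2 = (1 / (of_nat y)\<^sup>2 :: rat)"
    then have "(of_nat x :: rat)\<^sup>2 = (of_nat y)\<^sup>2"
      by (simp add: field_simps)
    then show "x = y"
      by (metis of_nat_eq_iff of_nat_power power2_eq_iff_nonneg zero_le)
  qed
  then show ?thesis
    using finite_imageD infinite_Ici by blast
qed

text \<open>Two such polynomials agree at \<open>N^-2\<close> for every positive \<open>N\<close>,
  that is at infinitely many points.\<close>

lemma genus_expansion_unique:
  assumes "genus_expansion F" "genus_expansion F'"
  shows "F = F'"
proof (intro ext mfps_eqI)
  fix g m
  obtain p where p: "\<And>g. mcoeff (F g) m = coeff p g"
    "\<And>N. N \<ge> 1 \<Longrightarrow> mcoeff (scaled_free_energy N) m = of_rat (poly p (1 / (of_nat N)\<^sup>2))"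
    using genus_expansion_poly[OF assms(1)] by blast
  obtain q where q: "\<And>g. mcoeff (F' g) m = coeff q g"
    "\<And>N. N \<ge> 1 \<Longrightarrow> mcoeff (scaled_free_energy N) m = of_rat (poly q (1 / (of_nat N)\<^sup>2))"
    using genus_expansion_poly[OF assms(2)] by blast
  have "(\<lambda>N. 1 / (of_nat N)\<^sup>2 :: rat) ` {1..} \<subseteq> {x. poly (p - q) x = 0}"
    using p(2) q(2) by auto
  then have "infinite {x. poly (p - q) x = 0}"
    using infinite_inverse_squares finite_subset by blast
  then have "p - q = 0"
    using poly_roots_finite by blast
  then show "mcoeff (F g) m = mcoeff (F' g) m"
    using p q by simp
qed

text \<open>The planar part is the value at 0 of the polynomial in \<open>N^-2\<close>. This turns
  the abstract choice of the expansion into a limit that passes through the loop equation.\<close>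

lemma planar_free_energy_tendsto:
  "(\<lambda>N. mcoeff (scaled_free_energy N) m) \<longlonglongrightarrow> of_rat (mcoeff planar_free_energy m)"
proof -
  obtain F where F: "genus_expansion F"
    using genus_expansion_exists by blast
  then have "(THE F. genus_expansion F) = F"
    using genus_expansion_unique by blast
  then have planar: "planar_free_energy = F 0"
    by (simp add: planar_free_energy_def)
  obtain p :: "rat poly" where p: "\<And>g. mcoeff (F g) m = coeff p g"
    "\<And>N. N \<ge> 1 \<Longrightarrow> mcoeff (scaled_free_energy N) m = of_rat (poly p (1 / (of_nat N)\<^sup>2))"
    using genus_expansion_poly[OF F] by blast
  define q where "q = map_poly (of_rat :: rat \<Rightarrow> complex) p"
  have q: "of_rat (poly p x) = poly q (of_rat x)" for x
    unfolding q_def poly_altdef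
    by (simp add: of_rat_sum of_rat_mult of_rat_power coeff_map_poly degree_map_poly)
  have "(\<lambda>N. 1 / (of_nat N :: complex)\<^sup>2) \<longlonglongrightarrow> 0"
    using tendsto_power[OF lim_1_over_n[where 'a = complex], of 2] by (simp add: power_divide)
  then have "(\<lambda>N. poly q (1 / (of_nat N)\<^sup>2)) \<longlonglongrightarrow> poly q 0"
    by (rule tendsto_poly)
  moreover have "poly q 0 = of_rat (mcoeff planar_free_energy m)"
    using q[of 0] by (simp add: planar p(1) poly_0_coeff_0)
  moreover have "eventually (\<lambda>N. poly q (1 / (of_nat N)\<^sup>2) = mcoeff (scaled_free_energy N) m) sequentially"
    using eventually_ge_at_top[of 1] by eventually_elim (simp add: p(2) q of_rat_divide of_rat_power)
  ultimately show ?thesis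
    using tendsto_cong by force
qed

lemma planar_free_energy_empty: "mcoeff planar_free_energy {#} = 0"
proof -
  have "(\<lambda>N. mcoeff (scaled_free_energy N) {#}) \<longlonglongrightarrow> 0"
    by (rule tendsto_eventually)
      (use eventually_ge_at_top[of 1] in eventually_elim, simp add: scaled_free_energy_empty)
  from LIMSEQ_unique[OF this planar_free_energy_tendsto] show ?thesis
    by simp
qed

text \<open>Each coefficient of the loop equation is a finite expression in coefficients of the
  scaled free energy, so the limit may be taken termwise; the connected term dies because its factor
  \<open>1 / N^2\<close> tends to 0.\<close>

lemma loop_equation_planar_free_energy: "loop_equation 0 planar_free_energy"
  unfolding loop_equation_def
proof (intro allI mfps_eqI)
  fix k n
  let ?G = scaled_free_energy and ?F = planar_free_energy
  have moment: "(\<lambda>N. mcoeff (loop_moment a (?G N)) j) \<longlonglongrightarrow> of_rat (mcoeff (loop_moment a ?F) j)" for a j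
  proof (cases a)
    case 0
    then show ?thesis
      by (simp add: loop_moment_def mcoeff_one)
  next
    case (Suc l)
    have "(\<lambda>N. of_nat (Suc l) * of_nat (Suc (count j l)) * mcoeff (?G N) (add_mset l j))
        \<longlonglongrightarrow> of_nat (Suc l) * of_nat (Suc (count j l)) * of_rat (mcoeff ?F (add_mset l j))"
      by (intro tendsto_mult tendsto_const planar_free_energy_tendsto)
    then show ?thesis
      using Suc by (simp add: loop_moment_def mcoeff_index_deriv of_rat_mult del: of_nat_Suc)
  qed
  have deriv: "(\<lambda>N. mcoeff (index_deriv a (loop_moment b (?G N))) n)
      \<longlonglongrightarrow> of_rat (mcoeff (index_deriv a (loop_moment b ?F)) n)" for a b
  proof (cases a)
    case (Suc l)
    have "(\<lambda>N. of_nat (Suc l) * of_nat (Suc (count n l)) * mcoeff (loop_moment b (?G N)) (add_mset l n))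
        \<longlonglongrightarrow> of_nat (Suc l) * of_nat (Suc (count n l)) * of_rat (mcoeff (loop_moment b ?F) (add_mset l n))"
      by (intro tendsto_mult tendsto_const moment)
    then show ?thesis
      using Suc by (simp add: mcoeff_index_deriv of_rat_mult del: of_nat_Suc)
  qed simp
  have lim: "(\<lambda>N. 1 / (of_nat N :: complex)\<^sup>2) \<longlonglongrightarrow> 0"
    using tendsto_power[OF lim_1_over_n[where 'a = complex], of 2] by (simp add: power_divide)
  let ?R = "\<lambda>N. (\<Sum>a<k. (\<Sum>j | j \<subseteq># n. mcoeff (loop_moment a (?G N)) j * mcoeff (loop_moment (k - 1 - a) (?G N)) (n - j))
        + 1 / (of_nat N)\<^sup>2 * mcoeff (index_deriv a (loop_moment (k - 1 - a) (?G N))) n)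
        + (\<Sum>l\<in>set_mset n. mcoeff (loop_moment (k + l) (?G N)) (n - {#l#}))"
  have "?R \<longlonglongrightarrow> (\<Sum>a<k. (\<Sum>j | j \<subseteq># n. of_rat (mcoeff (loop_moment a ?F) j) * of_rat (mcoeff (loop_moment (k - 1 - a) ?F) (n - j)))
        + 0 * of_rat (mcoeff (index_deriv a (loop_moment (k - 1 - a) ?F)) n))
        + (\<Sum>l\<in>set_mset n. of_rat (mcoeff (loop_moment (k + l) ?F) (n - {#l#})))"
    by (intro tendsto_add tendsto_sum tendsto_mult moment deriv lim)
  then have R: "?R \<longlonglongrightarrow> of_rat (mcoeff ((\<Sum>a<k. loop_moment a ?F * loop_moment (k - 1 - a) ?F
      + mconst 0 * index_deriv a (loop_moment (k - 1 - a) ?F))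
      + msum (\<lambda>l. avar (Suc l) * loop_moment (k + l) ?F)) n)"
    unfolding mcoeff_add mcoeff_sum mcoeff_mult[of "loop_moment _ _"] mcoeff_mconst_mult mcoeff_msum_avar
    by (simp add: of_rat_add of_rat_sum of_rat_mult)
  have "eventually (\<lambda>N. mcoeff (loop_moment (Suc k) (?G N)) n = ?R N) sequentially"
    using eventually_ge_at_top[of 1]
  proof eventually_elim
    case (elim N)
    then have "loop_equation (1 / (of_nat N)\<^sup>2) (?G N)"
      unfolding scaled_free_energy_def by (rule loop_equation_formal_partition_function)
    from mcoeff_loop_equation[OF this, of k n] show ?case
      by (simp add: loop_moment_def mcoeff_index_deriv)
  qed
  from tendsto_cong[OF this] moment[of "Suc k" n]
  have "?R \<longlonglongrightarrow> of_rat (mcoeff (loop_moment (Suc k) ?F) n)"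
    by blast
  from LIMSEQ_unique[OF this R]
  show "mcoeff (loop_moment (Suc k) ?F) n
      = mcoeff ((\<Sum>a<k. loop_moment a ?F * loop_moment (k - 1 - a) ?F
      + mconst 0 * index_deriv a (loop_moment (k - 1 - a) ?F))
      + msum (\<lambda>l. avar (Suc l) * loop_moment (k + l) ?F)) n"
    by (simp only: of_rat_eq_iff)
qed

unbundle no vec_syntax
no_notation vec_index (infixl "$" 100)

section \<open>Substitution of one-variable series\<close>

lemma weight_diff: "k \<subseteq># m \<Longrightarrow> weight (m - k) = weight m - weight k"
  by (metis add_diff_cancel_left' subset_mset.add_diff_inverse weight_union)

text \<open>A nonempty multiset of weight at most \<open>Suc d\<close> arises by adding an element
  \<open>k \<le> d\<close> to one of weight at most \<open>d\<close>. Hence each coefficient after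
  substitution is a finite sum.\<close>

lemma finite_weight_le: "finite {m. weight m \<le> d}"
proof (induction d)
  case 0
  have "{m. weight m \<le> 0} \<subseteq> {{#}}"
  proof
    fix m assume "m \<in> {m. weight m \<le> 0}"
    then show "m \<in> {{#}}"
      by (cases m) auto
  qed
  then show ?case
    using finite_subset by blast
next
  case (Suc d)
  have "{m. weight m \<le> Suc d} \<subseteq> {{#}} \<union> (\<Union>k\<le>d. add_mset k ` {m. weight m \<le> d})"
  proof
    fix m assume m: "m \<in> {m. weight m \<le> Suc d}"
    show "m \<in> {{#}} \<union> (\<Union>k\<le>d. add_mset k ` {m. weight m \<le> d})"
    proof (cases m)
      case (add k n)
      with m have "k \<le> d" "n \<in> {m. weight m \<le> d}"
        by auto
      with add show ?thesis
        by blast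
    qed simp
  qed
  moreover have "finite ({{#}} \<union> (\<Union>k\<le>d. add_mset k ` {m. weight m \<le> d}))"
    using Suc by simp
  ultimately show ?case
    by (rule finite_subset)
qed

lemma finite_weight: "finite {m. weight m = d}"
  by (rule finite_subset[OF _ finite_weight_le[of d]]) auto

lemma fps_nth_X_power_const_mult:
  "(fps_const e * fps_X ^ n * f) $ d = (if n \<le> d then e * f $ (d - n) else 0)"
proof -
  have "(fps_const e * fps_X ^ n * f) $ d = e * (fps_X ^ n * f) $ d"
    by (simp only: mult.assoc fps_mult_left_const_nth)
  then show ?thesis
    by (simp add: fps_X_power_mult_nth)
qed

text \<open>Homogeneity sends the monomial \<open>m\<close> to a scalar times the power of
  \<open>fps_X\<close> with exponent \<open>weight m\<close>. The three potentials are the case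
  where each \<open>\<epsilon> k\<close> is 0 or 1.\<close>

locale graded_substitution =
  fixes c :: "nat \<Rightarrow> 'a::comm_ring_1 fps" and \<epsilon> :: "nat \<Rightarrow> 'a"
  assumes c_Suc: "c (Suc k) = fps_const (\<epsilon> k) * fps_X ^ Suc k"
begin

definition \<epsilon>_prod :: "nat multiset \<Rightarrow> 'a"
  where "\<epsilon>_prod m = prod_mset (image_mset \<epsilon> m)"

lemma \<epsilon>_prod_simps [simp]:
  "\<epsilon>_prod {#} = 1" "\<epsilon>_prod (add_mset k m) = \<epsilon> k * \<epsilon>_prod m"
  "\<epsilon>_prod (m + n) = \<epsilon>_prod m * \<epsilon>_prod n"
  by (simp_all add: \<epsilon>_prod_def)

lemma prod_mset_c: "(\<Prod>k\<in>#m. c (Suc k)) = fps_const (\<epsilon>_prod m) * fps_X ^ weight m"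
proof (induction m)
  case (add k m)
  have "(\<Prod>k\<in>#add_mset k m. c (Suc k)) = fps_const (\<epsilon> k) * fps_X ^ Suc k * (fps_const (\<epsilon>_prod m) * fps_X ^ weight m)"
    using add by (simp add: c_Suc)
  also have "\<dots> = fps_const (\<epsilon> k * \<epsilon>_prod m) * fps_X ^ (Suc k + weight m)"
    by (simp only: power_add fps_const_mult[symmetric] mult_ac)
  finally show ?case
    by simp
qed simp

lemma msubst_nth: "msubst c f $ d = (\<Sum>m | weight m = d. \<epsilon>_prod m * mcoeff f m)"
proof -
  have "msubst c f $ d = (\<Sum>m | weight m = d. mcoeff f m * (\<Prod>k\<in>#m. c (Suc k)) $ d)"
    unfolding msubst_def fps_nth_Abs_fps
    by (rule Sum_any.expand_superset) (auto simp: finite_weight prod_mset_c fps_X_power_nth)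
  then show ?thesis
    by (simp add: prod_mset_c mult.commute)
qed

lemma msubst_add: "msubst c (f + g) = msubst c f + msubst c g"
  by (rule fps_ext) (simp add: msubst_nth distrib_left sum.distrib)

lemma msubst_sum: "msubst c (sum f A) = (\<Sum>i\<in>A. msubst c (f i))"
proof (rule fps_ext)
  fix d
  show "msubst c (sum f A) $ d = (\<Sum>i\<in>A. msubst c (f i)) $ d"
    by (simp add: msubst_nth sum_distrib_left fps_sum_nth, rule sum.swap)
qed

lemma msubst_mconst: "msubst c (mconst a) = fps_const a"
proof (rule fps_ext)
  fix d
  have "msubst c (mconst a) $ d = (\<Sum>m | weight m = d. if m = {#} then a else 0)"
    unfolding msubst_nth by (rule sum.cong) (auto simp: mcoeff_mconst)
  then show "msubst c (mconst a) $ d = fps_const a $ d"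
    by (simp add: finite_weight)
qed

lemma msubst_1: "msubst c 1 = 1"
  using msubst_mconst[of 1] by (simp add: mconst_1)

lemma msubst_of_nat: "msubst c (of_nat n) = of_nat n"
  by (simp add: of_nat_eq_mconst msubst_mconst fps_of_nat)

text \<open>Decompositions of monomials of weight \<open>d\<close> correspond to pairs of monomials
  whose weights add up to \<open>d\<close>.\<close>

lemma msubst_mult: "msubst c (f * g) = msubst c f * msubst c g"
proof (rule fps_ext)
  fix d
  let ?A = "\<lambda>d. {m. weight m = d}"
  have "msubst c (f * g) $ d = (\<Sum>m\<in>?A d. \<Sum>j | j \<subseteq># m. \<epsilon>_prod m * (mcoeff f j * mcoeff g (m - j)))"
    by (simp add: msubst_nth mcoeff_mult sum_distrib_left)
  also have "\<dots> = (\<Sum>(m, j)\<in>Sigma (?A d) (\<lambda>m. {j. j \<subseteq># m}). \<epsilon>_prod m * (mcoeff f j * mcoeff g (m - j)))"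
    by (rule sum.Sigma) (auto simp: finite_weight finite_submultisets)
  also have "\<dots> = (\<Sum>(i, j, l)\<in>Sigma {0..d} (\<lambda>i. ?A i \<times> ?A (d - i)). \<epsilon>_prod (j + l) * (mcoeff f j * mcoeff g l))"
    by (rule sum.reindex_bij_witness[where i = "\<lambda>(i, j, l). (j + l, j)" and j = "\<lambda>(m, j). (weight j, j, m - j)"])
       (auto simp: weight_mono weight_diff simp flip: \<epsilon>_prod_simps(3))
  also have "\<dots> = (\<Sum>i=0..d. \<Sum>(j, l)\<in>?A i \<times> ?A (d - i). \<epsilon>_prod (j + l) * (mcoeff f j * mcoeff g l))"
    by (rule sum.Sigma[symmetric]) (auto simp: finite_weight)
  also have "\<dots> = (\<Sum>i=0..d. msubst c f $ i * msubst c g $ (d - i))"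
    by (intro sum.cong refl)
      (simp add: msubst_nth sum_product sum.cartesian_product case_prod_unfold mult_ac)
  finally show "msubst c (f * g) $ d = (msubst c f * msubst c g) $ d"
    by (simp add: fps_mult_nth)
qed

lemma msubst_power: "msubst c (f ^ n) = msubst c f ^ n"
  by (induction n) (simp_all add: msubst_1 msubst_mult)

text \<open>Since \<open>c (Suc k)\<close> is divisible by \<open>fps_X ^ Suc k\<close>, only
  \<open>k < d\<close> can reach the coefficient \<open>d\<close>; the infinite sum becomes
  finite.\<close>

lemma msubst_msum_avar:
  "msubst c (msum (\<lambda>k. avar (Suc k) * f k)) $ d = (\<Sum>k<d. (c (Suc k) * msubst c (f k)) $ d)"
proof -
  let ?A = "\<lambda>d. {m. weight m = d}"
  have "msubst c (msum (\<lambda>k. avar (Suc k) * f k)) $ d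
      = (\<Sum>m\<in>?A d. \<Sum>k\<in>set_mset m. \<epsilon>_prod m * mcoeff (f k) (m - {#k#}))"
    by (simp add: msubst_nth mcoeff_msum_avar sum_distrib_left)
  also have "\<dots> = (\<Sum>(m, k)\<in>Sigma (?A d) set_mset. \<epsilon>_prod m * mcoeff (f k) (m - {#k#}))"
    by (rule sum.Sigma) (auto simp: finite_weight)
  also have "\<dots> = (\<Sum>(k, n)\<in>Sigma {..<d} (\<lambda>k. ?A (d - Suc k)). \<epsilon>_prod (add_mset k n) * mcoeff (f k) n)"
    by (rule sum.reindex_bij_witness[where i = "\<lambda>(k, n). (add_mset k n, k)" and j = "\<lambda>(m, k). (k, m - {#k#})"])
       (auto dest: weight_remove simp flip: \<epsilon>_prod_simps(2))
  also have "\<dots> = (\<Sum>k<d. \<Sum>n\<in>?A (d - Suc k). \<epsilon>_prod (add_mset k n) * mcoeff (f k) n)"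
    by (rule sum.Sigma[symmetric]) (auto simp: finite_weight)
  also have "\<dots> = (\<Sum>k<d. (c (Suc k) * msubst c (f k)) $ d)"
    by (intro sum.cong refl)
      (simp only: c_Suc fps_nth_X_power_const_mult msubst_nth, simp add: sum_distrib_left mult.assoc)
  finally show ?thesis .
qed

end

section \<open>The substituted planar loop equation\<close>

text \<open>Stated coefficientwise, because the interaction sum over all \<open>k\<close> is finite
  only at a fixed coefficient \<open>d\<close>.\<close>

definition loop_system :: "(nat \<Rightarrow> 'a::comm_ring_1 fps) \<Rightarrow> (nat \<Rightarrow> 'a fps) \<Rightarrow> bool"
  where "loop_system c W \<longleftrightarrow> W 0 = 1 \<and> (\<forall>m d. W (Suc m) $ d =
    (\<Sum>a<m. W a * W (m - 1 - a)) $ d + (\<Sum>k<d. (c (Suc k) * W (m + k)) $ d))"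

context graded_substitution
begin

lemma loop_system_msubst:
  assumes "loop_equation 0 F"
  shows "loop_system c (\<lambda>n. msubst c (loop_moment n F))"
  unfolding loop_system_def
proof (intro conjI allI)
  show "msubst c (loop_moment 0 F) = 1"
    by (simp add: loop_moment_def msubst_1)
next
  fix m d
  have "mconst 0 * g = 0" for g :: "'a mfps"
    by (rule mfps_eqI) simp
  then have "loop_moment (Suc m) F = (\<Sum>a<m. loop_moment a F * loop_moment (m - 1 - a) F)
      + msum (\<lambda>k. avar (Suc k) * loop_moment (m + k) F)"
    using assms unfolding loop_equation_def by simp
  then show "msubst c (loop_moment (Suc m) F) $ d =
      (\<Sum>a<m. msubst c (loop_moment a F) * msubst c (loop_moment (m - 1 - a) F)) $ d
      + (\<Sum>k<d. (c (Suc k) * msubst c (loop_moment (m + k) F)) $ d)"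
    by (simp only: msubst_add msubst_sum msubst_mult fps_add_nth msubst_msum_avar)
qed

text \<open>Induction on moment index plus coefficient index. The interaction raises the moment
  index to \<open>m + k\<close> but lowers the coefficient index to \<open>d - Suc k\<close>, so
  their sum drops to \<open>m + d - 1\<close>.\<close>

lemma loop_system_unique:
  assumes W: "loop_system c W" and V: "loop_system c V"
  shows "W n = V n"
proof -
  have "W n $ d = V n $ d" if "n + d = s" for n d s
    using that
  proof (induction s arbitrary: n d rule: less_induct)
    case (less s)
    show ?case
    proof (cases n)
      case 0
      then show ?thesis
        using W V by (simp add: loop_system_def)
    next
      case (Suc m)
      have "(W a * W (m - 1 - a)) $ d = (V a * V (m - 1 - a)) $ d" if "a < m" for a
        unfolding fps_mult_nth
        by (intro sum.cong refl arg_cong2[of _ _ _ _ "(*)"]; rule less.IH[OF _ refl])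
          (use that Suc less.prems in auto)
      moreover have "(c (Suc k) * W (m + k)) $ d = (c (Suc k) * V (m + k)) $ d" if "k < d" for k
      proof -
        have "W (m + k) $ (d - Suc k) = V (m + k) $ (d - Suc k)"
          by (rule less.IH[OF _ refl]) (use that Suc less.prems in auto)
        then show ?thesis
          unfolding c_Suc fps_nth_X_power_const_mult by simp
      qed
      ultimately have "(\<Sum>a<m. W a * W (m - 1 - a)) $ d + (\<Sum>k<d. (c (Suc k) * W (m + k)) $ d)
          = (\<Sum>a<m. V a * V (m - 1 - a)) $ d + (\<Sum>k<d. (c (Suc k) * V (m + k)) $ d)"
        by (simp add: fps_sum_nth)
      then show ?thesis
        using W V Suc by (simp add: loop_system_def)
    qed
  qed
  then show ?thesis
    by (intro fps_ext) blast
qed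

text \<open>
  Euler's identity: the loop equation for the second moment contains the sum of \<open>n a\<^sub>n\<close> times the
  derivative with respect to \<open>a\<^sub>n\<close>.
\<close>

lemma msubst_euler:
  assumes "loop_equation 0 F"
  shows "fps_X * fps_deriv (msubst c F) = msubst c (loop_moment 2 F) - 1"
proof -
  have weight_eq: "weight m = (\<Sum>k\<in>set_mset m. Suc k * count m k)" for m
  proof (induction m)
    case (add k m)
    have "(\<Sum>l\<in>set_mset (add_mset k m). Suc l * count (add_mset k m) l)
        = (\<Sum>l\<in>insert k (set_mset m). Suc l * count m l + (if l = k then Suc k else 0))"
      by (intro sum.cong) auto
    also have "\<dots> = (\<Sum>l\<in>insert k (set_mset m). Suc l * count m l) + Suc k"
      by (simp only: sum.distrib sum.delta finite_insert finite_set_mset insertI1 if_True)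
    also have "(\<Sum>l\<in>insert k (set_mset m). Suc l * count m l) = (\<Sum>l\<in>set_mset m. Suc l * count m l)"
      by (rule sum.mono_neutral_right) (auto simp: count_eq_zero_iff)
    finally show ?case
      using add by simp
  qed simp
  have coeff: "mcoeff (loop_moment 2 F) m = mcoeff 1 m + of_nat (weight m) * mcoeff F m" for m
  proof -
    have "loop_moment 2 F = (\<Sum>a<1. loop_moment a F * loop_moment (1 - 1 - a) F
        + mconst 0 * index_deriv a (loop_moment (1 - 1 - a) F))
        + msum (\<lambda>k. avar (Suc k) * loop_moment (1 + k) F)"
      using assms unfolding loop_equation_def by (metis Suc_1)
    then have "mcoeff (loop_moment 2 F) m = mcoeff 1 m
        + (\<Sum>k\<in>set_mset m. mcoeff (loop_moment (Suc k) F) (m - {#k#}))"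
      by (simp add: mcoeff_msum_avar loop_moment_def)
    also have "(\<Sum>k\<in>set_mset m. mcoeff (loop_moment (Suc k) F) (m - {#k#}))
        = (\<Sum>k\<in>set_mset m. of_nat (Suc k * count m k) * mcoeff F m)"
    proof (intro sum.cong refl)
      fix k assume k: "k \<in> set_mset m"
      then have "Suc (count (m - {#k#}) k) = count m k" "add_mset k (m - {#k#}) = m"
        by auto
      then show "mcoeff (loop_moment (Suc k) F) (m - {#k#}) = of_nat (Suc k * count m k) * mcoeff F m"
        by (simp only: loop_moment_def mcoeff_index_deriv nat.distinct if_False of_nat_mult)
    qed
    finally show ?thesis
      by (simp add: weight_eq sum_distrib_right)
  qed
  show ?thesis
  proof (rule fps_ext)
    fix d
    have "msubst c (loop_moment 2 F) $ d = msubst c 1 $ d + (\<Sum>m | weight m = d. of_nat d * (\<epsilon>_prod m * mcoeff F m))"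
      unfolding msubst_nth coeff distrib_left sum.distrib by (simp add: mult_ac)
    then have "msubst c (loop_moment 2 F) $ d = 1 $ d + of_nat d * msubst c F $ d"
      by (simp add: msubst_1 msubst_nth[of F] sum_distrib_left)
    then show "(fps_X * fps_deriv (msubst c F)) $ d = (msubst c (loop_moment 2 F) - 1) $ d"
      by (cases d) auto
  qed
qed

lemma msubst_nth_0: "msubst c F $ 0 = mcoeff F {#}"
proof -
  have "{m. weight m = 0} = {{#}}"
  proof -
    have "m = {#}" if "weight m = 0" for m
      using that by (cases m) auto
    then show ?thesis
      by auto
  qed
  then show ?thesis
    by (simp add: msubst_nth)
qed

end

section \<open>The series R and S\<close>

text \<open>Over an arbitrary commutative ring, so that the same expression serves before and after
  substitution.\<close>

definition system_R :: "nat \<Rightarrow> 'a::comm_ring_1 \<Rightarrow> 'a \<Rightarrow> 'a"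
  where "system_R n R S =
    (\<Sum>j=1..n. of_nat (((n - 1) choose (j - 1)) * ((n - j) choose j)) * R ^ j * S ^ (n - 2 * j))"

definition system_S :: "nat \<Rightarrow> 'a::comm_ring_1 \<Rightarrow> 'a \<Rightarrow> 'a"
  where "system_S n R S =
    (\<Sum>j=0..n. of_nat (((n - 1) choose (2 * j)) * ((2 * j) choose j)) * R ^ j * S ^ (n - 2 * j - 1))"

section \<open>Contractions on series in infinitely many variables and the system for R and
  S\<close>

definition agree_below :: "nat \<Rightarrow> 'a mfps \<Rightarrow> 'a mfps \<Rightarrow> bool"
  where "agree_below n f g \<longleftrightarrow> (\<forall>m. size m < n \<longrightarrow> mcoeff f m = mcoeff g m)"

lemma agree_below_refl: "agree_below n f f"
  by (simp add: agree_below_def)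

lemma agree_below_add: "agree_below n f f' \<Longrightarrow> agree_below n g g' \<Longrightarrow> agree_below n (f + g) (f' + g')"
  by (simp add: agree_below_def)

lemma agree_below_sum:
  "(\<And>i. i \<in> A \<Longrightarrow> agree_below n (f i) (g i)) \<Longrightarrow> agree_below n (sum f A) (sum g A)"
  by (simp add: agree_below_def)

lemma agree_below_mult:
  assumes "agree_below n f f'" "agree_below n g g'"
  shows "agree_below n (f * g) (f' * g')"
  unfolding agree_below_def mcoeff_mult
proof (intro allI impI sum.cong refl)
  fix m k :: "nat multiset" assume mk: "size m < n" "k \<in> {k. k \<subseteq># m}"
  then have "size k < n" "size (m - k) < n"
    by (auto dest: size_mset_mono) (metis le_less_trans diff_subset_eq_self size_mset_mono)
  then show "mcoeff f k * mcoeff g (m - k) = mcoeff f' k * mcoeff g' (m - k)"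
    using assms by (simp add: agree_below_def)
qed

lemma agree_below_power: "agree_below n f g \<Longrightarrow> agree_below n (f ^ k) (g ^ k)"
  by (induction k) (auto intro: agree_below_mult agree_below_refl)

text \<open>The extra variable gains one order of agreement; this is what makes the system a
  contraction.\<close>

lemma agree_below_msum_avar:
  assumes "\<And>k. agree_below n (f k) (g k)"
  shows "agree_below (Suc n) (msum (\<lambda>k. avar (Suc k) * f k)) (msum (\<lambda>k. avar (Suc k) * g k))"
  unfolding agree_below_def mcoeff_msum_avar
proof (intro allI impI sum.cong refl)
  fix m and k :: nat assume mk: "size m < Suc n" "k \<in> set_mset m"
  then have "size (m - {#k#}) < n"
    by (simp add: size_Diff_singleton)
      (metis Suc_pred less_antisym not_less_eq nonempty_has_size set_mset_eq_empty_iff equals0D)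
  then show "mcoeff (f k) (m - {#k#}) = mcoeff (g k) (m - {#k#})"
    using assms by (simp add: agree_below_def)
qed

text \<open>Banach's fixed point theorem for the filtration by monomial size: the iterates stabilise
  in each coefficient, and two fixed points agree to every order.\<close>

lemma mfps_pair_fixpoint:
  fixes \<Phi> :: "'a::zero mfps \<times> 'a mfps \<Rightarrow> 'a mfps \<times> 'a mfps"
  assumes contract: "\<And>n x y. agree_below n (fst x) (fst y) \<and> agree_below n (snd x) (snd y) \<Longrightarrow>
    agree_below (Suc n) (fst (\<Phi> x)) (fst (\<Phi> y)) \<and> agree_below (Suc n) (snd (\<Phi> x)) (snd (\<Phi> y))"
  shows "\<exists>!x. \<Phi> x = x"
proof -
  define A where "A = (\<lambda>n x y. agree_below n (fst x) (fst y) \<and> agree_below n (snd x) (snd (y :: 'a mfps \<times> 'a mfps)))"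
  have A_sym: "A n x y \<Longrightarrow> A n y x" and A_trans: "A n x y \<Longrightarrow> A n y z \<Longrightarrow> A n x z"
    and A_mono: "A n x y \<Longrightarrow> k \<le> n \<Longrightarrow> A k x y" for n k x y z
    by (auto simp: A_def agree_below_def)
  have A_step: "A n x y \<Longrightarrow> A (Suc n) (\<Phi> x) (\<Phi> y)" for n x y
    using contract by (simp add: A_def)
  have A_eq: "x = y" if "\<And>n. A n x y" for x y
    using that by (intro prod_eqI mfps_eqI) (auto simp: A_def agree_below_def)
  define z :: "'a mfps \<times> 'a mfps" where "z = (Abs_mfps (\<lambda>_. 0), Abs_mfps (\<lambda>_. 0))"
  define x where "x = (\<lambda>n. (\<Phi> ^^ n) z)"
  have x_Suc: "x (Suc n) = \<Phi> (x n)" for n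
    by (simp add: x_def)
  have "A n (x n) (x (Suc n))" for n
  proof (induction n)
    case 0
    show ?case by (simp add: A_def agree_below_def)
  next
    case (Suc n)
    then show ?case using A_step x_Suc by metis
  qed
  note step = this
  have x: "A n (x n) (x (n + k))" for n k
  proof (induction k)
    case 0
    show ?case
      by (simp add: A_def agree_below_refl)
  next
    case (Suc k)
    have "A n (x (n + k)) (x (n + Suc k))"
      using A_mono[OF step[of "n + k"], of n] by simp
    then show ?case
      by (rule A_trans[OF Suc])
  qed
  \<comment> \<open>The coefficient at \<open>m\<close> no longer changes after
    \<open>Suc (size m)\<close> iterations.\<close>
  define y where "y = (Abs_mfps (\<lambda>m. mcoeff (fst (x (Suc (size m)))) m),
      Abs_mfps (\<lambda>m. mcoeff (snd (x (Suc (size m)))) m))"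
  have y: "A n y (x n)" for n
  proof -
    have "mcoeff (fst (x (Suc (size m)))) m = mcoeff (fst (x n)) m \<and>
        mcoeff (snd (x (Suc (size m)))) m = mcoeff (snd (x n)) m" if "size m < n" for m
    proof -
      have "A (Suc (size m)) (x (Suc (size m))) (x (Suc (size m) + (n - Suc (size m))))"
        by (rule x)
      then show ?thesis
        using that by (simp add: A_def agree_below_def)
    qed
    then show ?thesis
      by (simp add: A_def agree_below_def y_def)
  qed
  have "\<Phi> y = y"
  proof (rule A_eq)
    fix n
    have "A (Suc n) (\<Phi> y) y"
      using A_step[OF y[of n]] A_sym[OF y[of "Suc n"]] A_trans unfolding x_Suc by blast
    then show "A n (\<Phi> y) y"
      by (rule A_mono) simp
  qed
  moreover have "w = y" if "\<Phi> w = w" for w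
  proof (rule A_eq)
    fix n
    show "A n w y"
    proof (induction n)
      case 0
      show ?case by (simp add: A_def agree_below_def)
    next
      case (Suc n)
      from A_step[OF this] show ?case
        using that \<open>\<Phi> y = y\<close> by simp
    qed
  qed
  ultimately show ?thesis
    by blast
qed

lemma RS_system_iff: "RS_system R S \<longleftrightarrow>
    R = 1 + msum (\<lambda>k. avar (Suc k) * system_R (Suc k) R S) \<and>
    S = msum (\<lambda>k. avar (Suc k) * system_S (Suc k) R S)"
proof -
  have "mcoeff (1 + msum (\<lambda>k. avar (Suc k) * f k)) {#} = 1"
    "mcoeff (msum (\<lambda>k. avar (Suc k) * f k)) {#} = 0" for f :: "nat \<Rightarrow> rat mfps"
    by (simp_all add: mcoeff_msum_avar mcoeff_one)
  note empty = this
  show ?thesis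
  proof
    assume "RS_system R S"
    then show "R = 1 + msum (\<lambda>k. avar (Suc k) * system_R (Suc k) R S) \<and>
        S = msum (\<lambda>k. avar (Suc k) * system_S (Suc k) R S)"
      unfolding RS_system_def system_R_def system_S_def Let_def by blast
  next
    assume *: "R = 1 + msum (\<lambda>k. avar (Suc k) * system_R (Suc k) R S) \<and>
        S = msum (\<lambda>k. avar (Suc k) * system_S (Suc k) R S)"
    then have "mcoeff R {#} = 1" "mcoeff S {#} = 0"
      using empty by metis+
    with * show "RS_system R S"
      unfolding RS_system_def system_R_def system_S_def Let_def by blast
  qed
qed

lemma RS_system_series: "RS_system series_R series_S"
proof -
  define \<Phi> :: "rat mfps \<times> rat mfps \<Rightarrow> rat mfps \<times> rat mfps" where
    "\<Phi> = (\<lambda>(R, S). (1 + msum (\<lambda>k. avar (Suc k) * system_R (Suc k) R S),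
                      msum (\<lambda>k. avar (Suc k) * system_S (Suc k) R S)))"
  have "\<exists>!x. \<Phi> x = x"
    by (rule mfps_pair_fixpoint)
      (auto simp: \<Phi>_def case_prod_unfold system_R_def system_S_def intro!: agree_below_add agree_below_refl
        agree_below_msum_avar agree_below_sum agree_below_mult agree_below_power)
  moreover have "RS_system R S \<longleftrightarrow> \<Phi> (R, S) = (R, S)" for R S
    unfolding RS_system_iff \<Phi>_def by auto
  ultimately have "\<exists>!x. (\<lambda>(R, S). RS_system R S) x"
    by (simp add: case_prod_unfold)
  from theI'[OF this] show ?thesis
    by (simp add: series_R_def series_S_def case_prod_unfold)
qed

definition substituted_RS_system :: "(nat \<Rightarrow> 'a::comm_ring_1 fps) \<Rightarrow> 'a fps \<Rightarrow> 'a fps \<Rightarrow> bool"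
  where "substituted_RS_system c R S \<longleftrightarrow> (\<forall>d.
    R $ d = 1 $ d + (\<Sum>k<d. (c (Suc k) * system_R (Suc k) R S) $ d) \<and>
    S $ d = (\<Sum>k<d. (c (Suc k) * system_S (Suc k) R S) $ d))"

context graded_substitution
begin

text \<open>The factor \<open>fps_X ^ Suc k\<close> in \<open>c (Suc k)\<close> makes coefficient
  \<open>n\<close> of both series depend only on their coefficients below \<open>n\<close>.\<close>

lemma substituted_RS_system_unique:
  assumes RS: "substituted_RS_system c R S" and RS': "substituted_RS_system c R' S'"
  shows "R = R' \<and> S = S'"
proof -
  define A where "A = (\<lambda>n f g :: 'a fps. \<forall>i<n. f $ i = g $ i)"
  have mult: "A n (f * g) (f' * g')" if "A n f f'" "A n g g'" for n f g f' g'
    unfolding A_def fps_mult_nth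
  proof (intro allI impI sum.cong refl)
    fix i j assume "i < n" "j \<in> {0..i}"
    then show "f $ j * g $ (i - j) = f' $ j * g' $ (i - j)"
      using that by (simp add: A_def)
  qed
  have refl: "A n f f" for n f
    by (simp add: A_def)
  have power: "A n (f ^ k) (g ^ k)" if "A n f g" for n f g k
    by (induction k) (use that refl mult in auto)
  have sum: "A n (sum f B) (sum g B)" if "\<And>i. i \<in> B \<Longrightarrow> A n (f i) (g i)" for n B and f g :: "nat \<Rightarrow> 'a fps"
    using that by (simp add: A_def fps_sum_nth)
  have c: "(c (Suc k) * f) $ d = (c (Suc k) * g) $ d" if "A d f g" "k < d" for k d f g
    unfolding c_Suc fps_nth_X_power_const_mult using that by (simp add: A_def)
  have "A n R R' \<and> A n S S'" for n
  proof (induction n)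
    case (Suc n)
    then have "A n (system_R k R S) (system_R k R' S')" "A n (system_S k R S) (system_S k R' S')" for k
      unfolding system_R_def system_S_def by (auto intro!: sum mult power refl)
    then have "(\<Sum>k<n. (c (Suc k) * system_R (Suc k) R S) $ n) = (\<Sum>k<n. (c (Suc k) * system_R (Suc k) R' S') $ n)"
      "(\<Sum>k<n. (c (Suc k) * system_S (Suc k) R S) $ n) = (\<Sum>k<n. (c (Suc k) * system_S (Suc k) R' S') $ n)"
      by (auto intro!: sum.cong c)
    then have "R $ n = R' $ n" "S $ n = S' $ n"
      using RS RS' unfolding substituted_RS_system_def by simp_all
    then show ?case
      using Suc by (auto simp: A_def less_Suc_eq)
  qed (simp add: A_def)
  then show ?thesis
    by (auto intro!: fps_ext simp: A_def)
qed

end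

lemma substituted_RS_system_series:
  assumes "graded_substitution c \<epsilon>"
  shows "substituted_RS_system c (msubst c series_R) (msubst c series_S)"
proof -
  interpret graded_substitution c \<epsilon> by fact
  let ?R = "msubst c series_R" and ?S = "msubst c series_S"
  have hom: "msubst c (system_R n series_R series_S) = system_R n ?R ?S"
    "msubst c (system_S n series_R series_S) = system_S n ?R ?S" for n
    by (simp_all only: system_R_def system_S_def msubst_sum msubst_mult msubst_of_nat msubst_power)
  have "series_R = 1 + msum (\<lambda>k. avar (Suc k) * system_R (Suc k) series_R series_S)"
    "series_S = msum (\<lambda>k. avar (Suc k) * system_S (Suc k) series_R series_S)"
    using RS_system_series unfolding RS_system_iff by blast+
  then have "?R $ d = msubst c (1 + msum (\<lambda>k. avar (Suc k) * system_R (Suc k) series_R series_S)) $ d"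
    "?S $ d = msubst c (msum (\<lambda>k. avar (Suc k) * system_S (Suc k) series_R series_S)) $ d" for d
    by metis+
  then show ?thesis
    unfolding substituted_RS_system_def by (simp only: msubst_add msubst_1 fps_add_nth msubst_msum_avar hom simp_thms)
qed

section \<open>Generating functions of three-step walks\<close>

text \<open>\<open>walk R S n j\<close> is the coefficient of \<open>z\<^sup>j\<close> in the \<open>n\<close>-th power of \<open>z + S + R / z\<close>.\<close>

fun walk :: "'a::comm_ring_1 \<Rightarrow> 'a \<Rightarrow> nat \<Rightarrow> int \<Rightarrow> 'a" where
  "walk R S 0 j = (if j = 0 then 1 else 0)"
| "walk R S (Suc n) j = walk R S n (j - 1) + S * walk R S n j + R * walk R S n (j + 1)"

text \<open>Multiplying \<open>z + S + R / z\<close> by \<open>z\<close> gives the polynomial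
  \<open>R + S z + z^2\<close>, so exponents of the \<open>n\<close>-th power are shifted by
  \<open>n\<close>.\<close>

lemma walk_eq_coeff:
  "walk R S n j = (if j + int n \<ge> 0 then coeff ([:R, S, 1:] ^ n) (nat (j + int n)) else 0)"
proof (induction n arbitrary: j)
  case 0
  show ?case
    by (auto simp: coeff_1)
next
  case (Suc n)
  define P where "P = [:R, S, 1:] ^ n"
  have P: "[:R, S, 1:] ^ Suc n = Polynomial.smult R P + pCons 0 (Polynomial.smult S P + pCons 0 P)"
    by (simp add: P_def)
  consider "j + int (Suc n) < 0" | "j + int (Suc n) = 0" | "j + int (Suc n) = 1" | "j + int (Suc n) \<ge> 2"
    by linarith
  then show ?case
  proof cases
    case 3
    then have j: "j = - int n"
      by simp
    then have *: "nat (j + int (Suc n)) = 1" "nat (j + 1 + int n) = 1" "nat (j + int n) = 0"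
      by auto
    show ?thesis
      unfolding P walk.simps(2) Suc.IH P_def[symmetric] using j * by simp
  next
    case 4
    then have "j + int (Suc n) = int (Suc (Suc (nat (j + int (Suc n) - 2))))"
      by simp
    then obtain i where i: "j + int (Suc n) = int (Suc (Suc i))"
      by blast
    then have *: "nat (j + int (Suc n)) = Suc (Suc i)" "nat (j + 1 + int n) = Suc (Suc i)"
      "nat (j + int n) = Suc i" "nat (j - 1 + int n) = i"
      by auto
    show ?thesis
      unfolding P walk.simps(2) Suc.IH P_def[symmetric] using i * by simp
  qed (simp_all add: P walk.simps(2) Suc.IH P_def[symmetric] del: power_Suc)
qed

text \<open>The binomial theorem twice: \<open>n - m\<close> factors contribute the level step
  \<open>S\<close>, and \<open>j\<close> of the other \<open>m\<close> contribute \<open>R\<close>.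
  The exponent condition is additive to avoid truncated subtraction.\<close>

lemma coeff_trinomial_power:
  "coeff ([:R, S, 1:] ^ n) i = (\<Sum>m\<le>n. \<Sum>j\<le>m. if n + m = i + 2 * j
    then of_nat ((n choose m) * (m choose j)) * R ^ j * S ^ (n - m) else (0 :: 'a::comm_ring_1))"
proof -
  have 1: "[:R, S, 1:] = [:R, 0, 1:] + monom S 1"
    by (simp add: monom_altdef)
  have 2: "[:R, 0, 1:] = [:R:] + monom (1 :: 'a) 2"
    by (simp add: monom_altdef numeral_2_eq_2)
  have "[:R, S, 1:] ^ n = (\<Sum>m\<le>n. of_nat (n choose m) * ([:R:] + monom 1 2) ^ m * monom S 1 ^ (n - m))"
    unfolding 1 2 binomial_ring[of _ "monom S 1"] ..
  also have "\<dots> = (\<Sum>m\<le>n. \<Sum>j\<le>m. of_nat (n choose m) *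
      (of_nat (m choose j) * [:R:] ^ j * monom 1 2 ^ (m - j)) * monom S 1 ^ (n - m))"
    unfolding binomial_ring[of "[:R:]"] by (simp add: sum_distrib_left sum_distrib_right)
  also have "\<dots> = (\<Sum>m\<le>n. \<Sum>j\<le>m.
      monom (of_nat ((n choose m) * (m choose j)) * R ^ j * S ^ (n - m)) (2 * (m - j) + (n - m)))"
  proof (intro sum.cong refl)
    fix m j
    have "[:R:] ^ j = monom (R ^ j) 0"
      by (simp add: monom_0 poly_const_pow)
    then show "of_nat (n choose m) * (of_nat (m choose j) * [:R:] ^ j * monom 1 2 ^ (m - j)) * monom S 1 ^ (n - m)
      = monom (of_nat ((n choose m) * (m choose j)) * R ^ j * S ^ (n - m)) (2 * (m - j) + (n - m))"
      by (simp add: of_nat_monom monom_power mult_monom mult_ac add.commute)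
  qed
  finally have "coeff ([:R, S, 1:] ^ n) i = (\<Sum>m\<le>n. \<Sum>j\<le>m. if 2 * (m - j) + (n - m) = i
    then of_nat ((n choose m) * (m choose j)) * R ^ j * S ^ (n - m) else 0)"
    by (simp only: coeff_sum coeff_monom)
  also have "\<dots> = (\<Sum>m\<le>n. \<Sum>j\<le>m. if n + m = i + 2 * j
    then of_nat ((n choose m) * (m choose j)) * R ^ j * S ^ (n - m) else 0)"
  proof (intro sum.cong refl)
    fix m j assume "m \<in> {..n}" "j \<in> {..m}"
    then have "2 * (m - j) + (n - m) = i \<longleftrightarrow> n + m = i + 2 * j"
      by auto
    then show "(if 2 * (m - j) + (n - m) = i
        then of_nat ((n choose m) * (m choose j)) * R ^ j * S ^ (n - m) else 0)
      = (if n + m = i + 2 * j then of_nat ((n choose m) * (m choose j)) * R ^ j * S ^ (n - m) else 0)"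
      by simp
  qed
  finally show ?thesis .
qed

lemma coeff_trinomial_power':
  "coeff ([:R, S, 1:] ^ n) i = (\<Sum>j\<le>Suc n. \<Sum>m\<le>n. if n + m = i + 2 * j
    then of_nat ((n choose m) * (m choose j)) * R ^ j * S ^ (n - m) else (0 :: 'a::comm_ring_1))"
proof -
  let ?f = "\<lambda>m j. if n + m = i + 2 * j
    then of_nat ((n choose m) * (m choose j)) * R ^ j * S ^ (n - m) else (0 :: 'a)"
  have "coeff ([:R, S, 1:] ^ n) i = (\<Sum>m\<le>n. \<Sum>j\<le>m. ?f m j)"
    by (rule coeff_trinomial_power)
  also have "\<dots> = (\<Sum>m\<le>n. \<Sum>j\<le>Suc n. ?f m j)"
    by (rule sum.cong[OF refl], rule sum.mono_neutral_left) (auto simp: binomial_eq_0)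
  also have "\<dots> = (\<Sum>j\<le>Suc n. \<Sum>m\<le>n. ?f m j)"
    by (rule sum.swap)
  finally show ?thesis .
qed

text \<open>Closed walks have \<open>j\<close> steps down and \<open>j\<close> steps up among
  \<open>2 * j\<close> non-level ones, so the inner sum reduces to \<open>m = 2 * j\<close>.\<close>

lemma system_S_eq_walk: "system_S (Suc n) R S = walk R S n 0"
proof -
  have "walk R S n 0 = (\<Sum>j\<le>Suc n. \<Sum>m\<le>n. if n + m = n + 2 * j
    then of_nat ((n choose m) * (m choose j)) * R ^ j * S ^ (n - m) else 0)"
    unfolding walk_eq_coeff coeff_trinomial_power'[symmetric] by simp
  also have "\<dots> = (\<Sum>j\<le>Suc n. of_nat ((n choose (2 * j)) * ((2 * j) choose j)) * R ^ j * S ^ (n - 2 * j))"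
  proof (intro sum.cong refl)
    fix j
    have "(\<Sum>m\<le>n. if n + m = n + 2 * j
        then of_nat ((n choose m) * (m choose j)) * R ^ j * S ^ (n - m) else 0)
      = (\<Sum>m\<le>n. if m = 2 * j
        then of_nat ((n choose (2 * j)) * ((2 * j) choose j)) * R ^ j * S ^ (n - 2 * j) else 0)"
      by (intro sum.cong) auto
    then show "(\<Sum>m\<le>n. if n + m = n + 2 * j
        then of_nat ((n choose m) * (m choose j)) * R ^ j * S ^ (n - m) else 0)
      = of_nat ((n choose (2 * j)) * ((2 * j) choose j)) * R ^ j * S ^ (n - 2 * j)"
      by (cases "2 * j \<le> n") (simp_all add: binomial_eq_0)
  qed
  finally show ?thesis
    by (simp add: system_S_def atLeast0AtMost del: sum.atMost_Suc)
qed

text \<open>Walks ending one level lower have \<open>j\<close> steps down and \<open>j - 1\<close>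
  up, hence \<open>m = 2 * j - 1\<close> non-level steps.\<close>

lemma system_R_eq_walk: "system_R (Suc n) R S = walk R S n (- 1)"
proof (cases n)
  case 0
  then show ?thesis
    by (simp add: system_R_def)
next
  case (Suc k)
  have "walk R S n (- 1) = coeff ([:R, S, 1:] ^ n) k"
    unfolding walk_eq_coeff Suc by simp
  also have "\<dots> = (\<Sum>j\<le>Suc n. \<Sum>m\<le>n. if n + m = k + 2 * j
    then of_nat ((n choose m) * (m choose j)) * R ^ j * S ^ (n - m) else 0)"
    by (rule coeff_trinomial_power')
  also have "\<dots> = (\<Sum>j=1..Suc n. \<Sum>m\<le>n. if n + m = k + 2 * j
    then of_nat ((n choose m) * (m choose j)) * R ^ j * S ^ (n - m) else 0)"
    by (rule sum.mono_neutral_right) (auto simp: Suc not_le)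
  also have "\<dots> = (\<Sum>j=1..Suc n. of_nat ((n choose (j - 1)) * ((Suc n - j) choose j)) * R ^ j * S ^ (Suc n - 2 * j))"
  proof (intro sum.cong refl)
    fix j assume j: "j \<in> {1..Suc n}"
    then obtain l where l: "j = Suc l" "l \<le> n"
      by (cases j) auto
    have "(\<Sum>m\<le>n. if n + m = k + 2 * j
        then of_nat ((n choose m) * (m choose j)) * R ^ j * S ^ (n - m) else 0)
      = (\<Sum>m\<le>n. if m = Suc (2 * l)
        then of_nat ((n choose Suc (2 * l)) * (Suc (2 * l) choose j)) * R ^ j * S ^ (n - Suc (2 * l)) else 0)"
      by (intro sum.cong) (auto simp: Suc l)
    also have "\<dots> = of_nat ((n choose Suc (2 * l)) * (Suc (2 * l) choose j)) * R ^ j * S ^ (n - Suc (2 * l))"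
      by (cases "Suc (2 * l) \<le> n") (simp_all add: binomial_eq_0)
    \<comment> \<open>Two ways of placing the steps: all non-level positions first and then the
      down-steps among them, or the \<open>l = j - 1\<close> up-steps first and then the
      \<open>j\<close> down-steps among the rest.\<close>
    also have "(n choose Suc (2 * l)) * (Suc (2 * l) choose j) = (n choose l) * ((n - l) choose j)"
    proof (cases "Suc (2 * l) \<le> n")
      case True
      have "Suc (2 * l) choose j = Suc (2 * l) choose l"
        using binomial_symmetric[of j "Suc (2 * l)"] by (simp add: l)
      moreover have "(n choose Suc (2 * l)) * (Suc (2 * l) choose l) = (n choose l) * ((n - l) choose (Suc (2 * l) - l))"
        by (rule choose_mult) (use True in auto)
      ultimately show ?thesis
        by (simp add: l)
    next
      case False
      then have "n - l < j"
        using l by auto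
      with False show ?thesis
        by (simp add: binomial_eq_0)
    qed
    finally show "(\<Sum>m\<le>n. if n + m = k + 2 * j
        then of_nat ((n choose m) * (m choose j)) * R ^ j * S ^ (n - m) else 0)
      = of_nat ((n choose (j - 1)) * ((Suc n - j) choose j)) * R ^ j * S ^ (Suc n - 2 * j)"
      by (simp add: l)
  qed
  finally show ?thesis
    by (simp add: system_R_def)
qed

lemma walk_symmetric_parity:
  assumes "odd (int n + j)"
  shows "walk R 0 n j = 0"
  using assms by (induction n arbitrary: j) auto

text \<open>\<open>X j\<close> is meant to be the sum over \<open>n\<close> of
  \<open>fps_X ^ n * walk R S n j\<close>; the assumption is the decomposition by the last step of a
  walk.\<close>

locale walk_generating_function =
  fixes R S :: "'a::comm_ring_1 fps" and X :: "int \<Rightarrow> 'a fps"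
  assumes X_eq: "X j = (if j = 0 then 1 else 0) + fps_X * (X (j - 1) + S * X j + R * X (j + 1))"
begin

text \<open>Unfolding the recursion \<open>K\<close> times produces all walks shorter than
  \<open>K\<close> and leaves a remainder divisible by \<open>fps_X ^ K\<close>.\<close>

lemma partial_sum: "\<exists>E. \<forall>j. X j = (\<Sum>k<K. fps_X ^ k * walk R S k j) + fps_X ^ K * E j"
proof (induction K)
  case 0
  show ?case
    by (rule exI[of _ X]) simp
next
  case (Suc K)
  then obtain E where E: "\<And>j. X j = (\<Sum>k<K. fps_X ^ k * walk R S k j) + fps_X ^ K * E j"
    by blast
  have "X j = (\<Sum>k<Suc K. fps_X ^ k * walk R S k j) + fps_X ^ Suc K * (E (j - 1) + S * E j + R * E (j + 1))"
    for j
  proof -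
    have "(\<Sum>k<Suc K. fps_X ^ k * walk R S k j)
        = (if j = 0 then 1 else 0) + (\<Sum>k<K. fps_X ^ Suc k * walk R S (Suc k) j)"
      by (subst sum.lessThan_Suc_shift) simp
    also have "(\<Sum>k<K. fps_X ^ Suc k * walk R S (Suc k) j)
        = fps_X * ((\<Sum>k<K. fps_X ^ k * walk R S k (j - 1)) + S * (\<Sum>k<K. fps_X ^ k * walk R S k j)
          + R * (\<Sum>k<K. fps_X ^ k * walk R S k (j + 1)))"
      by (simp add: sum_distrib_left sum.distrib algebra_simps)
    finally have s: "(\<Sum>k<Suc K. fps_X ^ k * walk R S k j) = (if j = 0 then 1 else 0)
        + fps_X * ((\<Sum>k<K. fps_X ^ k * walk R S k (j - 1)) + S * (\<Sum>k<K. fps_X ^ k * walk R S k j)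
          + R * (\<Sum>k<K. fps_X ^ k * walk R S k (j + 1)))" .
    have "X j = (if j = 0 then 1 else 0)
        + fps_X * (((\<Sum>k<K. fps_X ^ k * walk R S k (j - 1)) + fps_X ^ K * E (j - 1))
          + S * ((\<Sum>k<K. fps_X ^ k * walk R S k j) + fps_X ^ K * E j)
          + R * ((\<Sum>k<K. fps_X ^ k * walk R S k (j + 1)) + fps_X ^ K * E (j + 1)))"
      by (simp only: E[symmetric]) (rule X_eq)
    then show ?thesis
      unfolding s by (simp add: algebra_simps)
  qed
  then show ?case
    by (intro exI allI)
qed

text \<open>Evaluates the infinite sums of the substituted system. \<open>B\<close> collects the
  lengths whose potential coefficient is dropped although the generating function counts
  them.\<close>

lemma sum_walk:
  assumes g: "\<And>k. g k = (if k \<in> B then 0 else fps_X ^ Suc k * walk R S k j)" and B: "finite B"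
  shows "(\<Sum>k<d. g k $ d) = (fps_X * X j - (\<Sum>k\<in>B. fps_X ^ Suc k * walk R S k j)) $ d"
proof -
  let ?w = "\<lambda>k. (fps_X ^ Suc k * walk R S k j) $ d"
  obtain E where E: "\<And>j. X j = (\<Sum>k<d. fps_X ^ k * walk R S k j) + fps_X ^ d * E j"
    using partial_sum by blast
  have high: "?w k = 0" if "d \<le> k" for k
    using that by (simp only: fps_X_power_mult_nth) auto
  have "fps_X * X j = (\<Sum>k<d. fps_X ^ Suc k * walk R S k j) + fps_X ^ Suc d * E j"
    by (subst E) (simp add: distrib_left sum_distrib_left mult.assoc)
  moreover have "(fps_X ^ Suc d * E j) $ d = 0"
    by (simp only: fps_X_power_mult_nth) auto
  ultimately have 1: "(fps_X * X j) $ d = (\<Sum>k<d. ?w k)"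
    by (simp only: fps_add_nth fps_sum_nth add_0_right)
  have 2: "(\<Sum>k<d. ?w k) = (\<Sum>k<d. g k $ d) + (\<Sum>k\<in>B \<inter> {..<d}. ?w k)"
  proof -
    have "(\<Sum>k<d. ?w k) = (\<Sum>k<d. g k $ d + (if k \<in> B then ?w k else 0))"
      by (intro sum.cong refl) (simp add: g)
    also have "\<dots> = (\<Sum>k<d. g k $ d) + (\<Sum>k\<in>{..<d} \<inter> B. ?w k)"
      by (simp only: sum.distrib sum.inter_restrict[OF finite_lessThan])
    finally show ?thesis
      by (simp only: Int_commute)
  qed
  have 3: "(\<Sum>k\<in>B \<inter> {..<d}. ?w k) = (\<Sum>k\<in>B. ?w k)"
  proof (rule sum.mono_neutral_left[OF B Int_lower1], rule ballI)
    fix k assume "k \<in> B - B \<inter> {..<d}"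
    then show "?w k = 0"
      by (intro high) auto
  qed
  show ?thesis
    unfolding fps_sub_nth fps_sum_nth 1 2 3 by simp
qed

end

text \<open>First-passage decomposition: \<open>m\<close> and \<open>l\<close> count first passages
  one level up and one level down, \<open>C\<close> counts closed walks, and reaching level
  \<open>j\<close> takes \<open>j\<close> successive passages of one kind.\<close>

lemma walk_generating_functionI:
  fixes R S C l m :: "'a::comm_ring_1 fps"
  assumes m: "m = fps_X * (1 + S * m + R * m\<^sup>2)"
    and l: "l = fps_X * (l\<^sup>2 + S * l + R)"
    and C: "C = 1 + fps_X * C * (l + S + R * m)"
  shows "walk_generating_function R S (\<lambda>j. if j \<ge> 0 then C * m ^ nat j else C * l ^ nat (- j))"
    (is "walk_generating_function R S ?X")
proof
  fix j :: int
  consider "j = 0" | i where "j = int (Suc i)" | i where "j = - int (Suc i)"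
    by (metis int_cases3 gr0_conv_Suc)
  then show "?X j = (if j = 0 then 1 else 0) + fps_X * (?X (j - 1) + S * ?X j + R * ?X (j + 1))"
  proof cases
    case 1
    then show ?thesis
      using C by (simp add: algebra_simps)
  next
    case (2 i)
    then have "nat (j - 1) = i" "nat j = Suc i" "nat (j + 1) = Suc (Suc i)"
      by auto
    moreover have "C * m ^ Suc i = fps_X * (C * m ^ i + S * (C * m ^ Suc i) + R * (C * m ^ Suc (Suc i)))"
    proof -
      have "C * m ^ Suc i = C * m ^ i * m"
        by (simp add: mult_ac)
      also have "\<dots> = C * m ^ i * (fps_X * (1 + S * m + R * m\<^sup>2))"
        using m by simp
      also have "\<dots> = fps_X * (C * m ^ i + S * (C * m ^ Suc i) + R * (C * m ^ Suc (Suc i)))"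
        by (simp add: algebra_simps power2_eq_square)
      finally show ?thesis .
    qed
    ultimately show ?thesis
      using 2 by simp
  next
    case (3 i)
    then have "nat (- (j - 1)) = Suc (Suc i)" "nat (- j) = Suc i" "nat (- (j + 1)) = i"
      by auto
    moreover have "C * l ^ Suc i = fps_X * (C * l ^ Suc (Suc i) + S * (C * l ^ Suc i) + R * (C * l ^ i))"
    proof -
      have "C * l ^ Suc i = C * l ^ i * l"
        by (simp add: mult_ac)
      also have "\<dots> = C * l ^ i * (fps_X * (l\<^sup>2 + S * l + R))"
        using l by simp
      also have "\<dots> = fps_X * (C * l ^ Suc (Suc i) + S * (C * l ^ Suc i) + R * (C * l ^ i))"
        by (simp add: algebra_simps power2_eq_square)
      finally show ?thesis .
    qed
    moreover have "?X (j + 1) = C * l ^ i"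
      using 3 by (cases i) (auto simp: nat_add_distrib)
    ultimately show ?thesis
      using 3 by simp
  qed
qed

section \<open>Rational parametrisations of the planar resolvent\<close>

text \<open>
  The planar resolvent is rational in the uniformising parameter \<open>\<omega>\<close>, where \<open>1 / z = D / \<omega>\<close> is the
  Laurent polynomial \<open>1 / \<omega> + S + R \<omega>\<close> of the walks counted by \<open>R\<close> and \<open>S\<close>; \<open>w\<close> is the generating function
  of the moments in \<open>z\<close>. The two identities are the quadratic loop equation for \<open>w\<close>, multiplied by
  the denominator of the derivative of the potential.
\<close>

lemma loop_identity_from:
  fixes s z \<alpha> \<nu> R S \<kappa> D L \<omega> Y w :: "'a::idom"
  assumes R: "\<alpha> * R = 1 + \<alpha> * (s * \<nu>)\<^sup>2" and S: "\<alpha> * S = \<alpha> * (s * \<nu>) - s"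
    and \<nu>: "\<alpha> * \<nu> + s\<^sup>2 * \<nu> = 1 + 3 * \<alpha> * s\<^sup>2 * \<nu>\<^sup>2"
    and \<kappa>: "\<kappa> = \<alpha> * (s * \<nu>) ^ 3" and D: "D = 1 + S * \<omega> + R * \<omega>\<^sup>2" and L: "L = 1 - s * \<nu> * \<omega>"
    and \<omega>: "\<omega> = z * D" and Y: "L * Y = 1" and w: "w = D * (1 - \<kappa> * \<omega> * Y)"
    and nz: "\<alpha> \<noteq> 0" "\<nu> \<noteq> 0" "D \<noteq> 0"
  shows "(s - z) * (\<alpha> * (w - 1) - z\<^sup>2 * w\<^sup>2) = s * \<alpha> * (S - \<kappa>) * z - s\<^sup>2 * z * (w - 1)"
proof -
  define Q where "Q = (S + R * \<omega>) * L - \<kappa> * D"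
  have L0: "L \<noteq> 0"
    using Y by auto
  \<comment> \<open>The zero of \<open>L\<close> is the point where \<open>z = s\<close>, so
    \<open>s * D - \<omega>\<close> is divisible by \<open>L\<close>; the relation for
    \<open>\<nu>\<close> is exactly the condition for this.\<close>
  have "\<alpha> * (\<nu> * (s * D - \<omega>)) - \<alpha> * (L * (s * \<nu> - R * \<omega>))
      = \<omega> * (\<nu> * s * (\<alpha> * S) - \<alpha> * \<nu> + \<alpha> * R + \<alpha> * s\<^sup>2 * \<nu>\<^sup>2)"
    unfolding D L by (simp add: algebra_simps eval_nat_numeral)
  also have "\<dots> = \<omega> * (1 + 3 * \<alpha> * s\<^sup>2 * \<nu>\<^sup>2 - (\<alpha> * \<nu> + s\<^sup>2 * \<nu>))"
    unfolding R S by (simp add: algebra_simps eval_nat_numeral)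
  finally have f1: "\<nu> * (s * D - \<omega>) = L * (s * \<nu> - R * \<omega>)"
    using nz \<nu> by simp
  have "w * L = D * (L - \<kappa> * \<omega> * (L * Y))"
    unfolding w by (simp add: algebra_simps eval_nat_numeral)
  then have f2: "w * L = D * (L - \<kappa> * \<omega>)"
    unfolding Y by simp
  have f3: "w * L - L = \<omega> * Q"
    unfolding f2 Q_def unfolding D by (simp add: algebra_simps eval_nat_numeral)
  \<comment> \<open>\<open>A\<close>, \<open>B\<close> and \<open>q\<close> are
    \<open>\<alpha>\<close> times \<open>R\<close>, \<open>S\<close> and \<open>Q\<close>, written
    as polynomials in the remaining parameters.\<close>
  define A B q where "A = 1 + \<alpha> * (s * \<nu>)\<^sup>2" "B = \<alpha> * (s * \<nu>) - s"
    "q = (B + A * \<omega>) * L - \<kappa> * (\<alpha> + B * \<omega> + A * \<omega>\<^sup>2)"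
  have AB: "\<alpha> * R = A" "\<alpha> * S = B"
    using R S by (simp_all add: A_B_q_def)
  have "\<alpha> * Q = (\<alpha> * S + \<alpha> * R * \<omega>) * L - \<kappa> * (\<alpha> + \<alpha> * S * \<omega> + \<alpha> * R * \<omega>\<^sup>2)"
    unfolding Q_def D by (simp add: algebra_simps eval_nat_numeral)
  then have Q: "\<alpha> * Q = q"
    unfolding AB by (simp add: A_B_q_def)
  have "\<alpha> * ((s * \<nu> - R * \<omega>) * (\<alpha> * Q * L - \<omega> * (L - \<kappa> * \<omega>)\<^sup>2)
        - (s * \<nu> * \<alpha> * (S - \<kappa>) * L - s * (s * \<nu>) * \<omega> * Q))
      = (\<alpha> * s * \<nu> - \<alpha> * R * \<omega>) * (\<alpha> * Q * L - \<omega> * (L - \<kappa> * \<omega>)\<^sup>2)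
        - (s * \<nu> * \<alpha> * (\<alpha> * S - \<alpha> * \<kappa>) * L - s\<^sup>2 * \<nu> * \<omega> * (\<alpha> * Q))"
    by (simp add: algebra_simps eval_nat_numeral)
  also have "\<dots> = (\<alpha> * s * \<nu> - A * \<omega>) * (q * L - \<omega> * (L - \<kappa> * \<omega>)\<^sup>2)
        - (s * \<nu> * \<alpha> * (B - \<alpha> * \<kappa>) * L - s\<^sup>2 * \<nu> * \<omega> * q)"
    unfolding Q AB ..
  \<comment> \<open>The difference of the two sides is a polynomial multiple of the relation for
    \<open>\<nu>\<close> and therefore vanishes.\<close>
  also have "\<dots> = (\<alpha> * \<nu> + s\<^sup>2 * \<nu> - (1 + 3 * \<alpha> * s\<^sup>2 * \<nu>\<^sup>2))
        * (\<alpha> * \<nu> ^ 3 * s ^ 4 * \<omega>\<^sup>2 + \<nu> * s\<^sup>2 * \<omega>\<^sup>2 - s * \<omega>)"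
    unfolding A_B_q_def L \<kappa> by (simp add: algebra_simps eval_nat_numeral)
  finally have key: "(s * \<nu> - R * \<omega>) * (\<alpha> * Q * L - \<omega> * (L - \<kappa> * \<omega>)\<^sup>2)
      = s * \<nu> * \<alpha> * (S - \<kappa>) * L - s * (s * \<nu>) * \<omega> * Q"
    using nz \<nu> by simp
  \<comment> \<open>The factor clears the denominators of \<open>z\<close> and \<open>w\<close> and
    is cancelled at the end; \<open>D\<close>, \<open>\<nu>\<close> and \<open>L\<close> are nonzero
    in an integral domain.\<close>
  have "(D * \<nu> * L\<^sup>2) * ((s - z) * (\<alpha> * (w - 1) - z\<^sup>2 * w\<^sup>2))
      = (\<nu> * (s * D - z * D)) * (\<alpha> * (w * L - L) * L - (z * (w * L))\<^sup>2)"
    by (simp add: algebra_simps eval_nat_numeral)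
  also have "\<dots> = (L * (s * \<nu> - R * \<omega>)) * (\<alpha> * (\<omega> * Q) * L - (\<omega> * (L - \<kappa> * \<omega>))\<^sup>2)"
    unfolding f3 unfolding f2 \<omega>[symmetric] f1 mult.assoc[symmetric, of z D] ..
  also have "\<dots> = L * \<omega> * ((s * \<nu> - R * \<omega>) * (\<alpha> * Q * L - \<omega> * (L - \<kappa> * \<omega>)\<^sup>2))"
    by (simp add: algebra_simps eval_nat_numeral)
  also have "\<dots> = z * D * (s * \<nu> * \<alpha> * (S - \<kappa>) * L\<^sup>2 - s * (s * \<nu>) * (\<omega> * Q) * L)"
    unfolding key \<omega>[symmetric] by (simp add: algebra_simps eval_nat_numeral)
  also have "\<dots> = (D * \<nu> * L\<^sup>2) * (s * \<alpha> * (S - \<kappa>) * z - s\<^sup>2 * z * (w - 1))"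
    unfolding f3[symmetric] by (simp add: algebra_simps eval_nat_numeral)
  finally show ?thesis
    using nz L0 by simp
qed

lemma loop_identity_even:
  fixes t z \<alpha> e q R \<kappa> D L \<omega> Y w :: "'a::idom"
  assumes e: "\<alpha> * e = 1" and \<alpha>: "\<alpha> = 1 + t" and q: "4 * t * q\<^sup>2 = (1 + 5 * t) * q - (1 + 2 * t)"
    and R: "R = e * q" and \<kappa>: "\<kappa> = e * (q - 1)\<^sup>2"
    and D: "D = 1 + R * \<omega>\<^sup>2" and L: "L = 1 - e * (q - 1) * \<omega>\<^sup>2"
    and \<omega>: "\<omega> = z * D" and Y: "L * Y = 1" and w: "w = D * (1 - \<kappa> * \<omega>\<^sup>2 * Y)"
    and nz: "q \<noteq> 1" "D \<noteq> 0" "t \<noteq> 0"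
  shows "(t - z\<^sup>2) * (\<alpha> * (w - 1) - z\<^sup>2 * w\<^sup>2) = t * (\<alpha> * (R - \<kappa>) - 1) * z\<^sup>2 - t * z\<^sup>2 * (w - 1)"
proof -
  define Q where "Q = R * L - \<kappa> * D"
  have L0: "L \<noteq> 0"
    using Y by auto
  \<comment> \<open>Now both roots of \<open>z^2 = t\<close> lie over \<open>L = 0\<close>, and the
    quadratic equation for \<open>q\<close> is the condition for divisibility by
    \<open>L\<close>.\<close>
  have "\<alpha> * ((q - 1) * (t * D\<^sup>2 - \<omega>\<^sup>2) - t * L * (q - 1 - e * q\<^sup>2 * \<omega>\<^sup>2))
      = \<omega>\<^sup>2 * (t * (\<alpha> * e) * (4 * q\<^sup>2 - 4 * q + 1) - \<alpha> * (q - 1))"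
    unfolding D L R by (simp add: algebra_simps eval_nat_numeral)
  also have "\<dots> = \<omega>\<^sup>2 * (4 * t * q\<^sup>2 - ((1 + 5 * t) * q - (1 + 2 * t)))"
    unfolding e unfolding \<alpha> by (simp add: algebra_simps eval_nat_numeral)
  finally have f1: "(q - 1) * (t * D\<^sup>2 - \<omega>\<^sup>2) = t * L * (q - 1 - e * q\<^sup>2 * \<omega>\<^sup>2)"
    using e q by auto
  have "w * L = D * (L - \<kappa> * \<omega>\<^sup>2 * (L * Y))"
    unfolding w by (simp add: algebra_simps eval_nat_numeral)
  then have f2: "w * L = D * (L - \<kappa> * \<omega>\<^sup>2)"
    unfolding Y by simp
  have f3: "w * L - L = \<omega>\<^sup>2 * Q"
    unfolding f2 Q_def unfolding D by (simp add: algebra_simps eval_nat_numeral)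
  \<comment> \<open>Here the difference is a multiple of \<open>\<alpha> * e - 1\<close>; the
    quadratic equation for \<open>q\<close> has already been spent on the divisibility by
    \<open>L\<close>.\<close>
  have "(q - 1 - e * q\<^sup>2 * \<omega>\<^sup>2) * (\<alpha> * Q * L - (L - \<kappa> * \<omega>\<^sup>2)\<^sup>2)
      - (q - 1) * ((\<alpha> * (R - \<kappa>) - 1) * L - \<omega>\<^sup>2 * Q)
      = (\<alpha> * e - 1) * (- (e * q ^ 3 * \<omega>\<^sup>2) - e\<^sup>2 * q ^ 3 * (\<omega>\<^sup>2)\<^sup>2 + e\<^sup>2 * q ^ 5 * (\<omega>\<^sup>2)\<^sup>2
        - e ^ 3 * q ^ 4 * (\<omega>\<^sup>2) ^ 3 + 2 * e ^ 3 * q ^ 5 * (\<omega>\<^sup>2) ^ 3 - e ^ 3 * q ^ 6 * (\<omega>\<^sup>2) ^ 3)"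
    unfolding Q_def D L R \<kappa> by (simp add: algebra_simps eval_nat_numeral)
  then have key: "(q - 1 - e * q\<^sup>2 * \<omega>\<^sup>2) * (\<alpha> * Q * L - (L - \<kappa> * \<omega>\<^sup>2)\<^sup>2)
      = (q - 1) * ((\<alpha> * (R - \<kappa>) - 1) * L - \<omega>\<^sup>2 * Q)"
    unfolding e by simp
  have "(D\<^sup>2 * (q - 1) * L\<^sup>2) * ((t - z\<^sup>2) * (\<alpha> * (w - 1) - z\<^sup>2 * w\<^sup>2))
      = ((q - 1) * (t * D\<^sup>2 - (z * D)\<^sup>2)) * (\<alpha> * (w * L - L) * L - (z * (w * L))\<^sup>2)"
    by (simp add: algebra_simps eval_nat_numeral)
  also have "\<dots> = (t * L * (q - 1 - e * q\<^sup>2 * \<omega>\<^sup>2)) * (\<alpha> * (\<omega>\<^sup>2 * Q) * L - (\<omega> * (L - \<kappa> * \<omega>\<^sup>2))\<^sup>2)"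
    unfolding f3 unfolding f2 \<omega>[symmetric] f1 mult.assoc[symmetric, of z D] ..
  also have "\<dots> = t * L * \<omega>\<^sup>2 * ((q - 1 - e * q\<^sup>2 * \<omega>\<^sup>2) * (\<alpha> * Q * L - (L - \<kappa> * \<omega>\<^sup>2)\<^sup>2))"
    by (simp add: algebra_simps eval_nat_numeral)
  also have "\<dots> = t * (z * D)\<^sup>2 * (q - 1) * ((\<alpha> * (R - \<kappa>) - 1) * L\<^sup>2 - (\<omega>\<^sup>2 * Q) * L)"
    unfolding key \<omega>[symmetric] by (simp add: algebra_simps eval_nat_numeral)
  also have "\<dots> = (D\<^sup>2 * (q - 1) * L\<^sup>2) * (t * (\<alpha> * (R - \<kappa>) - 1) * z\<^sup>2 - t * z\<^sup>2 * (w - 1))"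
    unfolding f3[symmetric] by (simp add: algebra_simps eval_nat_numeral)
  finally show ?thesis
    using nz L0 by simp
qed

text \<open>Coefficient \<open>n\<close> of the image depends only on lower coefficients, so
  iteration from 0 settles one more coefficient in each round.\<close>

lemma fps_fixpoint:
  fixes \<Phi> :: "'a::zero fps \<Rightarrow> 'a fps"
  assumes "\<And>n f g. (\<And>i. i < n \<Longrightarrow> f $ i = g $ i) \<Longrightarrow> \<Phi> f $ n = \<Phi> g $ n"
  shows "\<exists>f. f = \<Phi> f"
proof -
  define f where "f = (\<lambda>n. (\<Phi> ^^ n) 0)"
  have f_Suc: "f (Suc n) = \<Phi> (f n)" for n
    by (simp add: f_def)
  have step: "f n $ i = f (Suc n) $ i" if "i < n" for n i
    using that
  proof (induction n arbitrary: i)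
    case (Suc n)
    have "\<Phi> (f n) $ i = \<Phi> (f (Suc n)) $ i"
      by (rule assms) (use Suc in auto)
    then show ?case
      by (simp only: f_Suc)
  qed simp
  have stable: "f (Suc i) $ i = f (Suc i + k) $ i" for i k
  proof (induction k)
    case (Suc k)
    also have "f (Suc i + k) $ i = f (Suc (Suc i + k)) $ i"
      by (rule step) simp
    finally show ?case
      by simp
  qed simp
  define g where "g = Abs_fps (\<lambda>i. f (Suc i) $ i)"
  have g: "g $ i = f n $ i" if "i < n" for i n
    using stable[of i "n - Suc i"] that by (simp add: g_def)
  have "g = \<Phi> g"
  proof (rule fps_ext)
    fix n
    have "\<Phi> g $ n = \<Phi> (f n) $ n"
      using g by (intro assms) auto
    also have "\<dots> = g $ n"
      using g[of n "Suc n"] by (simp add: f_Suc)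
    finally show "g $ n = \<Phi> g $ n" ..
  qed
  then show ?thesis ..
qed

lemma fps_mult_cong_below:
  fixes f g f' g' :: "'a::comm_ring_1 fps"
  assumes "\<And>i. i < n \<Longrightarrow> f $ i = f' $ i" "\<And>i. i < n \<Longrightarrow> g $ i = g' $ i" "i < n"
  shows "(f * g) $ i = (f' * g') $ i"
  unfolding fps_mult_nth by (intro sum.cong refl arg_cong2[of _ _ _ _ "(*)"]) (use assms in auto)

lemma fps_X_mult_cong:
  fixes f g :: "'a::comm_ring_1 fps"
  assumes "\<And>i. i < n \<Longrightarrow> f $ i = g $ i"
  shows "(fps_X * f) $ n = (fps_X * g) $ n"
  using assms by (cases n) auto

text \<open>Source of the algebraic series used below: \<open>\<omega>\<close>, \<open>q\<close> and
  \<open>g\<close>, and with vanishing quadratic part the inverse \<open>Y\<close> of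
  \<open>L\<close>.\<close>

lemma fps_X_mult_quadratic_fixpoint:
  fixes a b c d :: "'a::comm_ring_1 fps"
  shows "\<exists>f. f = d + fps_X * (a + b * f + c * f\<^sup>2)"
proof (rule fps_fixpoint)
  fix n and f g :: "'a fps"
  assume fg: "\<And>i. i < n \<Longrightarrow> f $ i = g $ i"
  have "(a + b * f + c * f\<^sup>2) $ i = (a + b * g + c * g\<^sup>2) $ i" if "i < n" for i
    unfolding power2_eq_square fps_add_nth
    by (intro arg_cong2[of _ _ _ _ "(+)"] refl; (intro fps_mult_cong_below[where n = n])?) (use fg that in \<open>auto intro: fps_mult_cong_below[where n = n]\<close>)
  then show "(d + fps_X * (a + b * f + c * f\<^sup>2)) $ n = (d + fps_X * (a + b * g + c * g\<^sup>2)) $ n"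
    using fps_X_mult_cong by simp
qed

section \<open>Solution of the planar loop equations\<close>

lemma fps_nth_tail_sum:
  fixes U :: "'a::comm_ring_1 fps"
  assumes "\<And>K. \<exists>M\<ge>K. \<exists>E. U = (\<Sum>k<M. (if k \<in> B then 0 else fps_X ^ Suc k) * f k) + fps_X ^ K * E"
  shows "U $ d = (\<Sum>k<d. ((if k \<in> B then 0 else fps_X ^ Suc k) * f k) $ d)"
proof -
  let ?g = "\<lambda>k. (if k \<in> B then 0 else fps_X ^ Suc k) * f k"
  \<comment> \<open>A remainder divisible by \<open>fps_X ^ Suc d\<close> cannot reach coefficient
    \<open>d\<close>.\<close>
  obtain M E where M: "M \<ge> Suc d" and U: "U = (\<Sum>k<M. ?g k) + fps_X ^ Suc d * E"
    using assms by blast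
  have high: "?g k $ d = 0" if "k \<ge> d" for k
  proof (cases "k \<in> B")
    case False
    then show ?thesis
      using that by (simp only: if_False fps_X_power_mult_nth) auto
  qed simp
  have "(fps_X ^ Suc d * E) $ d = 0"
    by (simp only: fps_X_power_mult_nth) auto
  then have "U $ d = (\<Sum>k<M. ?g k $ d)"
    unfolding U by (simp only: fps_add_nth fps_sum_nth add_0_right)
  also have "\<dots> = (\<Sum>k<d. ?g k $ d)"
  proof (rule sum.mono_neutral_right)
    show "\<forall>k\<in>{..<M} - {..<d}. ?g k $ d = 0"
      using high by auto
  qed (use M in auto)
  finally show ?thesis .
qed

text \<open>\<open>U m\<close> is the interaction sum with a complete geometric tail. When the
  coefficient of index 2 is missing (\<open>h = 1\<close>), the term \<open>k = 1\<close> of the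
  tail is compensated by the factor \<open>1 + h * fps_X\<^sup>2\<close> on the left, which mirrors
  the quadratic term \<open>(1 + t) x^2 / 2\<close> of the potential.\<close>

lemma loop_systemI:
  fixes W U :: "nat \<Rightarrow> 'a::comm_ring_1 fps"
  assumes W0: "W 0 = 1"
    and W: "\<And>m. (1 + h * fps_X\<^sup>2) * W (Suc m) = (\<Sum>a<m. W a * W (m - 1 - a)) + U m"
    and U: "\<And>m K. \<exists>M\<ge>K. \<exists>E. U m = (\<Sum>k<M. (if k \<in> B then 0 else fps_X ^ Suc k) * W (m + k)) + fps_X ^ K * E"
    and c: "\<And>k. (if k \<in> B then 0 else fps_X ^ Suc k) = c (Suc k) + (if k = 1 then h * fps_X\<^sup>2 else 0)"
  shows "loop_system c W"
  unfolding loop_system_def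
proof (intro conjI allI W0)
  fix m d
  have "U m $ d = (\<Sum>k<d. ((if k \<in> B then 0 else fps_X ^ Suc k) * W (m + k)) $ d)"
    by (rule fps_nth_tail_sum[OF U])
  also have "\<dots> = (\<Sum>k<d. (c (Suc k) * W (m + k)) $ d + (if k = 1 then (h * fps_X\<^sup>2 * W (Suc m)) $ d else 0))"
    unfolding c by (intro sum.cong refl) (auto simp: distrib_right)
  also have "\<dots> = (\<Sum>k<d. (c (Suc k) * W (m + k)) $ d) + (h * fps_X\<^sup>2 * W (Suc m)) $ d"
  proof (cases "1 < d")
    case False
    then have "(fps_X\<^sup>2 * (h * W (Suc m))) $ d = 0"
      by (simp only: fps_X_power_mult_nth) auto
    then show ?thesis
      using False by (simp add: sum.distrib mult_ac)
  qed (simp add: sum.distrib)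
  finally have "U m $ d = (\<Sum>k<d. (c (Suc k) * W (m + k)) $ d) + (h * fps_X\<^sup>2 * W (Suc m)) $ d" .
  moreover have "W (Suc m) + h * fps_X\<^sup>2 * W (Suc m) = (\<Sum>a<m. W a * W (m - 1 - a)) + U m"
    using W[of m] by (simp add: algebra_simps)
  then have "W (Suc m) $ d + (h * fps_X\<^sup>2 * W (Suc m)) $ d = (\<Sum>a<m. W a * W (m - 1 - a)) $ d + U m $ d"
    by (metis fps_add_nth)
  ultimately show "W (Suc m) $ d = (\<Sum>a<m. W a * W (m - 1 - a)) $ d + (\<Sum>k<d. (c (Suc k) * W (m + k)) $ d)"
    by simp
qed

text \<open>Isolates the part of the loop equation that the interaction has to supply; it is the
  quantity called \<open>U m\<close> afterwards.\<close>

lemma resolvent_coefficient: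
  fixes w :: "'a::comm_ring_1 fps"
  shows "(fps_const \<alpha> * (w - 1) - fps_X\<^sup>2 * w\<^sup>2) $ Suc m
    = \<alpha> * w $ Suc m - (\<Sum>a<m. w $ a * w $ (m - 1 - a))"
proof (cases m)
  case 0
  then show ?thesis
    by (simp add: fps_X_power_mult_nth)
next
  case (Suc k)
  have "(fps_X\<^sup>2 * w\<^sup>2) $ Suc m = (w * w) $ k"
    unfolding Suc power2_eq_square[of w] fps_X_power_mult_nth by simp
  also have "\<dots> = (\<Sum>a<m. w $ a * w $ (m - 1 - a))"
    by (simp add: fps_mult_nth Suc atLeast0AtMost lessThan_Suc_atMost)
  finally show ?thesis
    by simp
qed

text \<open>From degree 2 on, the coefficients of the functional equation give
  \<open>U m = s^2 W (m + 1) + s U (m + 1)\<close>; iterating produces the geometric tail. The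
  unknown \<open>w1\<close> sits in degree 1 only.\<close>

lemma loop_system_from:
  fixes w :: "rat fps fps"
  assumes n0: "n0 = 2 \<and> h = 0 \<or> n0 = 3 \<and> h = 1" and \<alpha>: "\<alpha> = 1 + h * fps_X\<^sup>2"
    and w0: "w $ 0 = 1"
    and eq: "(fps_const fps_X - fps_X) * (fps_const \<alpha> * (w - 1) - fps_X\<^sup>2 * w\<^sup>2)
      = fps_const fps_X * fps_const \<alpha> * fps_const w1 * fps_X - (fps_const fps_X)\<^sup>2 * fps_X * (w - 1)"
  shows "loop_system (coeffs_from n0) (\<lambda>n. w $ n)"
proof -
  define u where "u = fps_const \<alpha> * (w - 1) - fps_X\<^sup>2 * w\<^sup>2"
  define U where "U = (\<lambda>m. u $ Suc m)"
  have U_rec: "U m = fps_X\<^sup>2 * w $ Suc m + fps_X * U (Suc m)" for m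
  proof -
    have 1: "((fps_const fps_X - fps_X) * u) $ Suc (Suc m) = fps_X * u $ Suc (Suc m) - u $ Suc m"
      by (simp add: left_diff_distrib)
    have 2: "(fps_const fps_X * fps_const \<alpha> * fps_const w1 * fps_X
        - (fps_const fps_X)\<^sup>2 * fps_X * (w - 1)) $ Suc (Suc m) = - (fps_X\<^sup>2 * w $ Suc m)"
      by (simp add: mult.assoc fps_const_power)
    from arg_cong[OF eq[folded u_def], of "\<lambda>f. f $ Suc (Suc m)"]
    have "fps_X * u $ Suc (Suc m) - u $ Suc m = - (fps_X\<^sup>2 * w $ Suc m)"
      unfolding 1 2 .
    then show ?thesis
      by (simp add: U_def algebra_simps)
  qed
  show ?thesis
  proof (rule loop_systemI[where B = "{0}" and h = h and U = U])
    show "(1 + h * fps_X\<^sup>2) * w $ Suc m = (\<Sum>a<m. w $ a * w $ (m - 1 - a)) + U m" for m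
      unfolding U_def u_def resolvent_coefficient \<alpha> by simp
    show "\<exists>M\<ge>K. \<exists>E. U m = (\<Sum>k<M. (if k \<in> {0} then 0 else fps_X ^ Suc k) * w $ (m + k)) + fps_X ^ K * E" for m K
    proof (intro exI conjI)
      show "U m = (\<Sum>k<Suc K. (if k \<in> {0} then 0 else fps_X ^ Suc k) * w $ (m + k)) + fps_X ^ K * U (m + K)"
      proof (induction K)
        case (Suc K)
        have "fps_X ^ K * U (m + K) = fps_X ^ Suc (Suc K) * w $ (m + Suc K) + fps_X ^ Suc K * U (m + Suc K)"
          unfolding U_rec[of "m + K"] by (simp add: algebra_simps power2_eq_square)
        then show ?case
          by (subst Suc.IH) simp
      qed simp
    qed simp
    show "(if k \<in> {0} then 0 else fps_X ^ Suc k) = coeffs_from n0 (Suc k) + (if k = 1 then h * fps_X\<^sup>2 else 0)" for k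
      using n0 by (auto simp: coeffs_from_def numeral_2_eq_2)
  qed (rule w0)
qed

text \<open>As for the logarithmic potentials, but the recursion moves the moment index by 2, so
  only odd \<open>k\<close> appear in the tail.\<close>

lemma loop_system_even:
  fixes w :: "rat fps fps"
  assumes \<alpha>: "\<alpha> = 1 + fps_X\<^sup>2"
    and w0: "w $ 0 = 1"
    and eq: "(fps_const (fps_X\<^sup>2) - fps_X\<^sup>2) * (fps_const \<alpha> * (w - 1) - fps_X\<^sup>2 * w\<^sup>2)
      = fps_const (fps_X\<^sup>2) * (fps_const w2) * fps_X\<^sup>2 - fps_const (fps_X\<^sup>2) * fps_X\<^sup>2 * (w - 1)"
  shows "loop_system coeffs_even (\<lambda>n. w $ n)"
proof -
  define u where "u = fps_const \<alpha> * (w - 1) - fps_X\<^sup>2 * w\<^sup>2"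
  define U where "U = (\<lambda>m. u $ Suc m)"
  have U_rec: "U m = fps_X\<^sup>2 * w $ Suc m + fps_X\<^sup>2 * U (m + 2)" for m
  proof -
    have 1: "((fps_const (fps_X\<^sup>2) - fps_X\<^sup>2) * u) $ Suc (Suc (Suc m)) = fps_X\<^sup>2 * u $ Suc (Suc (Suc m)) - u $ Suc m"
      by (simp add: left_diff_distrib fps_X_power_mult_nth)
    have 2: "(fps_const (fps_X\<^sup>2) * (fps_const w2) * fps_X\<^sup>2
        - fps_const (fps_X\<^sup>2) * fps_X\<^sup>2 * (w - 1)) $ Suc (Suc (Suc m)) = - (fps_X\<^sup>2 * w $ Suc m)"
      by (simp add: mult.assoc fps_X_power_mult_nth fps_X_power_nth)
    from arg_cong[OF eq[folded u_def], of "\<lambda>f. f $ Suc (Suc (Suc m))"]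
    have "fps_X\<^sup>2 * u $ Suc (Suc (Suc m)) - u $ Suc m = - (fps_X\<^sup>2 * w $ Suc m)"
      unfolding 1 2 .
    then show ?thesis
      by (simp add: U_def algebra_simps)
  qed
  show ?thesis
  proof (rule loop_systemI[where B = "{k. even k}" and h = 1 and U = U])
    show "(1 + 1 * fps_X\<^sup>2) * w $ Suc m = (\<Sum>a<m. w $ a * w $ (m - 1 - a)) + U m" for m
      unfolding U_def u_def resolvent_coefficient \<alpha> by simp
    show "\<exists>M\<ge>K. \<exists>E. U m = (\<Sum>k<M. (if k \<in> {k. even k} then 0 else fps_X ^ Suc k) * w $ (m + k)) + fps_X ^ K * E" for m K
    proof (intro exI conjI)
      have "U m = (\<Sum>k<2 * K. (if k \<in> {k. even k} then 0 else fps_X ^ Suc k) * w $ (m + k)) + fps_X ^ (2 * K) * U (m + 2 * K)"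
      proof (induction K)
        case (Suc K)
        have "fps_X ^ (2 * K) * U (m + 2 * K)
            = fps_X ^ (2 * Suc K) * w $ Suc (m + 2 * K) + fps_X ^ (2 * Suc K) * U (m + 2 * Suc K)"
          unfolding U_rec[of "m + 2 * K"] by (simp add: algebra_simps power2_eq_square)
        then show ?case
          by (subst Suc.IH) simp
      qed simp
      then show "U m = (\<Sum>k<2 * K. (if k \<in> {k. even k} then 0 else fps_X ^ Suc k) * w $ (m + k))
          + fps_X ^ K * (fps_X ^ K * U (m + 2 * K))"
        by (simp add: mult_2 power_add mult.assoc)
    qed simp
    show "(if k \<in> {k. even k} then 0 else fps_X ^ Suc k)
        = coeffs_even (Suc k) + (if k = 1 then 1 * fps_X\<^sup>2 else 0)" for k
    proof (cases "even k")
      case False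
      then have "k = 1 \<or> k \<ge> 3"
        by presburger
      then show ?thesis
        using False by (auto simp: coeffs_even_def power2_eq_square)
    qed (auto simp: coeffs_even_def)
  qed (rule w0)
qed

lemma graded_substitution_from: "graded_substitution (coeffs_from n0) (\<lambda>k. if Suc k \<ge> n0 then 1 else 0)"
  by standard (auto simp: coeffs_from_def)

lemma graded_substitution_even: "graded_substitution coeffs_even (\<lambda>k. if even (Suc k) \<and> Suc k \<ge> 4 then 1 else 0)"
  by standard (auto simp: coeffs_even_def)

lemma fps_const_eqD:
  "a = b \<Longrightarrow> fps_const a = fps_const b"
  by simp

lemmas fps_const_hom = fps_const_mult[symmetric] fps_const_add[symmetric] fps_const_sub[symmetric]
  fps_const_power[symmetric] fps_const_1_eq_1

text \<open>In \<open>rat fps fps\<close> the outer variable is \<open>z\<close> and the inner one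
  the square root of \<open>t\<close>. The resolvent \<open>w\<close> built from
  \<open>\<omega>\<close> and \<open>Y\<close> solves the loop system, so by uniqueness its
  coefficient of \<open>z^2\<close> is the second moment.\<close>

lemma second_moment_from:
  fixes \<alpha> \<nu> R S :: "rat fps"
  assumes n0: "n0 = 2 \<and> h = 0 \<or> n0 = 3 \<and> h = 1" and \<alpha>: "\<alpha> = 1 + h * fps_X\<^sup>2"
    and R: "\<alpha> * R = 1 + \<alpha> * (fps_X * \<nu>)\<^sup>2" and S: "\<alpha> * S = \<alpha> * (fps_X * \<nu>) - fps_X"
    and \<nu>: "\<alpha> * \<nu> + fps_X\<^sup>2 * \<nu> = 1 + 3 * \<alpha> * fps_X\<^sup>2 * \<nu>\<^sup>2" and nz: "\<alpha> \<noteq> 0" "\<nu> \<noteq> 0"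
    and \<kappa>: "\<kappa> = \<alpha> * (fps_X * \<nu>) ^ 3"
  shows "msubst (coeffs_from n0) (loop_moment 2 planar_free_energy)
    = S\<^sup>2 + R - 2 * \<kappa> * S - \<kappa> * (fps_X * \<nu>)"
proof -
  let ?F = "fps_const :: rat fps \<Rightarrow> rat fps fps"
  obtain \<omega> :: "rat fps fps" where \<omega>: "\<omega> = 0 + fps_X * (1 + ?F S * \<omega> + ?F R * \<omega>\<^sup>2)"
    using fps_X_mult_quadratic_fixpoint[of 0 1 "?F S" "?F R"] by blast
  define D where "D = 1 + ?F S * \<omega> + ?F R * \<omega>\<^sup>2"
  obtain Y where Y: "Y = 1 + fps_X * (0 + (?F (fps_X * \<nu>) * D) * Y + 0 * Y\<^sup>2)"
    using fps_X_mult_quadratic_fixpoint[of 1 0 "?F (fps_X * \<nu>) * D" 0] by blast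
  have \<omega>D: "\<omega> = fps_X * D"
    using \<omega> by (simp add: D_def)
  have Y': "Y = 1 + ?F (fps_X * \<nu>) * \<omega> * Y"
    using Y by (simp add: \<omega>D mult_ac)
  define w where "w = D * (1 - ?F \<kappa> * \<omega> * Y)"
  have \<omega>_nth: "\<omega> $ 0 = 0" "\<omega> $ Suc n = D $ n" for n
    by (simp_all add: \<omega>D)
  have D_nth: "D $ 0 = 1" "D $ Suc 0 = S" "D $ 2 = S\<^sup>2 + R"
  proof -
    show D0: "D $ 0 = 1"
      by (simp add: D_def \<omega>_nth power2_eq_square)
    show D1: "D $ Suc 0 = S"
      unfolding D_def by (simp add: \<omega>_nth D0 power2_eq_square[of \<omega>] fps_mult_nth[of \<omega> \<omega>])
    show "D $ 2 = S\<^sup>2 + R"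
      unfolding D_def numeral_2_eq_2
      by (simp add: \<omega>_nth D0 D1 fps_mult_nth[of \<omega> \<omega>] power2_eq_square)
  qed
  have Y_nth: "Y $ 0 = 1" "Y $ Suc 0 = fps_X * \<nu>"
  proof -
    show Y0: "Y $ 0 = 1"
      by (subst Y') (simp add: \<omega>_nth)
    show "Y $ Suc 0 = fps_X * \<nu>"
      by (subst Y') (simp add: mult.assoc fps_mult_nth[of \<omega> Y] \<omega>_nth Y0 D_nth)
  qed
  define V where "V = \<omega> * Y"
  have V_nth: "V $ 0 = 0" "V $ Suc 0 = 1" "V $ Suc (Suc 0) = S + fps_X * \<nu>"
    by (simp_all add: V_def fps_mult_nth \<omega>_nth D_nth Y_nth)
  have w_V: "w = D * (1 - ?F \<kappa> * V)"
    by (simp add: w_def V_def mult.assoc)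
  have "w $ 2 = D $ 2 - D $ Suc 0 * \<kappa> - \<kappa> * (S + fps_X * \<nu>)"
    unfolding w_V by (simp add: fps_mult_nth[of D] numeral_2_eq_2 V_nth D_nth(1))
  then have w2: "w $ 2 = S\<^sup>2 + R - 2 * \<kappa> * S - \<kappa> * (fps_X * \<nu>)"
    by (simp add: D_nth algebra_simps)
  have w_nth: "w $ 0 = 1"
    unfolding w_V by (simp add: V_nth D_nth)
  have "(?F fps_X - fps_X) * (?F \<alpha> * (w - 1) - fps_X\<^sup>2 * w\<^sup>2)
      = ?F fps_X * ?F \<alpha> * (?F S - ?F \<kappa>) * fps_X - (?F fps_X)\<^sup>2 * fps_X * (w - 1)"
  proof (rule loop_identity_from[where \<nu> = "?F \<nu>" and R = "?F R" and D = D and \<omega> = \<omega> and Y = Y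
        and L = "1 - ?F fps_X * ?F \<nu> * \<omega>"])
    show "?F \<alpha> * ?F R = 1 + ?F \<alpha> * (?F fps_X * ?F \<nu>)\<^sup>2"
      using fps_const_eqD[OF R] by (simp only: fps_const_hom)
    show "?F \<alpha> * ?F S = ?F \<alpha> * (?F fps_X * ?F \<nu>) - ?F fps_X"
      using fps_const_eqD[OF S] by (simp only: fps_const_hom)
    have "?F 3 = 3"
      by (simp add: numeral_fps_const)
    then show "?F \<alpha> * ?F \<nu> + (?F fps_X)\<^sup>2 * ?F \<nu> = 1 + 3 * ?F \<alpha> * (?F fps_X)\<^sup>2 * (?F \<nu>)\<^sup>2"
      using fps_const_eqD[OF \<nu>] by (simp only: fps_const_hom)
    show "?F \<kappa> = ?F \<alpha> * (?F fps_X * ?F \<nu>) ^ 3"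
      using fps_const_eqD[OF \<kappa>] by (simp only: fps_const_hom)
    show "(1 - ?F fps_X * ?F \<nu> * \<omega>) * Y = 1"
      using Y' by (simp add: algebra_simps)
    show "D \<noteq> 0"
      using D_nth by auto
  qed (use nz \<omega>D in \<open>simp_all add: D_def w_def\<close>)
  then have "loop_system (coeffs_from n0) (\<lambda>n. w $ n)"
    by (intro loop_system_from[OF n0 \<alpha> w_nth, where ?w1.0 = "S - \<kappa>"]) (simp only: fps_const_hom)
  then have "msubst (coeffs_from n0) (loop_moment 2 planar_free_energy) = w $ 2"
    using graded_substitution.loop_system_unique[OF graded_substitution_from
        graded_substitution.loop_system_msubst[OF graded_substitution_from loop_equation_planar_free_energy]]
    by blast
  then show ?thesis
    by (simp add: w2)
qed

lemma second_moment_even: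
  fixes \<alpha> e q :: "rat fps"
  assumes \<alpha>: "\<alpha> = 1 + fps_X\<^sup>2" and e: "\<alpha> * e = 1"
    and q: "4 * fps_X\<^sup>2 * q\<^sup>2 = (1 + 5 * fps_X\<^sup>2) * q - (1 + 2 * fps_X\<^sup>2)"
  shows "msubst coeffs_even (loop_moment 2 planar_free_energy) = e * q - e * (q - 1)\<^sup>2"
proof -
  let ?F = "fps_const :: rat fps \<Rightarrow> rat fps fps"
  define R \<kappa> where "R = e * q" and "\<kappa> = e * (q - 1)\<^sup>2"
  obtain \<omega> :: "rat fps fps" where \<omega>: "\<omega> = 0 + fps_X * (1 + 0 * \<omega> + ?F R * \<omega>\<^sup>2)"
    using fps_X_mult_quadratic_fixpoint[of 0 1 0 "?F R"] by blast
  define D where "D = 1 + ?F R * \<omega>\<^sup>2"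
  obtain Y where Y: "Y = 1 + fps_X * (0 + (?F (e * (q - 1)) * D * \<omega>) * Y + 0 * Y\<^sup>2)"
    using fps_X_mult_quadratic_fixpoint[of 1 0 "?F (e * (q - 1)) * D * \<omega>" 0] by blast
  have \<omega>D: "\<omega> = fps_X * D"
    using \<omega> by (simp add: D_def)
  have Y': "Y = 1 + ?F (e * (q - 1)) * (\<omega> * \<omega>) * Y"
    using Y by (simp add: \<omega>D mult_ac)
  define w where "w = D * (1 - ?F \<kappa> * (\<omega> * \<omega>) * Y)"
  have \<omega>_nth: "\<omega> $ 0 = 0" "\<omega> $ Suc n = D $ n" for n
    by (simp_all add: \<omega>D)
  have D_nth: "D $ 0 = 1" "D $ Suc 0 = 0" "D $ 2 = R"
  proof -
    show D0: "D $ 0 = 1"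
      by (simp add: D_def \<omega>_nth power2_eq_square)
    show D1: "D $ Suc 0 = 0"
      unfolding D_def by (simp add: \<omega>_nth D0 power2_eq_square[of \<omega>] fps_mult_nth[of \<omega> \<omega>])
    show "D $ 2 = R"
      unfolding D_def numeral_2_eq_2
      by (simp add: \<omega>_nth D0 D1 fps_mult_nth[of \<omega> \<omega>] power2_eq_square)
  qed
  have \<omega>\<omega>_nth: "(\<omega> * \<omega>) $ 0 = 0" "(\<omega> * \<omega>) $ Suc 0 = 0" "(\<omega> * \<omega>) $ Suc (Suc 0) = 1"
    by (simp_all add: fps_mult_nth \<omega>_nth D_nth)
  have Y_nth: "Y $ 0 = 1"
    by (subst Y') (simp add: \<omega>_nth)
  define V where "V = \<omega> * \<omega> * Y"
  have V_nth: "V $ 0 = 0" "V $ Suc 0 = 0" "V $ Suc (Suc 0) = 1"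
    unfolding V_def fps_mult_nth[of "\<omega> * \<omega>" Y] by (simp_all add: \<omega>\<omega>_nth \<omega>_nth Y_nth)
  have w_V: "w = D * (1 - ?F \<kappa> * V)"
    by (simp add: w_def V_def mult.assoc)
  have "w $ 2 = D $ 2 - \<kappa>"
    unfolding w_V by (simp add: fps_mult_nth[of D] numeral_2_eq_2 V_nth D_nth(1))
  then have w2: "w $ 2 = R - \<kappa>"
    by (simp add: D_nth)
  have w_nth: "w $ 0 = 1"
    unfolding w_V by (simp add: V_nth D_nth)
  have q1: "q \<noteq> 1"
  proof
    assume "q = 1"
    then have "4 * fps_X\<^sup>2 = (1 + 5 * fps_X\<^sup>2) - (1 + 2 * fps_X\<^sup>2 :: rat fps)"
      using q by simp
    then have "(fps_X\<^sup>2 :: rat fps) = 0"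
      by simp
    then show False
      by simp
  qed
  have F_numeral: "?F (numeral n) = numeral n" for n
    by (simp add: numeral_fps_const)
  have "(?F (fps_X\<^sup>2) - fps_X\<^sup>2) * (?F \<alpha> * (w - 1) - fps_X\<^sup>2 * w\<^sup>2)
      = ?F (fps_X\<^sup>2) * (?F \<alpha> * (?F R - ?F \<kappa>) - 1) * fps_X\<^sup>2 - ?F (fps_X\<^sup>2) * fps_X\<^sup>2 * (w - 1)"
  proof (rule loop_identity_even[where q = "?F q" and e = "?F e" and R = "?F R" and D = D and \<omega> = \<omega> and Y = Y
        and L = "1 - ?F e * (?F q - 1) * \<omega>\<^sup>2"])
    show "?F \<alpha> * ?F e = 1"
      using fps_const_eqD[OF e] by (simp only: fps_const_hom)
    show "?F \<alpha> = 1 + ?F (fps_X\<^sup>2)"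
      using fps_const_eqD[OF \<alpha>] by (simp only: fps_const_hom)
    show "4 * ?F (fps_X\<^sup>2) * (?F q)\<^sup>2 = (1 + 5 * ?F (fps_X\<^sup>2)) * ?F q - (1 + 2 * ?F (fps_X\<^sup>2))"
      using fps_const_eqD[OF q] by (simp only: fps_const_hom F_numeral)
    show "?F R = ?F e * ?F q" "?F \<kappa> = ?F e * (?F q - 1)\<^sup>2"
      unfolding R_def \<kappa>_def by (simp_all only: fps_const_hom)
    show "(1 - ?F e * (?F q - 1) * \<omega>\<^sup>2) * Y = 1"
      using Y' unfolding fps_const_hom by (simp add: algebra_simps power2_eq_square)
    show "D \<noteq> 0"
      using D_nth by auto
    show "?F q \<noteq> 1"
    proof
      assume "?F q = 1"
      then have "?F q $ 0 = 1 $ 0"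
        by simp
      with q1 show False
        by simp
    qed
    have "?F (fps_X\<^sup>2) $ 0 \<noteq> 0"
      by simp
    then show "?F (fps_X\<^sup>2) \<noteq> 0"
      by fastforce
  qed (use \<omega>D in \<open>simp_all add: D_def w_def power2_eq_square\<close>)
  then have "loop_system coeffs_even (\<lambda>n. w $ n)"
    by (intro loop_system_even[OF \<alpha> w_nth, where ?w2.0 = "\<alpha> * (R - \<kappa>) - 1"]) (simp only: fps_const_hom)
  then have "msubst coeffs_even (loop_moment 2 planar_free_energy) = w $ 2"
    using graded_substitution.loop_system_unique[OF graded_substitution_even
        graded_substitution.loop_system_msubst[OF graded_substitution_even loop_equation_planar_free_energy]]
    by blast
  then show ?thesis
    by (simp add: w2 R_def \<kappa>_def)
qed

lemma fps_mult_inverse: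
  fixes f :: "rat fps"
  assumes "f $ 0 \<noteq> 0"
  shows "f * inverse f = 1"
  using assms by (rule inverse_mult_eq_1')

text \<open>With geometric coefficients the sums over \<open>n\<close> are walk generating functions
  evaluated at \<open>fps_X\<close> itself, so finitely many algebraic identities verify the whole
  system.\<close>

lemma series_RS_from:
  fixes \<alpha> \<nu> R S :: "rat fps"
  assumes n0: "n0 = 2 \<and> h = 0 \<or> n0 = 3 \<and> h = 1" and \<alpha>: "\<alpha> = 1 + h * fps_X\<^sup>2"
    and R: "\<alpha> * R = 1 + \<alpha> * (fps_X * \<nu>)\<^sup>2" and S: "\<alpha> * S = \<alpha> * (fps_X * \<nu>) - fps_X"
    and \<nu>: "\<alpha> * \<nu> + fps_X\<^sup>2 * \<nu> = 1 + 3 * \<alpha> * fps_X\<^sup>2 * \<nu>\<^sup>2"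
  shows "msubst (coeffs_from n0) series_R = R \<and> msubst (coeffs_from n0) series_S = S"
proof -
  define \<rho> where "\<rho> = inverse R"
  \<comment> \<open>\<open>\<nu>\<close> is the down-passage series divided by \<open>fps_X\<close>.
    Reversing a walk exchanges \<open>l\<close> with \<open>R * m\<close>, and
    \<open>C = \<alpha> * \<nu>\<close> solves the equation for closed walks by the relation for
    \<open>\<nu>\<close>.\<close>
  define l where "l = fps_X * \<nu>"
  define m where "m = l * \<rho>"
  define C where "C = \<alpha> * \<nu>"
  have \<alpha>0: "\<alpha> $ 0 = 1"
    by (simp add: \<alpha> power2_eq_square)
  then have \<alpha>nz: "\<alpha> \<noteq> 0"
    by auto
  have "(\<alpha> * R) $ 0 = 1"
    unfolding R by (simp add: power2_eq_square)
  then have R0: "R $ 0 \<noteq> 0" "R \<noteq> 0"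
    using \<alpha>0 by auto
  have \<rho>: "R * \<rho> = 1"
    unfolding \<rho>_def by (rule fps_mult_inverse[OF R0(1)])
  have Rm: "R * m = l"
    unfolding m_def using \<rho> by (metis mult.commute mult.left_commute mult_1_right)
  have "\<alpha> * (fps_X * (l\<^sup>2 + S * l + R)) = fps_X * (\<alpha> * l\<^sup>2 + (\<alpha> * S) * l + \<alpha> * R)"
    by (simp add: algebra_simps)
  also have "\<dots> = fps_X * (1 + 3 * \<alpha> * fps_X\<^sup>2 * \<nu>\<^sup>2 - fps_X\<^sup>2 * \<nu>)"
    unfolding R S l_def by (simp add: algebra_simps power2_eq_square)
  also have "\<dots> = \<alpha> * l"
    unfolding \<nu>[symmetric] l_def by (simp add: algebra_simps)
  finally have l: "l = fps_X * (l\<^sup>2 + S * l + R)"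
    using \<alpha>nz by simp
  have "R * (fps_X * (1 + S * m + R * m\<^sup>2)) = fps_X * (R + S * (R * m) + (R * m)\<^sup>2)"
    by (simp add: algebra_simps power2_eq_square)
  also have "\<dots> = R * m"
    unfolding Rm using l by (simp add: algebra_simps)
  finally have m: "m = fps_X * (1 + S * m + R * m\<^sup>2)"
    using R0 by simp
  have "1 + fps_X * C * (l + S + R * m) = 1 + fps_X * \<nu> * (2 * \<alpha> * l + \<alpha> * S)"
    unfolding Rm C_def by (simp add: algebra_simps)
  also have "\<dots> = 1 + 3 * \<alpha> * fps_X\<^sup>2 * \<nu>\<^sup>2 - fps_X\<^sup>2 * \<nu>"
    unfolding S l_def by (simp add: algebra_simps power2_eq_square)
  also have "\<dots> = C"
    unfolding \<nu>[symmetric] C_def by simp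
  finally have C: "C = 1 + fps_X * C * (l + S + R * m)" ..
  interpret walk_generating_function R S "\<lambda>j. if j \<ge> 0 then C * m ^ nat j else C * l ^ nat (- j)"
    by (rule walk_generating_functionI[OF m l C])
  \<comment> \<open>Walk lengths \<open>k = n - 1\<close> of the absent coefficients: index 1
    always, index 2 when \<open>n0 = 3\<close>.\<close>
  define B where "B = (if n0 = 2 then {0} else {0, 1 :: nat})"
  have c: "coeffs_from n0 (Suc k) * walk R S k j = (if k \<in> B then 0 else fps_X ^ Suc k * walk R S k j)" for k j
    using n0 by (auto simp: coeffs_from_def B_def)
  have Bsum: "(\<Sum>k\<in>B. fps_X ^ Suc k * walk R S k j) = fps_X * walk R S 0 j + h * fps_X\<^sup>2 * walk R S (Suc 0) j" for j
    using n0 by (auto simp: B_def power2_eq_square simp del: walk.simps)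
  have R_eq: "R = 1 + (fps_X * (C * l) - h * fps_X\<^sup>2 * R)"
  proof -
    have "R + h * fps_X\<^sup>2 * R = \<alpha> * R"
      by (simp add: \<alpha> algebra_simps)
    also have "\<dots> = 1 + fps_X * (C * l)"
      unfolding R C_def l_def by (simp add: power2_eq_square mult_ac)
    finally show ?thesis
      by (simp add: algebra_simps)
  qed
  have S_eq: "S = fps_X * C - (fps_X + h * fps_X\<^sup>2 * S)"
  proof -
    have "S + h * fps_X\<^sup>2 * S = \<alpha> * S"
      by (simp add: \<alpha> algebra_simps)
    also have "\<dots> = fps_X * C - fps_X"
      unfolding S C_def by (simp add: mult_ac)
    finally show ?thesis
      by (simp add: algebra_simps)
  qed
  have B: "finite B"
    by (simp add: B_def)
  have "substituted_RS_system (coeffs_from n0) R S"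
    unfolding substituted_RS_system_def system_R_eq_walk system_S_eq_walk
  proof (intro allI conjI)
    fix d
    have "(\<Sum>k<d. (coeffs_from n0 (Suc k) * walk R S k (- 1)) $ d) = (fps_X * (C * l) - h * fps_X\<^sup>2 * R) $ d"
      using sum_walk[where j = "- 1" and d = d, OF c B] unfolding Bsum by simp
    moreover have "R $ d = (1 + (fps_X * (C * l) - h * fps_X\<^sup>2 * R)) $ d"
      using R_eq by simp
    ultimately show "R $ d = 1 $ d + (\<Sum>k<d. (coeffs_from n0 (Suc k) * walk R S k (- 1)) $ d)"
      by (simp only: fps_add_nth)
    have "(\<Sum>k<d. (coeffs_from n0 (Suc k) * walk R S k 0) $ d) = (fps_X * C - (fps_X + h * fps_X\<^sup>2 * S)) $ d"
      using sum_walk[where j = 0 and d = d, OF c B] unfolding Bsum by simp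
    then show "S $ d = (\<Sum>k<d. (coeffs_from n0 (Suc k) * walk R S k 0) $ d)"
      using S_eq by simp
  qed
  from graded_substitution.substituted_RS_system_unique[OF graded_substitution_from
      substituted_RS_system_series[OF graded_substitution_from] this]
  show ?thesis .
qed

lemma series_RS_even:
  fixes \<alpha> e q :: "rat fps"
  assumes \<alpha>: "\<alpha> = 1 + fps_X\<^sup>2" and e: "\<alpha> * e = 1"
    and q: "4 * fps_X\<^sup>2 * q\<^sup>2 = (1 + 5 * fps_X\<^sup>2) * q - (1 + 2 * fps_X\<^sup>2)"
  shows "msubst coeffs_even series_R = e * q \<and> msubst coeffs_even series_S = 0"
proof -
  \<comment> \<open>\<open>p\<close> is to be \<open>R * m\<^sup>2\<close>. The system demands
    \<open>\<alpha> * R = 1 + fps_X * (C * l)\<close>, so \<open>fps_X * (C * l) = q - 1\<close>,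
    and the equation for closed walks then forces \<open>C = 2 * q - 1\<close>.\<close>
  define R p m l C where "R = e * q" and "p = 1 - inverse q" and "m = fps_X * (1 + p)"
    and "l = R * m" and "C = 2 * q - 1"
  have "(4 * fps_X\<^sup>2 * q\<^sup>2) $ 0 = ((1 + 5 * fps_X\<^sup>2) * q - (1 + 2 * fps_X\<^sup>2)) $ 0"
    by (simp only: q)
  then have "q $ 0 = 1"
    by (simp add: power2_eq_square)
  then have qi: "q * inverse q = 1" "q \<noteq> 0"
    using fps_mult_inverse[of q] by auto
  have qp: "q * p = q - 1"
    by (simp add: p_def right_diff_distrib qi)
  have \<alpha>nz: "\<alpha> \<noteq> 0"
    using e by auto
  have "\<alpha> * q * (R * m\<^sup>2) = (\<alpha> * e) * fps_X\<^sup>2 * (q + q * p)\<^sup>2"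
    unfolding R_def m_def by (simp add: algebra_simps power2_eq_square)
  also have "\<dots> = 4 * fps_X\<^sup>2 * q\<^sup>2 - 4 * fps_X\<^sup>2 * q + fps_X\<^sup>2"
    unfolding e qp by (simp add: algebra_simps power2_eq_square)
  also have "\<dots> = \<alpha> * (q * p)"
    unfolding q qp \<alpha> by (simp add: algebra_simps)
  finally have "(\<alpha> * q) * (R * m\<^sup>2) = (\<alpha> * q) * p"
    by (simp only: mult.assoc)
  then have Rmm: "R * m\<^sup>2 = p"
    using \<alpha>nz qi by simp
  have m: "m = fps_X * (1 + 0 * m + R * m\<^sup>2)"
    unfolding Rmm by (simp add: m_def)
  have l: "l = fps_X * (l\<^sup>2 + 0 * l + R)"
  proof -
    have "fps_X * (l\<^sup>2 + 0 * l + R) = R * (fps_X * (1 + R * m\<^sup>2))"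
      unfolding l_def by (simp add: algebra_simps power2_eq_square)
    then show ?thesis
      unfolding Rmm m_def[symmetric] l_def[symmetric] by simp
  qed
  have XCl: "fps_X * (C * l) = q - 1"
  proof -
    have "fps_X * (C * l) = fps_X * ((q + q * p) * (R * m))"
      unfolding qp C_def l_def by (simp add: algebra_simps)
    also have "\<dots> = q * (R * (m * (fps_X * (1 + p))))"
      by (simp add: algebra_simps)
    also have "\<dots> = q * p"
      unfolding m_def[symmetric] using Rmm by (simp add: power2_eq_square)
    finally show ?thesis
      by (simp add: qp)
  qed
  have C: "C = 1 + fps_X * C * (l + 0 + R * m)"
  proof -
    have "1 + fps_X * C * (l + 0 + R * m) = 1 + 2 * (fps_X * (C * l))"
      unfolding l_def by (simp add: algebra_simps)
    then show ?thesis
      unfolding XCl by (simp add: C_def)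
  qed
  interpret walk_generating_function R 0 "\<lambda>j. if j \<ge> 0 then C * m ^ nat j else C * l ^ nat (- j)"
    by (rule walk_generating_functionI[OF m l C])
  \<comment> \<open>Parity removes all even lengths automatically, so only \<open>k = 1\<close>, the
    absent quadratic coefficient, has to be excluded.\<close>
  have cR: "coeffs_even (Suc k) * walk R 0 k (- 1) = (if k \<in> {1} then 0 else fps_X ^ Suc k * walk R 0 k (- 1))" for k
  proof (cases "even k")
    case True
    then have "walk R 0 k (- 1) = 0"
      by (intro walk_symmetric_parity) auto
    then show ?thesis
      by simp
  next
    case False
    then have "k = 1 \<or> k \<ge> 3"
      by presburger
    then show ?thesis
      using False by (auto simp: coeffs_even_def)
  qed
  have cS: "coeffs_even (Suc k) * walk R 0 k 0 = 0" for k
    using walk_symmetric_parity[of k 0 R] by (cases "even k") (auto simp: coeffs_even_def)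
  have R_eq: "R = 1 + (fps_X * (C * l) - fps_X\<^sup>2 * R)"
  proof -
    have "R + fps_X\<^sup>2 * R = \<alpha> * e * q"
      by (simp add: R_def \<alpha> algebra_simps)
    then show ?thesis
      unfolding XCl e by (simp add: algebra_simps)
  qed
  have "substituted_RS_system coeffs_even R 0"
    unfolding substituted_RS_system_def system_R_eq_walk system_S_eq_walk
  proof (intro allI conjI)
    fix d
    have "(\<Sum>k<d. (coeffs_even (Suc k) * walk R 0 k (- 1)) $ d) = (fps_X * (C * l) - fps_X\<^sup>2 * R) $ d"
      using sum_walk[where j = "- 1" and d = d, OF cR] by (simp add: power2_eq_square)
    moreover have "R $ d = (1 + (fps_X * (C * l) - fps_X\<^sup>2 * R)) $ d"
      using R_eq by simp
    ultimately show "R $ d = 1 $ d + (\<Sum>k<d. (coeffs_even (Suc k) * walk R 0 k (- 1)) $ d)"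
      by (simp only: fps_add_nth)
    show "0 $ d = (\<Sum>k<d. (coeffs_even (Suc k) * walk R 0 k 0) $ d)"
      by (simp add: cS)
  qed
  from graded_substitution.substituted_RS_system_unique[OF graded_substitution_even
      substituted_RS_system_series[OF graded_substitution_even] this]
  show ?thesis
    by (simp add: R_def)
qed

section \<open>Planar free energy\<close>

lemma fps_X_deriv_log:
  fixes f :: "rat fps"
  assumes "f $ 0 = 1"
  shows "f * (fps_X * fps_deriv (fps_log f)) = fps_X * fps_deriv f"
proof -
  have f1: "(f - 1) $ 0 = 0"
    using assms by simp
  have "fps_deriv (fps_log f) = (inverse (1 + fps_X) oo (f - 1)) * fps_deriv f"
    unfolding fps_log_def by (simp add: fps_compose_deriv[OF f1] fps_ln_deriv)
  moreover have "f * (inverse (1 + fps_X) oo (f - 1)) = 1"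
  proof -
    have "(1 + fps_X) oo (f - 1) = f"
      by (simp add: fps_compose_add_distrib fps_X_fps_compose_startby0[OF f1])
    moreover have "((1 + fps_X) oo (f - 1)) * (inverse (1 + fps_X) oo (f - 1))
        = ((1 + fps_X) * inverse (1 + fps_X)) oo (f - 1)"
      by (rule fps_compose_mult_distrib[OF f1, symmetric])
    moreover have "(1 + fps_X) * inverse (1 + fps_X) = (1 :: rat fps)"
      by (rule fps_mult_inverse) simp
    ultimately show ?thesis
      by simp
  qed
  moreover have "f * (fps_X * (c * fps_deriv f)) = (f * c) * (fps_X * fps_deriv f)" for c
    by (simp only: mult_ac)
  ultimately show ?thesis
    by simp
qed

lemma fps_log_nth_0: "fps_log f $ 0 = 0"
  by (simp add: fps_log_def)

text \<open>Two roots with constant term 1 have a sum with constant term 2, hence nonzero, so their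
  difference must vanish.\<close>

lemma fps_sqrt_eqI:
  fixes f g :: "rat fps"
  assumes "g\<^sup>2 = f" "g $ 0 = 1"
  shows "fps_sqrt f = g"
proof -
  have f0: "f $ 0 = 1"
    using assms by (auto simp: power2_eq_square)
  have "fps_sqrt f ^ Suc 1 = f"
    unfolding fps_sqrt_def numeral_2_eq_2 One_nat_def
    using power_radical[of f "\<lambda>_ _. 1" 1] f0 by simp
  then have "(fps_sqrt f - g) * (fps_sqrt f + g) = 0"
    using assms by (simp add: algebra_simps power2_eq_square)
  moreover have "(fps_sqrt f + g) $ 0 \<noteq> 0"
    using assms by (simp add: fps_sqrt_def)
  then have "fps_sqrt f + g \<noteq> 0"
    by (metis fps_zero_nth)
  ultimately show ?thesis
    by simp
qed

lemma planar_free_energy_deriv_even: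
  fixes \<alpha> e q :: "rat fps"
  assumes "\<alpha> = 1 + fps_X\<^sup>2" "\<alpha> * e = 1"
    and "4 * fps_X\<^sup>2 * q\<^sup>2 = (1 + 5 * fps_X\<^sup>2) * q - (1 + 2 * fps_X\<^sup>2)"
  shows "fps_X * fps_deriv (msubst coeffs_even planar_free_energy) = e * q - e * (q - 1)\<^sup>2 - 1"
  using graded_substitution.msubst_euler[OF graded_substitution_even loop_equation_planar_free_energy]
    second_moment_even[OF assms] by simp

lemma planar_free_energy_nth_0_even: "msubst coeffs_even planar_free_energy $ 0 = 0"
  using graded_substitution.msubst_nth_0[OF graded_substitution_even] planar_free_energy_empty by simp

lemma planar_free_energy_nth_0_from: "msubst (coeffs_from n0) planar_free_energy $ 0 = 0"
  using graded_substitution.msubst_nth_0[OF graded_substitution_from] planar_free_energy_empty by simp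

text \<open>As \<open>fps_X\<close> is the square root of \<open>t\<close>, this is
  \<open>2 t d/dt\<close>; hence the factors 2 in derivatives of \<open>t\<close>.\<close>

definition euler :: "rat fps \<Rightarrow> rat fps"
  where "euler f = fps_X * fps_deriv f"

lemma euler_simps:
  "euler (f + g) = euler f + euler g" "euler (f - g) = euler f - euler g"
  "euler (f * g) = euler f * g + f * euler g" "euler (fps_const c) = 0" "euler (numeral n) = 0"
  "euler 1 = 0" "euler 0 = 0" "euler fps_X = fps_X"
  by (simp_all add: euler_def algebra_simps)

lemma euler_power2: "euler (f\<^sup>2) = 2 * f * euler f"
  by (simp add: power2_eq_square euler_simps)

lemma euler_X_power2: "euler (fps_X\<^sup>2) = 2 * fps_X\<^sup>2"
  by (simp add: euler_power2 euler_simps power2_eq_square)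

lemma euler_eqI: "euler F = euler G \<Longrightarrow> F $ 0 = G $ 0 \<Longrightarrow> F = G"
  unfolding euler_def by (auto simp: fps_deriv_eq_iff)

lemma euler_log: "f $ 0 = 1 \<Longrightarrow> f * euler (fps_log f) = euler f"
  unfolding euler_def by (rule fps_X_deriv_log)

lemma fps_to_fls_divide_eqI:
  fixes a n d :: "rat fps"
  assumes "d \<noteq> 0" "n = d * a"
  shows "fps_to_fls n / fps_to_fls d = fps_to_fls a"
  using assms by (simp add: fls_times_fps_to_fls)

subsection \<open>The even potential\<close>

text \<open>All quantities are rational in \<open>q\<close>: with
  \<open>v = 1 / (4 q^2 - 5 q + 2)\<close> one has \<open>t = (q - 1) v\<close>,
  \<open>1 + t = (2 q - 1)^2 v\<close> and \<open>r = (2 q - 1) (3 - 2 q) v\<close>. The free energy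
  is then found by comparing Euler derivatives.\<close>

lemma even_parametrisation:
  fixes t r :: "rat fps"
  assumes t: "t = fps_X\<^sup>2" and r: "r = fps_sqrt ((1 + t) * (1 - 7 * t))"
  obtains e q v where "(1 + t) * e = 1" "4 * t * q\<^sup>2 = (1 + 5 * t) * q - (1 + 2 * t)"
    "r = 1 + 5 * t - 8 * t * q" "v = 1 + t - 4 * t * q"
    "8 * msubst coeffs_even planar_free_energy = 2 * (q - 1) * (q - 5) - fps_log (1 + t) - 3 * fps_log v"
    "1 - 22 * t + 49 * t\<^sup>2 - (1 - 19 * t) * r = 128 * t\<^sup>2 * (fps_const (1 / 4) * ((q - 1) * (q - 5)))"
    "q = 1 + t * (2 + 4 * (q * q) - 5 * q)" "e = 1 - t * e"
    "euler (msubst coeffs_even planar_free_energy) = e * (3 * q - q * q - 1) - 1"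
proof -
  define \<alpha> where "\<alpha> = 1 + t"
  have t0: "t $ 0 = 0"
    by (simp add: t power2_eq_square)
  have tnz: "t \<noteq> 0"
    by (simp add: t)
  have "\<alpha> $ 0 \<noteq> 0"
    by (simp add: \<alpha>_def t0)
  then obtain e where e: "\<alpha> * e = 1"
    using fps_mult_inverse[of \<alpha>] by auto
  obtain q :: "rat fps" where q_fix: "q = 1 + fps_X * (2 * fps_X + (- 5 * fps_X) * q + (4 * fps_X) * q\<^sup>2)"
    using fps_X_mult_quadratic_fixpoint[of 1 "2 * fps_X" "- 5 * fps_X" "4 * fps_X"] by blast
  then have q_eq: "q = 1 + t * (2 + 4 * (q * q) - 5 * q)"
    by (simp add: t algebra_simps power2_eq_square)
  have q: "4 * t * q\<^sup>2 = (1 + 5 * t) * q - (1 + 2 * t)"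
    using q_eq by (simp add: algebra_simps power2_eq_square)
  have q0: "q $ 0 = 1"
    by (subst q_eq) (simp add: t0)
  define v where "v = 1 + t - 4 * t * q"
  \<comment> \<open>The quadratic equation says \<open>t * De = q - 1\<close>. Its inverse turns out
    to be \<open>v\<close>, the argument of the second logarithm.\<close>
  define De where "De = 4 * q\<^sup>2 - 5 * q + 2"
  have tDe: "t * De = q - 1"
    using q by (simp add: De_def algebra_simps)
  have "v * De = De + t * De - 4 * q * (t * De)"
    by (simp add: v_def algebra_simps)
  also have "\<dots> = 1"
    unfolding tDe unfolding De_def by (simp add: algebra_simps power2_eq_square)
  finally have vDe: "v * De = 1" .
  have t_v: "t = (q - 1) * v"
    using tDe vDe by (metis mult.assoc mult.commute mult_1_right)
  have "\<alpha> = v * De + (q - 1) * v"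
    unfolding vDe t_v[symmetric] \<alpha>_def ..
  then have \<alpha>_v: "\<alpha> = (2 * q - 1)\<^sup>2 * v"
    by (simp add: De_def algebra_simps power2_eq_square)
  define r' where "r' = 1 + 5 * t - 8 * t * q"
  have "r' = v * De + (5 - 8 * q) * ((q - 1) * v)"
    unfolding vDe t_v[symmetric] r'_def by (simp add: algebra_simps)
  then have r_v: "r' = (2 * q - 1) * (3 - 2 * q) * v"
    by (simp add: De_def algebra_simps power2_eq_square)
  have r'0: "r' $ 0 = 1"
    by (simp add: r'_def t0 mult.assoc)
  have "r'\<^sup>2 = (1 + 5 * t)\<^sup>2 - 16 * t * (1 + 5 * t) * q + 16 * t * (4 * t * q\<^sup>2)"
    by (simp add: r'_def algebra_simps power2_eq_square)
  also have "\<dots> = (1 + t) * (1 - 7 * t)"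
    unfolding q by (simp add: algebra_simps power2_eq_square)
  finally have rr': "r = r'"
    unfolding r by (intro fps_sqrt_eqI r'0)
  have v0: "v $ 0 = 1"
    by (simp add: v_def t0 mult.assoc)
  have "euler (4 * t * q\<^sup>2) = euler ((1 + 5 * t) * q - (1 + 2 * t))"
    by (simp only: q)
  then have dq: "r' * euler q = 2 * (q - 1)"
    unfolding tDe[symmetric] De_def r'_def
    by (simp add: euler_simps euler_power2 euler_X_power2 t algebra_simps power2_eq_square)
  have "euler (v * De) = 0"
    unfolding vDe by (simp add: euler_simps)
  moreover have "euler (v * De) = euler v * De + v * ((8 * q - 5) * euler q)"
    by (simp add: De_def euler_simps euler_power2 algebra_simps)
  ultimately have *: "euler v * De = - (v * ((8 * q - 5) * euler q))"
    by (simp only: eq_neg_iff_add_eq_0)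
  have "euler v * (v * De) = v * (euler v * De)"
    by (simp only: mult_ac)
  then have "v * euler (fps_log v) = v * - (v * ((8 * q - 5) * euler q))"
    unfolding * vDe euler_log[OF v0] by (simp only: mult_1_right)
  moreover have "v \<noteq> 0"
    using v0 by auto
  ultimately have dv: "euler (fps_log v) = - (v * ((8 * q - 5) * euler q))"
    by (simp only: mult_cancel_left simp_thms)
  have "euler \<alpha> = 2 * t"
    unfolding \<alpha>_def t by (simp add: euler_simps euler_X_power2)
  moreover have "\<alpha> * euler (fps_log \<alpha>) = euler \<alpha>"
    by (rule euler_log) (simp add: \<alpha>_def t0)
  ultimately have d\<alpha>: "\<alpha> * euler (fps_log \<alpha>) = 2 * t"
    by (simp only:)
  define F where "F = msubst coeffs_even planar_free_energy"
  have dF: "euler F = e * q - e * (q - 1)\<^sup>2 - 1"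
    unfolding euler_def F_def
    by (rule planar_free_energy_deriv_even[OF _ e]) (use q in \<open>simp_all add: \<alpha>_def t\<close>)
  \<comment> \<open>The factor \<open>\<alpha> * r'\<close> clears the denominators of
    \<open>e\<close>, of \<open>euler q\<close> and of the logarithmic derivative of
    \<open>\<alpha>\<close>.\<close>
  have "\<alpha> * r' * euler (8 * F) = \<alpha> * r' * euler (2 * (q - 1) * (q - 5) - fps_log \<alpha> - 3 * fps_log v)"
  proof -
    have "\<alpha> * r' * euler (8 * F) = 8 * r' * ((\<alpha> * e) * (3 * q - q * q - 1)) - 8 * \<alpha> * r'"
      by (simp add: euler_simps dF algebra_simps power2_eq_square)
    also have "\<dots> = 8 * r' * (3 * q - q * q - 1) - 8 * \<alpha> * r'"
      unfolding e by simp
    \<comment> \<open>The last summand is zero because \<open>v * De = 1\<close>; it makes the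
      equation a polynomial identity in \<open>q\<close> and \<open>v\<close>.\<close>
    also have "\<dots> = \<alpha> * ((4 * q - 12) + 3 * v * (8 * q - 5)) * (2 * (q - 1)) - r' * (2 * t)
        - (v * De - 1) * (16 * q\<^sup>2 * v - 8 * q * v)"
      unfolding \<alpha>_v r_v t_v De_def by (simp add: algebra_simps eval_nat_numeral)
    also have "\<dots> = \<alpha> * ((4 * q - 12) + 3 * v * (8 * q - 5)) * (r' * euler q) - r' * (\<alpha> * euler (fps_log \<alpha>))"
      unfolding dq d\<alpha> vDe by simp
    also have "\<dots> = \<alpha> * r' * euler (2 * (q - 1) * (q - 5) - fps_log \<alpha> - 3 * fps_log v)"
      by (simp add: euler_simps dv algebra_simps)
    finally show ?thesis .
  qed
  moreover have "\<alpha> * r' \<noteq> 0"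
    using r'0 e by auto
  ultimately have "euler (8 * F) = euler (2 * (q - 1) * (q - 5) - fps_log \<alpha> - 3 * fps_log v)"
    by simp
  then have F: "8 * F = 2 * (q - 1) * (q - 5) - fps_log \<alpha> - 3 * fps_log v"
    by (rule euler_eqI) (simp add: F_def planar_free_energy_nth_0_even fps_log_nth_0 q0 mult.assoc)
  have "1 - 22 * t + 49 * t\<^sup>2 - (1 - 19 * t) * r' = 32 * t\<^sup>2 * ((q - 1) * (q - 5))
      - (v * De - 1) * (1 - 35 * q * v + 8 * q\<^sup>2 * v + 27 * v)"
    unfolding r_v t_v De_def by (simp add: algebra_simps eval_nat_numeral)
  also have "\<dots> = 32 * t\<^sup>2 * ((q - 1) * (q - 5))"
    unfolding vDe by simp
  also have "\<dots> = 128 * t\<^sup>2 * (fps_const (1 / 4) * ((q - 1) * (q - 5)))"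
  proof -
    have "(128 :: rat fps) * fps_const (1 / 4) = 32"
      by (simp add: numeral_fps_const)
    moreover have "128 * t\<^sup>2 * (fps_const (1 / 4) * f) = 128 * fps_const (1 / 4) * t\<^sup>2 * f" for f
      by (simp only: mult_ac)
    ultimately show ?thesis
      by (simp only:)
  qed
  finally have num: "1 - 22 * t + 49 * t\<^sup>2 - (1 - 19 * t) * r = 128 * t\<^sup>2 * (fps_const (1 / 4) * ((q - 1) * (q - 5)))"
    unfolding rr' .
  have e_eq: "e = 1 - t * e"
    using e by (simp add: \<alpha>_def algebra_simps)
  show thesis
    by (rule that[OF e[unfolded \<alpha>_def] q rr'[unfolded r'_def] v_def F[unfolded F_def \<alpha>_def] num q_eq e_eq])
      (use dF in \<open>simp add: F_def algebra_simps power2_eq_square\<close>)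
qed

subsection \<open>The logarithmic potentials\<close>

text \<open>In terms of \<open>T = t / \<alpha>\<close> and \<open>g = \<alpha> * \<nu>\<close> the
  curve no longer depends on \<open>h\<close>. Since \<open>(3 * g - 1) * k\<close> is the inverse
  of \<open>g\<close>, the last fact says that the Euler derivative of \<open>A + log g\<close> is
  that of the free energy plus \<open>h * T\<close>, and \<open>T\<close> is half the Euler
  derivative of \<open>log (1 + t)\<close>.\<close>

lemma from_parametrisation:
  fixes t \<alpha> r h :: "rat fps"
  assumes n0: "n0 = 2 \<and> h = 0 \<or> n0 = 3 \<and> h = 1" and t: "t = fps_X\<^sup>2" and \<alpha>: "\<alpha> = 1 + h * t"
  obtains e g T k A where "\<alpha> * e = 1" "T = t * e" "g = 1 + T * (3 * (g * g) - g)" "e = 1 - h * t * e"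
    "k * (g * (3 * g - 1)) = 1" "T = (g - 1) * k" "g $ 0 = 1"
    "msubst (coeffs_from n0) series_S = fps_X * (e * (g - 1))"
    "msubst (coeffs_from n0) series_R = e + T * e * g\<^sup>2"
    "euler (msubst (coeffs_from n0) planar_free_energy) + h * T
      = e * (T * (2 * (g * g) - 2 * g + 1) + T * T * (2 * (g * (g * g)) - 3 * (g * g * (g * g))))"
    "A = fps_const (1 / 4) * ((3 * g ^ 5 - 30 * g ^ 4 + 35 * g ^ 3 - 2 * g\<^sup>2 - 8 * g + 2) * k\<^sup>2 * g)"
    "euler A + (3 * g - 1) * k * euler g = euler (msubst (coeffs_from n0) planar_free_energy) + h * T"
proof -
  have t0: "t $ 0 = 0"
    by (simp add: t power2_eq_square)
  have \<alpha>0: "\<alpha> $ 0 = 1"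
    by (simp add: \<alpha> t0)
  then obtain e where e: "\<alpha> * e = 1"
    using fps_mult_inverse[of \<alpha>] by auto
  define T where "T = t * e"
  obtain g where g_fix: "g = 1 + fps_X * (0 + (- fps_X * e) * g + (3 * fps_X * e) * g\<^sup>2)"
    using fps_X_mult_quadratic_fixpoint[of 1 0 "- fps_X * e" "3 * fps_X * e"] by blast
  then have g_eq: "g = 1 + T * (3 * (g * g) - g)"
    by (simp add: t T_def algebra_simps power2_eq_square)
  have T0: "T $ 0 = 0"
    by (simp add: T_def t0)
  have g0: "g $ 0 = 1"
    by (subst g_eq) (simp add: T0)
  have "(g * (3 * g - 1)) $ 0 \<noteq> 0"
    by (simp add: g0 numeral_fps_const)
  then obtain k where k: "k * (g * (3 * g - 1)) = 1"
    using fps_mult_inverse by (metis mult.commute)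
  have Tg: "T * (g * (3 * g - 1)) = g - 1"
    using g_eq by (simp add: algebra_simps)
  then have Tk: "T = (g - 1) * k"
    using k by (metis mult.assoc mult.commute mult_1_right)
  have e_eq: "e = 1 - h * t * e"
    using e by (simp add: \<alpha> algebra_simps)
  define \<nu> R S where "\<nu> = e * g" and "R = e + T * e * g\<^sup>2" and "S = fps_X * (e * (g - 1))"
  have R: "\<alpha> * R = 1 + \<alpha> * (fps_X * \<nu>)\<^sup>2"
  proof -
    have "\<alpha> * R = (\<alpha> * e) + t * (\<alpha> * e) * e * g\<^sup>2"
      by (simp add: R_def T_def algebra_simps)
    moreover have "\<alpha> * (fps_X * \<nu>)\<^sup>2 = t * (\<alpha> * e) * e * g\<^sup>2"
      by (simp add: \<nu>_def t algebra_simps power2_eq_square)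
    ultimately show ?thesis
      by (simp add: e)
  qed
  have S: "\<alpha> * S = \<alpha> * (fps_X * \<nu>) - fps_X"
  proof -
    have "\<alpha> * S = \<alpha> * (fps_X * \<nu>) - (\<alpha> * e) * fps_X"
      by (simp add: S_def \<nu>_def algebra_simps)
    then show ?thesis
      by (simp add: e)
  qed
  have \<nu>: "\<alpha> * \<nu> + fps_X\<^sup>2 * \<nu> = 1 + 3 * \<alpha> * fps_X\<^sup>2 * \<nu>\<^sup>2"
  proof -
    have "\<alpha> * \<nu> + fps_X\<^sup>2 * \<nu> = (\<alpha> * e) * g + T * g"
      by (simp add: \<nu>_def T_def t algebra_simps)
    also have "\<dots> = 1 + 3 * T * g\<^sup>2"
      unfolding e using Tg by (simp add: algebra_simps power2_eq_square)
    also have "\<dots> = 1 + 3 * (\<alpha> * e) * T * g\<^sup>2"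
      by (simp add: e)
    also have "\<dots> = 1 + 3 * \<alpha> * fps_X\<^sup>2 * \<nu>\<^sup>2"
      by (simp add: \<nu>_def T_def t algebra_simps power2_eq_square)
    finally show ?thesis .
  qed
  have RS: "msubst (coeffs_from n0) series_R = R" "msubst (coeffs_from n0) series_S = S"
    using series_RS_from[OF n0 \<alpha>[unfolded t] R S \<nu>] by blast+
  have \<alpha>nz: "\<alpha> \<noteq> 0" and enz: "e \<noteq> 0" and gnz: "g \<noteq> 0"
    using e g0 by auto
  define \<kappa> where "\<kappa> = \<alpha> * (fps_X * \<nu>) ^ 3"
  define F where "F = msubst (coeffs_from n0) planar_free_energy"
  have "euler F = S\<^sup>2 + R - 2 * \<kappa> * S - \<kappa> * (fps_X * \<nu>) - 1"
    unfolding euler_def F_def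
      graded_substitution.msubst_euler[OF graded_substitution_from loop_equation_planar_free_energy]
    by (subst second_moment_from[OF n0 \<alpha>[unfolded t] R S \<nu> \<alpha>nz _ \<kappa>_def])
      (use enz gnz in \<open>auto simp: \<nu>_def\<close>)
  also have "\<dots> = T * e * (g - 1)\<^sup>2 + e + T * e * g\<^sup>2 - (\<alpha> * e) * (T * T * e * (2 * g ^ 3 * (g - 1) + g ^ 4)) - 1"
    unfolding S_def R_def \<kappa>_def \<nu>_def T_def t by (simp add: algebra_simps eval_nat_numeral)
  also have "\<dots> = e * (T * (2 * (g * g) - 2 * g + 1) + T * T * (2 * (g * (g * g)) - 3 * (g * g * (g * g)))) + (e - 1)"
    unfolding e by (simp add: algebra_simps eval_nat_numeral)
  also have "e - 1 = - (h * T)"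
    using e_eq by (simp add: T_def algebra_simps)
  finally have dF: "euler F + h * T
      = e * (T * (2 * (g * g) - 2 * g + 1) + T * T * (2 * (g * (g * g)) - 3 * (g * g * (g * g))))"
    by simp
  define N4 where "N4 = 3 * g ^ 5 - 30 * g ^ 4 + 35 * g ^ 3 - 2 * g\<^sup>2 - 8 * g + 2"
  \<comment> \<open>The derivative of \<open>N4\<close> as a polynomial in \<open>g\<close>.\<close>
  define dN where "dN = 15 * g ^ 4 - 120 * g ^ 3 + 105 * g\<^sup>2 - 4 * g - 8"
  \<comment> \<open>\<open>A\<close> is the algebraic part of the claimed free energy, rewritten by means of \<open>T = (g - 1) * k\<close>.
    The cofactors of relations such as \<open>k * (g * (3 * g - 1)) = 1\<close> come from polynomial division.\<close>
  define A where "A = fps_const (1 / 4) * (N4 * k\<^sup>2 * g)"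
  have four: "4 * fps_const (1 / 4) = (1 :: rat fps)"
    by (simp add: numeral_fps_const)
  have A4: "4 * A = N4 * k\<^sup>2 * g"
    unfolding A_def mult.assoc[symmetric] four by simp
  have eh: "euler h = 0"
    using n0 by (auto simp: euler_simps)
  have dT: "euler T = 2 * T * e"
  proof -
    have "\<alpha> * euler T = \<alpha> * (2 * T * e)"
    proof -
      have "\<alpha> * euler e + 2 * h * t * e = euler (\<alpha> * e)"
        unfolding \<alpha> t by (simp add: euler_simps euler_X_power2 eh algebra_simps)
      then have de: "\<alpha> * euler e = - (2 * h * t * e)"
        unfolding e by (simp add: euler_simps eq_neg_iff_add_eq_0)
      have "\<alpha> * euler T = 2 * t * (\<alpha> * e) + t * (\<alpha> * euler e)"
        unfolding T_def t by (simp add: euler_simps euler_X_power2 algebra_simps)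
      also have "\<dots> = 2 * t * (\<alpha> * e) - t * (2 * h * t * e)"
        unfolding de by simp
      also have "\<dots> = 2 * t * (1 - h * t * e)"
        unfolding e by (simp add: algebra_simps)
      also have "\<dots> = 2 * t * e * (\<alpha> * e)"
        unfolding e_eq[symmetric] e by simp
      finally show ?thesis
        by (simp add: T_def algebra_simps)
    qed
    then show ?thesis
      using \<alpha>nz by simp
  qed
  \<comment> \<open>Numerator of the derivative of \<open>(g - 1) / (g * (3 * g - 1))\<close>, that
    is of \<open>T\<close> as a function of \<open>g\<close>; thus \<open>\<rho> * k\<close> turns
    \<open>euler g\<close> into a polynomial in \<open>dg\<close>.\<close>
  define \<rho> where "\<rho> = - 3 * g\<^sup>2 + 6 * g - 1"
  have dg: "\<rho> * k * euler g = 2 * e * (g - 1)"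
  proof -
    have "euler (T * (g * (3 * g - 1))) = euler (g - 1)"
      by (simp only: Tg)
    then have "(1 - T * (6 * g - 1)) * euler g = 2 * e * (T * (g * (3 * g - 1)))"
      by (simp add: euler_simps dT algebra_simps)
    also have "\<dots> = 2 * e * (g - 1)"
      by (simp only: Tg)
    also have "1 - T * (6 * g - 1) = \<rho> * k - (k * (g * (3 * g - 1)) - 1)"
      unfolding Tk \<rho>_def by (simp add: algebra_simps power2_eq_square)
    finally show ?thesis
      unfolding k by simp
  qed
  have dk: "euler k = - (k\<^sup>2 * (6 * g - 1) * euler g)"
  proof -
    have "euler (k * (g * (3 * g - 1))) = 0"
      unfolding k by (simp add: euler_simps)
    moreover have "euler (k * (g * (3 * g - 1))) = euler k * (g * (3 * g - 1)) + k * ((6 * g - 1) * euler g)"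
      by (simp add: euler_simps algebra_simps)
    ultimately have *: "euler k * (g * (3 * g - 1)) = - (k * ((6 * g - 1) * euler g))"
      by (simp only: eq_neg_iff_add_eq_0)
    have "euler k * (k * (g * (3 * g - 1))) = k * (euler k * (g * (3 * g - 1)))"
      by (simp only: mult_ac)
    then show ?thesis
      unfolding * k by (simp add: power2_eq_square mult.assoc)
  qed
  define C where "C = dN * k\<^sup>2 * g - 2 * N4 * k ^ 3 * g * (6 * g - 1) + N4 * k\<^sup>2"
  have dA: "euler (4 * A) = C * euler g"
    unfolding A4
    by (simp add: N4_def dN_def C_def euler_simps dk eval_nat_numeral algebra_simps)
  \<comment> \<open>The factor 4 removes the constant 1/4 of \<open>A\<close>, and
    \<open>\<rho> * k\<close> eliminates \<open>euler g\<close>.\<close>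
  have "\<rho> * k * (4 * (euler A + (3 * g - 1) * k * euler g)) = (C + 4 * (3 * g - 1) * k) * (\<rho> * k * euler g)"
    using dA by (simp add: euler_simps algebra_simps)
  also have "\<dots> = 2 * e * ((C + 4 * (3 * g - 1) * k) * (g - 1))"
    unfolding dg by (simp add: algebra_simps)
  also have "(C + 4 * (3 * g - 1) * k) * (g - 1)
      = 2 * \<rho> * k * (T * (2 * (g * g) - 2 * g + 1) + T * T * (2 * (g * (g * g)) - 3 * (g * g * (g * g))))
      + (k * (g * (3 * g - 1)) - 1) * (16 * g * k - 32 * g * k\<^sup>2 - 12 * g\<^sup>2 * k + 32 * g\<^sup>2 * k\<^sup>2
        + 136 * g ^ 3 * k\<^sup>2 - 278 * g ^ 4 * k\<^sup>2 + 156 * g ^ 5 * k\<^sup>2 - 18 * g ^ 6 * k\<^sup>2 - 4 * k + 4 * k\<^sup>2)"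
    unfolding C_def N4_def dN_def \<rho>_def Tk by (simp add: algebra_simps eval_nat_numeral)
  also have "2 * e * \<dots> = \<rho> * k * (4 * (euler F + h * T))"
    unfolding k dF by (simp add: algebra_simps)
  finally have "\<rho> * k * (4 * (euler A + (3 * g - 1) * k * euler g)) = \<rho> * k * (4 * (euler F + h * T))" .
  moreover have "\<rho> * k \<noteq> 0"
  proof -
    have "\<rho> $ 0 \<noteq> 0"
      by (simp add: \<rho>_def g0 power2_eq_square numeral_fps_const)
    moreover have "k \<noteq> 0"
      using k by auto
    ultimately show ?thesis
      by auto
  qed
  ultimately have "4 * (euler A + (3 * g - 1) * k * euler g) = 4 * (euler F + h * T)"
    by (simp only: mult_cancel_left simp_thms)
  then have dA': "euler A + (3 * g - 1) * k * euler g = euler F + h * T"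
    by (subst (asm) mult_cancel_left) simp
  show thesis
    by (rule that[OF e T_def g_eq e_eq k Tk g0 RS(2)[unfolded S_def] RS(1)[unfolded R_def]
        dF[unfolded F_def] A_def[unfolded N4_def] dA'[unfolded F_def]])
qed

subsection \<open>Truncated expansions\<close>

text \<open>Coefficient lists refer to powers of the square of \<open>fps_X\<close>, that is of \<open>t\<close>.\<close>

primrec tseries :: "rat list \<Rightarrow> rat fps" where
  "tseries [] = 0"
| "tseries (c # cs) = fps_const c + fps_X\<^sup>2 * tseries cs"

definition tapprox :: "rat fps \<Rightarrow> rat list \<Rightarrow> bool"
  where "tapprox f cs \<longleftrightarrow> (\<exists>h. f = tseries cs + fps_X ^ (2 * length cs) * h)"

text \<open>Product truncated to the common length: each shift by one power of \<open>t\<close>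
  drops the last entry of \<open>ys\<close>.\<close>

fun tmult :: "rat list \<Rightarrow> rat list \<Rightarrow> rat list" where
  "tmult [] ys = []"
| "tmult (x # xs) ys = map2 (+) (map ((*) x) ys) (0 # tmult xs (butlast ys))"

lemma length_tmult: "length xs = length ys \<Longrightarrow> length (tmult xs ys) = length xs"
  by (induction xs arbitrary: ys) auto

lemma tapprox_Nil: "tapprox f []"
  by (simp add: tapprox_def)

lemma tapprox_ConsI: "tapprox g cs \<Longrightarrow> f = fps_const c + fps_X\<^sup>2 * g \<Longrightarrow> tapprox f (c # cs)"
  unfolding tapprox_def by (auto simp: power2_eq_square algebra_simps)

lemma tapprox_ConsE:
  assumes "tapprox f (c # cs)"
  obtains g where "f = fps_const c + fps_X\<^sup>2 * g" "tapprox g cs"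
proof -
  obtain h where h: "f = tseries (c # cs) + fps_X ^ (2 * length (c # cs)) * h"
    using assms by (auto simp: tapprox_def)
  show thesis
    by (rule that[of "tseries cs + fps_X ^ (2 * length cs) * h"])
      (use h in \<open>auto simp: tapprox_def power2_eq_square algebra_simps\<close>)
qed

lemma tapprox_add:
  "length xs = length ys \<Longrightarrow> tapprox f xs \<Longrightarrow> tapprox g ys \<Longrightarrow> tapprox (f + g) (map2 (+) xs ys)"
proof (induction xs ys arbitrary: f g rule: list_induct2)
  case (Cons x xs y ys)
  obtain f' where f': "f = fps_const x + fps_X\<^sup>2 * f'" "tapprox f' xs"
    using Cons.prems(1) by (rule tapprox_ConsE)
  obtain g' where g': "g = fps_const y + fps_X\<^sup>2 * g'" "tapprox g' ys"
    using Cons.prems(2) by (rule tapprox_ConsE)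
  have "tapprox (f' + g') (map2 (+) xs ys)"
    by (rule Cons.IH[OF f'(2) g'(2)])
  then have "tapprox (f + g) ((x + y) # map2 (+) xs ys)"
    by (rule tapprox_ConsI) (simp add: f'(1) g'(1) algebra_simps flip: fps_const_add)
  then show ?case
    by simp
qed (simp add: tapprox_Nil)

lemma tapprox_cmult: "tapprox f xs \<Longrightarrow> tapprox (fps_const c * f) (map ((*) c) xs)"
proof (induction xs arbitrary: f)
  case (Cons x xs)
  obtain f' where f': "f = fps_const x + fps_X\<^sup>2 * f'" "tapprox f' xs"
    using Cons.prems by (rule tapprox_ConsE)
  have "tapprox (fps_const c * f) (c * x # map ((*) c) xs)"
    by (rule tapprox_ConsI[OF Cons.IH[OF f'(2)]])
      (simp add: f'(1) algebra_simps flip: fps_const_mult)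
  then show ?case
    by simp
qed (simp add: tapprox_Nil)

lemma tapprox_take: "tapprox f xs \<Longrightarrow> tapprox f (take n xs)"
proof (induction xs arbitrary: f n)
  case (Cons x xs)
  obtain f' where f': "f = fps_const x + fps_X\<^sup>2 * f'" "tapprox f' xs"
    using Cons.prems by (rule tapprox_ConsE)
  show ?case
    by (cases n) (auto simp: tapprox_Nil intro: tapprox_ConsI[OF Cons.IH[OF f'(2)] f'(1)])
qed (simp add: tapprox_Nil)

lemma tapprox_butlast: "tapprox f xs \<Longrightarrow> tapprox f (butlast xs)"
  by (simp add: butlast_conv_take tapprox_take)

lemma tapprox_mult:
  "length xs = length ys \<Longrightarrow> tapprox f xs \<Longrightarrow> tapprox g ys \<Longrightarrow> tapprox (f * g) (tmult xs ys)"
proof (induction xs arbitrary: f g ys)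
  case (Cons x xs)
  obtain f' where f': "f = fps_const x + fps_X\<^sup>2 * f'" "tapprox f' xs"
    using Cons.prems(2) by (rule tapprox_ConsE)
  have len: "length xs = length (butlast ys)" "length (tmult xs (butlast ys)) = length xs"
    using Cons.prems(1) length_tmult[of xs "butlast ys"] by auto
  have "tapprox (f' * g) (tmult xs (butlast ys))"
    by (rule Cons.IH[OF len(1) f'(2) tapprox_butlast[OF Cons.prems(3)]])
  then have "tapprox (fps_const 0 + fps_X\<^sup>2 * (f' * g)) (0 # tmult xs (butlast ys))"
    by (rule tapprox_ConsI) simp
  from tapprox_add[OF _ tapprox_cmult[OF Cons.prems(3), of x] this]
  have "tapprox (fps_const x * g + (fps_const 0 + fps_X\<^sup>2 * (f' * g)))
      (map2 (+) (map ((*) x) ys) (0 # tmult xs (butlast ys)))"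
    using len Cons.prems(1) by simp
  then show ?case
    by (simp add: f'(1) algebra_simps)
qed (simp add: tapprox_Nil)

lemma tapprox_iterate:
  assumes "\<And>xs. tapprox f xs \<Longrightarrow> tapprox f (\<Phi> xs)"
  shows "tapprox f ((\<Phi> ^^ n) [])"
  by (induction n) (simp_all add: tapprox_Nil assms)

lemma tseries_nth:
  "tseries cs $ n = (if even n \<and> n div 2 < length cs then cs ! (n div 2) else 0)"
proof (induction cs arbitrary: n)
  case (Cons c cs)
  show ?case
  proof (cases "n < 2")
    case True
    then show ?thesis
      by (cases n) (auto simp: fps_X_power_mult_nth)
  next
    case False
    then obtain m where "n = Suc (Suc m)"
      by (metis add_2_eq_Suc le_Suc_ex not_less)
    then show ?thesis
      by (simp add: fps_X_power_mult_nth Cons.IH)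
  qed
qed simp

lemma tapprox_iff_nth:
  "tapprox f cs \<longleftrightarrow> (\<forall>n<2 * length cs. f $ n = (if even n then cs ! (n div 2) else 0))"
proof
  assume "tapprox f cs"
  then obtain h where "f = tseries cs + fps_X ^ (2 * length cs) * h"
    by (auto simp: tapprox_def)
  then show "\<forall>n<2 * length cs. f $ n = (if even n then cs ! (n div 2) else 0)"
    by (auto simp: fps_X_power_mult_nth tseries_nth)
next
  assume *: "\<forall>n<2 * length cs. f $ n = (if even n then cs ! (n div 2) else 0)"
  have "f = tseries cs + fps_X ^ (2 * length cs) * fps_shift (2 * length cs) (f - tseries cs)"
    by (rule fps_ext) (use * in \<open>auto simp: fps_X_power_mult_nth tseries_nth\<close>)
  then show "tapprox f cs"
    unfolding tapprox_def by blast
qed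

text \<open>The Euler operator multiplies the coefficient of \<open>t^i\<close> by
  \<open>2 i\<close>. At \<open>i = 0\<close> the quotient is a division by zero, whose value 0
  agrees with \<open>f $ 0 = 0\<close>.\<close>

lemma tapprox_euler:
  assumes "tapprox (euler f) cs" "f $ 0 = 0"
  shows "tapprox f (map (\<lambda>i. cs ! i / (2 * of_nat i)) [0..<length cs])"
  unfolding tapprox_iff_nth
proof (intro allI impI)
  fix n assume n: "n < 2 * length (map (\<lambda>i. cs ! i / (2 * of_nat i)) [0..<length cs])"
  then have "n div 2 < length cs"
    by auto
  moreover have "euler f $ n = (if even n then cs ! (n div 2) else 0)"
    using assms(1) n by (auto simp: tapprox_iff_nth)
  moreover have "euler f $ n = of_nat n * f $ n"
    by (cases n) (simp_all add: euler_def)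
  moreover have "even n \<Longrightarrow> of_nat n = (2 * of_nat (n div 2) :: rat)"
    by (metis dvd_mult_div_cancel of_nat_mult of_nat_numeral)
  ultimately show "f $ n = (if even n then map (\<lambda>i. cs ! i / (2 * of_nat i)) [0..<length cs] ! (n div 2) else 0)"
    using assms(2) by (cases "n = 0") (auto simp: field_simps)
qed

lemma tapprox_inverse_1_plus:
  assumes "e = 1 - fps_X\<^sup>2 * e"
  shows "tapprox e [1, - 1, 1, - 1, 1, - 1, 1, - 1, 1]"
proof -
  \<comment> \<open>Every round adds one correct coefficient; nine rounds reach
    \<open>t^8\<close>.\<close>
  have "tapprox e (((\<lambda>xs. 1 # map ((*) (- 1)) xs) ^^ 9) [])"
  proof (rule tapprox_iterate)
    fix xs assume "tapprox e xs"
    from tapprox_cmult[OF this, of "- 1"] show "tapprox e (1 # map ((*) (- 1)) xs)"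
      by (rule tapprox_ConsI) (subst assms, simp flip: fps_const_neg)
  qed
  then show ?thesis
    by (simp add: eval_nat_numeral)
qed

text \<open>One round of the fixed point equation for \<open>q\<close>: a valid list of coefficients
  becomes a valid list that is longer by one.\<close>

definition even_step :: "rat list \<Rightarrow> rat list"
  where "even_step xs = 1 # map2 (+) (take (length xs) [2, 0, 0, 0, 0, 0, 0, 0, 0])
    (map2 (+) (map ((*) 4) (tmult xs xs)) (map ((*) (- 5)) xs))"

lemma tapprox_const: "tapprox (fps_const c) [c, 0, 0, 0, 0, 0, 0, 0, 0]"
  unfolding tapprox_def by (rule exI[of _ 0]) simp

lemma tapprox_even:
  assumes "q = 1 + fps_X\<^sup>2 * (2 + 4 * (q * q) - 5 * q)"
  shows "tapprox q [1, 1, 3, 13, 63, 329, 1803, 10229, 59559]"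
proof -
  have step: "tapprox q (even_step xs)" if "tapprox q xs" "length xs \<le> 9" for xs
  proof -
    have "tapprox (fps_const 2 + (fps_const 4 * (q * q) + fps_const (- 5) * q))
      (map2 (+) (take (length xs) [2, 0, 0, 0, 0, 0, 0, 0, 0])
        (map2 (+) (map ((*) 4) (tmult xs xs)) (map ((*) (- 5)) xs)))"
      by (intro tapprox_add tapprox_cmult tapprox_mult tapprox_take tapprox_const that)
        (use that(2) in \<open>simp_all add: length_tmult\<close>)
    then show ?thesis
      unfolding even_step_def
      by (rule tapprox_ConsI) (subst assms, simp flip: numeral_fps_const fps_const_neg)
  qed
  have len: "length (even_step xs) = Suc (length xs)" if "length xs \<le> 9" for xs
    using that by (simp add: even_step_def length_tmult)
  have "tapprox q ((even_step ^^ n) []) \<and> length ((even_step ^^ n) []) = n" if "n \<le> 9" for n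
    using that by (induction n) (simp_all add: tapprox_Nil step len)
  then have "tapprox q ((even_step ^^ 9) [])"
    by simp
  then show ?thesis
    by (simp add: eval_nat_numeral even_step_def)
qed

definition from_step :: "rat list \<Rightarrow> rat list \<Rightarrow> rat list"
  where "from_step es xs = 1 # tmult (take (length xs) es)
    (map2 (+) (map ((*) 3) (tmult xs xs)) (map ((*) (- 1)) xs))"

lemma tapprox_from:
  assumes "g = 1 + fps_X\<^sup>2 * e * (3 * (g * g) - g)" "tapprox e es" "length es = 9"
  shows "tapprox g ((from_step es ^^ 9) [])"
proof -
  have step: "tapprox g (from_step es xs)" if "tapprox g xs" "length xs \<le> 9" for xs
  proof -
    have "tapprox (e * (fps_const 3 * (g * g) + fps_const (- 1) * g)) (tmult (take (length xs) es)
      (map2 (+) (map ((*) 3) (tmult xs xs)) (map ((*) (- 1)) xs)))"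
      by (intro tapprox_add tapprox_cmult tapprox_mult tapprox_take assms that)
        (use that(2) assms(3) in \<open>simp_all add: length_tmult\<close>)
    then show ?thesis
      unfolding from_step_def
      by (rule tapprox_ConsI) (subst assms(1), simp add: mult.assoc flip: numeral_fps_const fps_const_neg)
  qed
  have len: "length (from_step es xs) = Suc (length xs)" if "length xs \<le> 9" for xs
    using that assms(3) by (simp add: from_step_def length_tmult)
  have "tapprox g ((from_step es ^^ n) []) \<and> length ((from_step es ^^ n) []) = n" if "n \<le> 9" for n
    using that by (induction n) (simp_all add: tapprox_Nil step len)
  then show ?thesis
    by simp
qed

lemma tapprox_expansion:
  assumes "tapprox F [0, a1, a2, a3, a4, a5, a6, a7, a8]" "t = fps_X\<^sup>2"
  shows "\<exists>h. F = fps_const a1 * t + fps_const a2 * t^2 + fps_const a3 * t^3 + fps_const a4 * t^4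
    + fps_const a5 * t^5 + fps_const a6 * t^6 + fps_const a7 * t^7 + fps_const a8 * t^8 + t^9 * h"
proof -
  obtain h where "F = tseries [0, a1, a2, a3, a4, a5, a6, a7, a8] + fps_X ^ (2 * 9) * h"
    using assms(1) by (auto simp: tapprox_def)
  then have "F = tseries [0, a1, a2, a3, a4, a5, a6, a7, a8] + t ^ 9 * h"
    by (simp only: assms(2) power_mult)
  then have "F = t * (fps_const a1 + t * (fps_const a2 + t * (fps_const a3 + t * (fps_const a4
      + t * (fps_const a5 + t * (fps_const a6 + t * (fps_const a7 + t * fps_const a8))))))) + t ^ 9 * h"
    by (simp add: assms(2))
  then show ?thesis
    by (intro exI[of _ h]) (simp add: algebra_simps eval_nat_numeral)
qed

lemma tapprox_free_energy_even:
  assumes q: "q = 1 + fps_X\<^sup>2 * (2 + 4 * (q * q) - 5 * q)" and e: "e = 1 - fps_X\<^sup>2 * e"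
    and F: "euler F = e * (3 * q - q * q - 1) - 1" "F $ 0 = 0"
  shows "tapprox F [0, 0, 1/2, 5/6, 23/8, 51/5, 124/3, 2515/14, 13245/16]"
proof -
  let ?e = "[1, - 1, 1, - 1, 1, - 1, 1, - 1, 1] :: rat list"
  let ?q = "[1, 1, 3, 13, 63, 329, 1803, 10229, 59559] :: rat list"
  have "tapprox (e * (fps_const 3 * q + (fps_const (- 1) * (q * q) + fps_const (- 1))) + fps_const (- 1))
    (map2 (+) (tmult ?e (map2 (+) (map ((*) 3) ?q) (map2 (+) (map ((*) (- 1)) (tmult ?q ?q))
      [- 1, 0, 0, 0, 0, 0, 0, 0, 0]))) [- 1, 0, 0, 0, 0, 0, 0, 0, 0])"
    by (intro tapprox_add tapprox_mult tapprox_cmult tapprox_const tapprox_even[OF q]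
        tapprox_inverse_1_plus[OF e]) (simp_all add: length_tmult)
  also have "e * (fps_const 3 * q + (fps_const (- 1) * (q * q) + fps_const (- 1))) + fps_const (- 1) = euler F"
    unfolding F(1) by (simp add: algebra_simps flip: numeral_fps_const fps_const_neg)
  finally have "tapprox (euler F) [0, 0, 2, 5, 23, 102, 496, 2515, 13245]"
    by simp
  from tapprox_euler[OF this F(2)] show ?thesis
    by (simp add: upt_rec)
qed

text \<open>The Euler derivative is a polynomial in \<open>e\<close>, \<open>g\<close> and
  \<open>T\<close>, so list arithmetic suffices. Intermediate lists are named by equations, so that
  each can be supplied in evaluated form.\<close>

lemma tapprox_free_energy_from:
  assumes g: "tapprox g gs" and e: "tapprox e es" and T: "T = fps_X\<^sup>2 * e"
    and len: "length gs = 9" "length es = 9"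
    and F: "euler F + h * T
      = e * (T * (2 * (g * g) - 2 * g + 1) + T * T * (2 * (g * (g * g)) - 3 * (g * g * (g * g))))" "F $ 0 = 0"
    and h: "h = fps_const d"
    and ts: "ts = 0 # butlast es" and g2: "g2 = tmult gs gs"
    and cs: "cs = map2 (+) (tmult es (map2 (+)
        (tmult ts (map2 (+) (map ((*) 2) g2) (map2 (+) (map ((*) (- 2)) gs) [1, 0, 0, 0, 0, 0, 0, 0, 0])))
        (tmult (tmult ts ts) (map2 (+) (map ((*) 2) (tmult gs g2)) (map ((*) (- 3)) (tmult g2 g2))))))
      (map ((*) (- d)) ts)"
  shows "tapprox F (map (\<lambda>i. cs ! i / (2 * of_nat i)) [0..<9])"
proof -
  have ts': "tapprox T ts" "length ts = 9"
    unfolding ts by (rule tapprox_ConsI[OF tapprox_butlast[OF e]]) (use T len in simp_all)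
  have "tapprox (e * (T * (fps_const 2 * (g * g) + (fps_const (- 2) * g + fps_const 1))
      + T * T * (fps_const 2 * (g * (g * g)) + fps_const (- 3) * (g * g * (g * g)))) + fps_const (- d) * T) cs"
    unfolding cs g2
    by (intro tapprox_add tapprox_mult tapprox_cmult tapprox_const g e ts')
      (simp_all add: length_tmult len ts')
  also have "e * (T * (fps_const 2 * (g * g) + (fps_const (- 2) * g + fps_const 1))
      + T * T * (fps_const 2 * (g * (g * g)) + fps_const (- 3) * (g * g * (g * g)))) + fps_const (- d) * T
    = euler F + h * T - h * T"
    unfolding F(1) unfolding h by (simp add: algebra_simps flip: numeral_fps_const fps_const_neg)
  also have "\<dots> = euler F"
    by simp
  finally have "tapprox (euler F) cs" .
  from tapprox_euler[OF this F(2)] show ?thesis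
    unfolding cs g2 by (simp add: length_tmult len ts')
qed

section \<open>The specific potentials\<close>

lemma fps_divide_2_nth:
  fixes f :: "'a::field_char_0 fps"
  shows "(f / 2) $ n = f $ n / 2"
proof -
  have "(2 :: 'a fps) $ 0 \<noteq> 0"
    by simp
  then have "f / 2 = f * inverse 2"
    by (rule fps_divide_unit)
  also have "inverse (2 :: 'a fps) = fps_const (1 / 2)"
    by (simp add: numeral_fps_const fps_const_inverse inverse_eq_divide)
  finally show ?thesis
    by simp
qed

lemma fps_log_1_minus_linear_nth:
  fixes a :: "'a::field_char_0"
  shows "fps_log (1 - fps_const a * fps_X) $ n = (if n = 0 then 0 else - (a ^ n / of_nat n))"
proof -
  have "fps_log (1 - fps_const a * fps_X) = fps_ln 1 oo (fps_const (- a) * fps_X)"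
    by (simp add: fps_log_def flip: fps_const_neg)
  also have "\<dots> $ n = (- a) ^ n * fps_ln 1 $ n"
    by (simp add: fps_compose_linear)
  also have "\<dots> = (if n = 0 then 0 else - (a ^ n / of_nat n))"
  proof (cases n)
    case (Suc m)
    have "(- a) ^ Suc m * (- 1) ^ m = - (a ^ Suc m)"
      by (simp add: power_minus[of a] mult_ac flip: power_add) 
    then show ?thesis
      by (simp add: fps_ln_nth Suc del: power_Suc of_nat_Suc)
  qed simp
  finally show ?thesis .
qed

text \<open>The series is the linear one composed with the square of the variable, so its
  coefficients are those of the linear case at half the index.\<close>

lemma fps_log_1_minus_quadratic_nth:
  fixes a :: "'a::field_char_0"
  shows "fps_log (1 - fps_const a * fps_X\<^sup>2) $ n
    = (if n = 0 \<or> odd n then 0 else - (a ^ (n div 2) / of_nat (n div 2)))"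
proof -
  have "fps_const (- a) * fps_X\<^sup>2 = (fps_const (- a) * fps_X) oo (fps_X\<^sup>2 :: 'a fps)"
    by (subst fps_compose_mult_distrib) (simp_all add: fps_X_power_nth fps_X_fps_compose_startby0)
  then have "fps_log (1 - fps_const a * fps_X\<^sup>2) = (fps_ln 1 oo (fps_const (- a) * fps_X)) oo fps_X\<^sup>2"
    by (subst fps_compose_assoc[symmetric]) (simp_all add: fps_log_def fps_X_power_nth flip: fps_const_neg)
  also have "fps_ln 1 oo (fps_const (- a) * fps_X) = fps_log (1 - fps_const a * fps_X)"
    by (simp add: fps_log_def flip: fps_const_neg)
  finally have "fps_log (1 - fps_const a * fps_X\<^sup>2) $ n
      = (if 2 dvd n then fps_log (1 - fps_const a * fps_X) $ (n div 2) else 0)"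
    by (simp only: fps_nth_compose_X_power)
  then show ?thesis
    by (auto simp: fps_log_1_minus_linear_nth)
qed

lemma formal_potential_nth:
  "formal_potential c $ n = (if n = 2 then 1 / 2 else 0) - (if n \<ge> 1 then fps_to_fls (c n) / of_nat n else 0)"
  unfolding formal_potential_def by (simp add: fps_divide_2_nth fps_X_power_nth)

text \<open>The logarithm supplies all powers of \<open>x\<close>; the linear term cancels its first
  coefficient, and for \<open>h = 1\<close> the extra quadratic term cancels the second.\<close>

lemma formal_potential_from:
  fixes s :: "rat fls"
  assumes s: "s = fps_to_fls fps_X" and n0: "n0 = 2 \<and> h = 0 \<or> n0 = 3 \<and> h = 1"
  shows "formal_potential (coeffs_from n0) = (1 + fps_const (h * s\<^sup>2)) * fps_X\<^sup>2 / 2 + fps_const s * fps_X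
    + fps_log (1 - fps_const s * fps_X)"
proof (rule fps_ext)
  fix n
  have c: "fps_to_fls (coeffs_from n0 n) = (if n \<ge> n0 then s ^ n else 0)"
    by (simp add: coeffs_from_def s fps_to_fls_power)
  have 1: "((1 + fps_const (h * s\<^sup>2)) * fps_X\<^sup>2) $ n = (if n = 2 then 1 + h * s\<^sup>2 else 0)"
    by (simp add: distrib_right fps_X_power_nth)
  show "formal_potential (coeffs_from n0) $ n = ((1 + fps_const (h * s\<^sup>2)) * fps_X\<^sup>2 / 2 + fps_const s * fps_X
      + fps_log (1 - fps_const s * fps_X)) $ n"
    unfolding formal_potential_nth fps_add_nth fps_divide_2_nth c 1 fps_log_1_minus_linear_nth
  proof -
    consider "n = 0" | "n = 1" | "n = 2" | "n \<ge> 3"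
      by linarith
    then show "(if n = 2 then 1 / 2 else 0) - (if 1 \<le> n then (if n0 \<le> n then s ^ n else 0) / of_nat n else 0)
      = (if n = 2 then 1 + h * s\<^sup>2 else 0) / 2 + (fps_const s * fps_X) $ n + (if n = 0 then 0 else - (s ^ n / of_nat n))"
      using n0 by cases (elim disjE conjE; simp add: add_divide_distrib)+
  qed
qed

lemma formal_potential_even:
  fixes a :: "rat fls"
  assumes a: "a = fps_to_fls (fps_X\<^sup>2)"
  shows "formal_potential coeffs_even = (1 + fps_const a) * fps_X\<^sup>2 / 2 + fps_log (1 - fps_const a * fps_X\<^sup>2) / 2"
proof (rule fps_ext)
  fix n
  have c: "fps_to_fls (coeffs_even n) = (if even n \<and> n \<ge> 4 then a ^ (n div 2) else 0)"
    by (auto simp: coeffs_even_def a simp flip: fps_to_fls_power power_mult)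
  have 1: "((1 + fps_const a) * fps_X\<^sup>2) $ n = (if n = 2 then 1 + a else 0)"
    by (simp add: distrib_right fps_X_power_nth)
  show "formal_potential coeffs_even $ n
      = ((1 + fps_const a) * fps_X\<^sup>2 / 2 + fps_log (1 - fps_const a * fps_X\<^sup>2) / 2) $ n"
    unfolding formal_potential_nth fps_add_nth fps_divide_2_nth c 1 fps_log_1_minus_quadratic_nth
  proof (cases "even n \<and> n \<noteq> 0")
    case True
    then obtain m where "n = 2 * m" "m \<ge> 1"
      by auto
    then show "(if n = 2 then 1 / 2 else 0) - (if 1 \<le> n then (if even n \<and> 4 \<le> n then a ^ (n div 2) else 0) / of_nat n else 0)
      = (if n = 2 then 1 + a else 0) / 2 + (if n = 0 \<or> odd n then 0 else - (a ^ (n div 2) / of_nat (n div 2))) / 2"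
      by (cases "m = 1") (auto simp: add_divide_distrib)
  qed auto
qed

lemma fps_to_fls_hom:
  "fps_to_fls (f * g) = fps_to_fls f * (fps_to_fls g :: rat fls)" "fps_to_fls (f ^ n) = (fps_to_fls f :: rat fls) ^ n"
  by (simp_all add: fls_times_fps_to_fls fps_to_fls_power)

section \<open>Closed forms and expansions for the three potentials\<close>

lemma even_potential_solution:
  fixes s t r R S F :: "rat fps" and L :: "rat fps \<Rightarrow> rat fls"
  assumes t: "t = fps_X\<^sup>2" and L: "L = fps_to_fls" and r: "r = fps_sqrt ((1 + t) * (1 - 7 * t))"
    and R: "R = msubst coeffs_even series_R" and S: "S = msubst coeffs_even series_S"
    and F: "F = msubst coeffs_even planar_free_energy"
  shows "S = 0 \<and> L R = L (1 + 5 * t - r) / L (8 * t * (1 + t)) \<and>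
     L F = L (1 - 22 * t + 49 * t^2 - (1 - 19 * t) * r) / L (128 * t^2)
       - 1 / 8 * L (fps_log (1 + t)) - 3 / 8 * L (fps_log ((1 - 3 * t + r) / 2)) \<and>
     (\<exists>h. F = fps_const (1/2) * t^2 + fps_const (5/6) * t^3 + fps_const (23/8) * t^4
       + fps_const (51/5) * t^5 + fps_const (124/3) * t^6 + fps_const (2515/14) * t^7
       + fps_const (13245/16) * t^8 + t^9 * h)"
proof -
  obtain e q v where e: "(1 + t) * e = 1" and q: "4 * t * q\<^sup>2 = (1 + 5 * t) * q - (1 + 2 * t)"
    and rq: "r = 1 + 5 * t - 8 * t * q" and v: "v = 1 + t - 4 * t * q"
    and F8: "8 * F = 2 * (q - 1) * (q - 5) - fps_log (1 + t) - 3 * fps_log v"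
    and num: "1 - 22 * t + 49 * t\<^sup>2 - (1 - 19 * t) * r = 128 * t\<^sup>2 * (fps_const (1 / 4) * ((q - 1) * (q - 5)))"
    and q_eq: "q = 1 + t * (2 + 4 * (q * q) - 5 * q)" and e_eq: "e = 1 - t * e"
    and dF: "euler F = e * (3 * q - q * q - 1) - 1"
    using even_parametrisation[OF t r] unfolding F by blast
  have tnz: "t \<noteq> 0" "1 + t \<noteq> 0"
    by (simp add: t) (use e in \<open>metis mult_zero_left zero_neq_one\<close>)
  have RS: "R = e * q" "S = 0"
    using series_RS_even[OF refl e[unfolded t] q[unfolded t]] unfolding R S by blast+
  have "1 + 5 * t - r = 8 * t * ((1 + t) * e) * q"
    unfolding e by (simp add: rq)
  then have R': "1 + 5 * t - r = (8 * t * (1 + t)) * R"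
    by (simp only: RS mult_ac)
  have LR: "L R = L (1 + 5 * t - r) / L (8 * t * (1 + t))"
    unfolding L by (rule fps_to_fls_divide_eqI[symmetric, OF _ R']) (use tnz in simp)
  define A where "A = fps_const (1 / 4) * ((q - 1) * (q - 5))"
  have LA: "L (1 - 22 * t + 49 * t\<^sup>2 - (1 - 19 * t) * r) / L (128 * t\<^sup>2) = L A"
    unfolding L A_def by (rule fps_to_fls_divide_eqI[OF _ num]) (use tnz in simp)
  have v': "(1 - 3 * t + r) / 2 = v"
  proof -
    have "1 - 3 * t + r = 2 * v"
      by (simp add: rq v algebra_simps)
    then show ?thesis
      by simp
  qed
  have "8 * A = 2 * (q - 1) * (q - 5)"
  proof -
    have "8 * fps_const (1 / 4) = (2 :: rat fps)"
      by (simp add: numeral_fps_const)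
    then show ?thesis
      unfolding A_def by (simp only: mult.assoc[symmetric])
  qed
  with F8 have "8 * F = 8 * A - fps_log (1 + t) - 3 * fps_log v"
    by simp
  then have "L (8 * F) = L (8 * A - fps_log (1 + t) - 3 * fps_log v)"
    by simp
  then have "8 * L F = 8 * L A - L (fps_log (1 + t)) - 3 * L (fps_log v)"
    unfolding L by (simp add: fps_to_fls_hom)
  moreover have "L F = 8 * L F / 8"
    by simp
  ultimately have "L F = (8 * L A - L (fps_log (1 + t)) - 3 * L (fps_log v)) / 8"
    by (simp only:)
  then have LF: "L F = L (1 - 22 * t + 49 * t\<^sup>2 - (1 - 19 * t) * r) / L (128 * t\<^sup>2)
      - 1 / 8 * L (fps_log (1 + t)) - 3 / 8 * L (fps_log ((1 - 3 * t + r) / 2))"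
    unfolding LA v' by (simp add: diff_divide_distrib)
  have F0: "F $ 0 = 0"
    unfolding F by (rule planar_free_energy_nth_0_even)
  have "tapprox F [0, 0, 1/2, 5/6, 23/8, 51/5, 124/3, 2515/14, 13245/16]"
    by (rule tapprox_free_energy_even[OF q_eq[unfolded t] e_eq[unfolded t] dF F0])
  from tapprox_expansion[OF this t]
  have "\<exists>h. F = fps_const (1/2) * t^2 + fps_const (5/6) * t^3 + fps_const (23/8) * t^4
       + fps_const (51/5) * t^5 + fps_const (124/3) * t^6 + fps_const (2515/14) * t^7
       + fps_const (13245/16) * t^8 + t^9 * h"
    by simp
  then show ?thesis
    using RS(2) LR LF by blast
qed

lemma from_2_potential_solution:
  fixes s t r R S F :: "rat fps" and L :: "rat fps \<Rightarrow> rat fls"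
  assumes s: "s = fps_X" and t: "t = s\<^sup>2" and L: "L = fps_to_fls" and r: "r = fps_sqrt (1 - 10 * t + t^2)"
    and R: "R = msubst (coeffs_from 2) series_R" and S: "S = msubst (coeffs_from 2) series_S"
    and F: "F = msubst (coeffs_from 2) planar_free_energy"
  shows "L S = L (1 - 5 * t - r) / L (6 * s) \<and>
     L R = L (1 + 14 * t + t^2 - (1 + t) * r) / L (18 * t) \<and>
     L F = L (1 - 32 * t + 96 * t^2 + 76 * t^3 + t^4 - (1 - 27 * t - 27 * t^2 + t^3) * r) / L (216 * t^2)
       - L (fps_log ((1 + t + r) / 2)) \<and>
     (\<exists>h. F = fps_const (1/2) * t + fps_const (3/4) * t^2 + fps_const (8/3) * t^3
       + 12 * t^4 + fps_const (312/5) * t^5 + fps_const (1076/3) * t^6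
       + fps_const (15528/7) * t^7 + 14508 * t^8 + t^9 * h)"
proof -
  have t': "t = fps_X\<^sup>2"
    by (simp add: t s)
  have n0: "2 = (2 :: nat) \<and> (0 :: rat fps) = 0 \<or> 2 = (3 :: nat) \<and> (0 :: rat fps) = 1"
    and \<alpha>: "1 = 1 + 0 * t"
    by simp_all
  show ?thesis
  proof (rule from_parametrisation[OF n0 t' \<alpha>])
    fix e g T k A
    assume e: "1 * e = 1" and T: "T = t * e" and g: "g = 1 + T * (3 * (g * g) - g)"
      and e_eq: "e = 1 - 0 * t * e"
      and k: "k * (g * (3 * g - 1)) = 1" and Tk: "T = (g - 1) * k" and g0: "g $ 0 = 1"
      and S0: "msubst (coeffs_from 2) series_S = fps_X * (e * (g - 1))"
      and R0: "msubst (coeffs_from 2) series_R = e + T * e * g\<^sup>2"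
      and F1: "euler (msubst (coeffs_from 2) planar_free_energy) + 0 * T
        = e * (T * (2 * (g * g) - 2 * g + 1) + T * T * (2 * (g * (g * g)) - 3 * (g * g * (g * g))))"
      and A: "A = fps_const (1 / 4) * ((3 * g ^ 5 - 30 * g ^ 4 + 35 * g ^ 3 - 2 * g\<^sup>2 - 8 * g + 2) * k\<^sup>2 * g)"
      and F2: "euler A + (3 * g - 1) * k * euler g = euler (msubst (coeffs_from 2) planar_free_energy) + 0 * T"
    have S': "S = s * (e * (g - 1))" and R': "R = e + T * e * g\<^sup>2"
      using S0 R0 by (simp_all only: S R s)
    note dF = F1[folded F] and dA = F2[folded F]
    have e1: "e = 1" and T1: "T = t"
      using e T by auto
    have tk: "t = (g - 1) * k"
      using Tk T1 by simp
    have t0: "t $ 0 = 0" and tnz: "t \<noteq> 0" and snz: "s \<noteq> 0"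
      by (auto simp: t s power2_eq_square)
    have g_eq: "g * (1 + t) = 1 + 3 * t * g\<^sup>2"
      using g unfolding T1 by (simp add: algebra_simps power2_eq_square)
    \<comment> \<open>\<open>r'\<close> squares to the discriminant of the quadratic equation for
      \<open>g\<close>; the constant term selects the root.\<close>
    define r' where "r' = 1 + t - 6 * t * g"
    have "r'\<^sup>2 = (1 + t)\<^sup>2 - 12 * t * (g * (1 + t)) + 36 * t\<^sup>2 * g\<^sup>2"
      by (simp add: r'_def algebra_simps power2_eq_square)
    also have "\<dots> = 1 - 10 * t + t\<^sup>2"
      unfolding g_eq by (simp add: algebra_simps power2_eq_square)
    finally have rr': "r = r'"
      unfolding r by (rule fps_sqrt_eqI) (simp add: r'_def t0 mult.assoc)
    \<comment> \<open>This is the inverse of \<open>g\<close>, so \<open>log g\<close> in the free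
      energy becomes minus the logarithm of \<open>v\<close>.\<close>
    define v where "v = 1 + t - 3 * t * g"
    have gv: "g * v = 1"
      using g_eq by (simp add: v_def algebra_simps power2_eq_square)
    have v': "(1 + t + r) / 2 = v"
    proof -
      have "1 + t + r = 2 * v"
        by (simp add: rr' r'_def v_def algebra_simps)
      then show ?thesis
        by simp
    qed
    have LS: "L S = L (1 - 5 * t - r) / L (6 * s)"
      unfolding L by (rule fps_to_fls_divide_eqI[symmetric])
        (use snz in \<open>simp_all add: S' e1 rr' r'_def t algebra_simps power2_eq_square\<close>)
    have "1 + 14 * t + t\<^sup>2 - (1 + t) * r = 1 + 14 * t + t\<^sup>2 - (1 + t)\<^sup>2 + 6 * t * (g * (1 + t))"
      by (simp add: rr' r'_def algebra_simps power2_eq_square)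
    also have "\<dots> = 18 * t * R"
      unfolding g_eq R' e1 T1 by (simp add: algebra_simps power2_eq_square)
    finally have LR: "L R = L (1 + 14 * t + t\<^sup>2 - (1 + t) * r) / L (18 * t)"
      unfolding L by (intro fps_to_fls_divide_eqI[symmetric]) (use tnz in auto)
    define N4 where "N4 = 3 * g ^ 5 - 30 * g ^ 4 + 35 * g ^ 3 - 2 * g\<^sup>2 - 8 * g + 2"
    have A4: "4 * A = N4 * k\<^sup>2 * g"
    proof -
      have "4 * fps_const (1 / 4) = (1 :: rat fps)"
        by (simp add: numeral_fps_const)
      then show ?thesis
        unfolding A N4_def by (simp only: mult.assoc[symmetric] mult_1_left)
    qed
    define num where "num = 1 - 32 * t + 96 * t^2 + 76 * t^3 + t^4 - (1 - 27 * t - 27 * t^2 + t^3) * r"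
    \<comment> \<open>With \<open>t = (g - 1) * k\<close> both sides are polynomials in
      \<open>g\<close> and \<open>k\<close>; they differ by a multiple of the relation for
      \<open>k\<close>.\<close>
    have "4 * (216 * t\<^sup>2 * A) = 216 * t\<^sup>2 * (4 * A)"
      by (simp only: mult_ac)
    also have "\<dots> = 4 * num + (k * (g * (3 * g - 1)) - 1) * (- 48 * g * k - 1872 * g * k ^ 2 + 1272 * g * k ^ 3
        + 24 * g ^ 2 * k + 2016 * g ^ 2 * k ^ 2 + 504 * g ^ 2 * k ^ 3 - 816 * g ^ 3 * k ^ 2 - 5280 * g ^ 3 * k ^ 3
        + 72 * g ^ 4 * k ^ 2 + 6216 * g ^ 4 * k ^ 3 - 2520 * g ^ 5 * k ^ 3 + 216 * g ^ 6 * k ^ 3 + 24 * k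
        + 600 * k ^ 2 - 408 * k ^ 3)"
      unfolding A4 num_def rr' r'_def N4_def tk by (simp add: algebra_simps eval_nat_numeral)
    finally have "4 * (216 * t\<^sup>2 * A) = 4 * num"
      unfolding k by (simp only: diff_self mult_zero_left add_0_right)
    then have "216 * t\<^sup>2 * A = num"
      by (subst (asm) mult_cancel_left) simp
    then have "num = 216 * t\<^sup>2 * A" ..
    then have LA: "L num / L (216 * t\<^sup>2) = L A"
      unfolding L by (intro fps_to_fls_divide_eqI) (use tnz in auto)
    have v0: "v $ 0 = 1"
      by (simp add: v_def t0 mult.assoc)
    have "v = (g * v) * ((3 * g - 1) * k)"
    proof -
      have "(g * v) * ((3 * g - 1) * k) = v * (k * (g * (3 * g - 1)))"
        by (simp only: mult_ac)
      then show ?thesis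
        unfolding k by simp
    qed
    then have v_k: "v = (3 * g - 1) * k"
      unfolding gv by simp
    have "euler (g * v) = 0"
      unfolding gv by (simp add: euler_simps)
    then have "g * euler v = - (v * euler g)"
      by (simp add: euler_simps eq_neg_iff_add_eq_0 algebra_simps)
    moreover have "g * (v * euler (fps_log v)) = g * euler v"
      by (simp only: euler_log[OF v0])
    moreover have "g * (v * euler (fps_log v)) = (g * v) * euler (fps_log v)"
      by (simp only: mult_ac)
    ultimately have dl: "euler (fps_log v) = - ((3 * g - 1) * k * euler g)"
      unfolding gv v_k[symmetric] by simp
    have F0: "F $ 0 = 0"
      unfolding F by (rule planar_free_energy_nth_0_from)
    have "F = A - fps_log v"
    proof (rule euler_eqI)
      show "euler F = euler (A - fps_log v)"
        using dA unfolding euler_simps dl by simp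
      show "F $ 0 = (A - fps_log v) $ 0"
        by (simp add: F0 fps_log_nth_0 A g0 fps_power_zeroth)
    qed
    then have LF: "L F = L num / L (216 * t\<^sup>2) - L (fps_log v)"
      unfolding LA unfolding L by simp
    have ap_e: "tapprox e [1, 0, 0, 0, 0, 0, 0, 0, 0]"
      using tapprox_const[of 1] by (simp add: e1)
    have g_T: "g = 1 + fps_X\<^sup>2 * e * (3 * (g * g) - g)"
      using g unfolding T t' .
    have ap_g: "tapprox g [1, 2, 10, 62, 430, 3194, 24850, 199910, 1649350]"
      using tapprox_from[OF g_T ap_e] by (simp add: eval_nat_numeral from_step_def)
    \<comment> \<open>The integers are the coefficients of \<open>euler F\<close>, which are
      \<open>2 i\<close> times those of \<open>F\<close>.\<close>
    have "tapprox F (map (\<lambda>i. [0, 1, 3, 16, 96, 624, 4304, 31056, 232128] ! i / (2 * of_nat i)) [0..<9])"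
      by (rule tapprox_free_energy_from[OF ap_g ap_e T[unfolded t'] _ _ dF F0, where d = 0
        and ts = "[0, 1, 0, 0, 0, 0, 0, 0, 0]"
        and ?g2.0 = "[1, 4, 24, 164, 1208, 9348, 74920, 616420, 5176296]"]) simp_all
    then have "tapprox F [0, 1/2, 3/4, 8/3, 12, 312/5, 1076/3, 15528/7, 14508]"
      by (simp add: upt_rec)
    from tapprox_expansion[OF this t'] have "\<exists>h. F = fps_const (1/2) * t + fps_const (3/4) * t^2 + fps_const (8/3) * t^3
         + 12 * t^4 + fps_const (312/5) * t^5 + fps_const (1076/3) * t^6
         + fps_const (15528/7) * t^7 + 14508 * t^8 + t^9 * h"
      by (simp flip: numeral_fps_const)
    then show ?thesis
      using LS LR LF unfolding v' num_def by blast
  qed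
qed

lemma from_3_potential_solution:
  fixes s t r R S F :: "rat fps" and L :: "rat fps \<Rightarrow> rat fls"
  assumes s: "s = fps_X" and t: "t = s\<^sup>2" and L: "L = fps_to_fls" and r: "r = fps_sqrt (1 - 8 * t - 8 * t^2)"
    and R: "R = msubst (coeffs_from 3) series_R" and S: "S = msubst (coeffs_from 3) series_S"
    and F: "F = msubst (coeffs_from 3) planar_free_energy"
  shows "L S = L (1 - 4 * t - r) / L (6 * (1 + t) * s) \<and>
     L R = L (1 + 16 * t + 16 * t^2 - (1 + 2 * t) * r) / L (18 * t * (1 + t)^2) \<and>
     L F = L (1 - 28 * t + 6 * t^2 + 176 * t^3 + 142 * t^4 - (1 - 24 * t - 78 * t^2 - 52 * t^3) * r)
         / L (216 * t^2 * (1 + t)^2)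
       + 1 / 2 * L (fps_log (1 + t)) - L (fps_log ((1 + 2 * t + r) / 2)) \<and>
     (\<exists>h. F = fps_const (1/2) * t^2 + fps_const (3/2) * t^3 + fps_const (47/8) * t^4
       + fps_const (139/5) * t^5 + fps_const (430/3) * t^6 + fps_const (11175/14) * t^7
       + fps_const (75149/16) * t^8 + t^9 * h)"
proof -
  have t': "t = fps_X\<^sup>2"
    by (simp add: t s)
  have n0: "3 = (2 :: nat) \<and> (1 :: rat fps) = 0 \<or> 3 = (3 :: nat) \<and> (1 :: rat fps) = 1"
    and \<alpha>: "1 + t = 1 + 1 * t"
    by simp_all
  show ?thesis
  proof (rule from_parametrisation[OF n0 t' \<alpha>])
    fix e g T k A
    assume e: "(1 + t) * e = 1" and T: "T = t * e" and g: "g = 1 + T * (3 * (g * g) - g)"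
      and e_eq: "e = 1 - 1 * t * e"
      and k: "k * (g * (3 * g - 1)) = 1" and Tk: "T = (g - 1) * k" and g0: "g $ 0 = 1"
      and S0: "msubst (coeffs_from 3) series_S = fps_X * (e * (g - 1))"
      and R0: "msubst (coeffs_from 3) series_R = e + T * e * g\<^sup>2"
      and F1: "euler (msubst (coeffs_from 3) planar_free_energy) + 1 * T
        = e * (T * (2 * (g * g) - 2 * g + 1) + T * T * (2 * (g * (g * g)) - 3 * (g * g * (g * g))))"
      and A: "A = fps_const (1 / 4) * ((3 * g ^ 5 - 30 * g ^ 4 + 35 * g ^ 3 - 2 * g\<^sup>2 - 8 * g + 2) * k\<^sup>2 * g)"
      and F2: "euler A + (3 * g - 1) * k * euler g = euler (msubst (coeffs_from 3) planar_free_energy) + 1 * T"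
    have S': "S = s * (e * (g - 1))" and R': "R = e + T * e * g\<^sup>2"
      using S0 R0 by (simp_all only: S R s)
    note dF = F1[folded F] and dA = F2[folded F]
    define \<alpha> where "\<alpha> = 1 + t"
    note e' = e[folded \<alpha>_def]
    have \<alpha>T: "\<alpha> * T = t"
      using e' unfolding T by (metis mult.left_commute mult_1_right)
    have t0: "t $ 0 = 0" and tnz: "t \<noteq> 0" and snz: "s \<noteq> 0"
      by (auto simp: t s power2_eq_square)
    have \<alpha>nz: "\<alpha> \<noteq> 0"
      using e' by (metis mult_zero_left zero_neq_one)
    have "\<alpha> * g = \<alpha> + (\<alpha> * T) * (3 * (g * g) - g)"
      by (subst (1) g) (simp add: algebra_simps)
    then have g_eq: "g * (1 + 2 * t) = 1 + t + 3 * t * g\<^sup>2"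
      unfolding \<alpha>T by (simp add: \<alpha>_def algebra_simps power2_eq_square)
    define r' where "r' = 1 + 2 * t - 6 * t * g"
    have "r'\<^sup>2 = (1 + 2 * t)\<^sup>2 - 12 * t * (g * (1 + 2 * t)) + 36 * t\<^sup>2 * g\<^sup>2"
      by (simp add: r'_def algebra_simps power2_eq_square)
    also have "\<dots> = 1 - 8 * t - 8 * t\<^sup>2"
      unfolding g_eq by (simp add: algebra_simps power2_eq_square)
    finally have rr': "r = r'"
      unfolding r by (rule fps_sqrt_eqI) (simp add: r'_def t0 mult.assoc)
    \<comment> \<open>Here \<open>g * v = 1 + t\<close>, so \<open>log g\<close> is
      \<open>log (1 + t)\<close> minus \<open>log v\<close>. Together with the integral of
      \<open>- T\<close>, which is minus one half of \<open>log (1 + t)\<close>, this leaves the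
      coefficient 1/2 in the closed form.\<close>
    define v where "v = 1 + 2 * t - 3 * t * g"
    have gv: "g * v = \<alpha>"
      using g_eq by (simp add: v_def \<alpha>_def algebra_simps power2_eq_square)
    have v': "(1 + 2 * t + r) / 2 = v"
    proof -
      have "1 + 2 * t + r = 2 * v"
        by (simp add: rr' r'_def v_def algebra_simps)
      then show ?thesis
        by simp
    qed
    have "1 - 4 * t - r = 6 * t * (\<alpha> * e) * (g - 1)"
      unfolding e' by (simp add: rr' r'_def algebra_simps)
    also have "\<dots> = (6 * \<alpha> * s) * S"
      by (simp add: S' t power2_eq_square mult_ac)
    finally have LS: "L S = L (1 - 4 * t - r) / L (6 * (1 + t) * s)"
      unfolding L \<alpha>_def[symmetric] by (intro fps_to_fls_divide_eqI[symmetric]) (use snz \<alpha>nz in simp_all)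
    have "1 + 16 * t + 16 * t\<^sup>2 - (1 + 2 * t) * r = 12 * t + 12 * t\<^sup>2 + 6 * t * (g * (1 + 2 * t))"
      by (simp add: rr' r'_def algebra_simps power2_eq_square)
    also have "\<dots> = 18 * t * (\<alpha> * (\<alpha> * e) + (\<alpha> * T) * (\<alpha> * e) * g\<^sup>2)"
      unfolding g_eq e' \<alpha>T by (simp add: \<alpha>_def algebra_simps power2_eq_square)
    also have "\<dots> = 18 * t * \<alpha>\<^sup>2 * R"
      unfolding R' by (simp add: algebra_simps power2_eq_square)
    finally have LR: "L R = L (1 + 16 * t + 16 * t\<^sup>2 - (1 + 2 * t) * r) / L (18 * t * (1 + t)\<^sup>2)"
      unfolding L \<alpha>_def[symmetric] by (intro fps_to_fls_divide_eqI[symmetric]) (use tnz \<alpha>nz in simp_all)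
    define N4 where "N4 = 3 * g ^ 5 - 30 * g ^ 4 + 35 * g ^ 3 - 2 * g\<^sup>2 - 8 * g + 2"
    have A4: "4 * A = N4 * k\<^sup>2 * g"
    proof -
      have "4 * fps_const (1 / 4) = (1 :: rat fps)"
        by (simp add: numeral_fps_const)
      then show ?thesis
        unfolding A N4_def by (simp only: mult.assoc[symmetric] mult_1_left)
    qed
    define num where "num = 1 - 28 * t + 6 * t^2 + 176 * t^3 + 142 * t^4 - (1 - 24 * t - 78 * t^2 - 52 * t^3) * r"
    \<comment> \<open>In terms of \<open>u\<close> both \<open>\<alpha>\<close> and \<open>t\<close>
      are polynomial multiples, and \<open>\<alpha> - t = 1\<close> becomes the single relation for
      \<open>u\<close> used for the reduction.\<close>
    define u where "u = \<alpha> * k"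
    have \<alpha>u: "\<alpha> = g * (3 * g - 1) * u"
    proof -
      have "g * (3 * g - 1) * u = \<alpha> * (k * (g * (3 * g - 1)))"
        by (simp only: u_def mult_ac)
      then show ?thesis
        unfolding k by simp
    qed
    have tu: "t = (g - 1) * u"
      using \<alpha>T unfolding Tk u_def by (simp only: mult_ac)
    have "u * (3 * g\<^sup>2 - 2 * g + 1) = g * (3 * g - 1) * u - (g - 1) * u"
      by (simp add: algebra_simps power2_eq_square)
    then have u: "u * (3 * g\<^sup>2 - 2 * g + 1) = 1"
      unfolding \<alpha>u[symmetric] tu[symmetric] by (simp add: \<alpha>_def)
    have "216 * t\<^sup>2 * \<alpha>\<^sup>2 * A = 54 * t\<^sup>2 * \<alpha>\<^sup>2 * (4 * A)"
      by simp
    also have "\<dots> = 54 * t\<^sup>2 * N4 * g * u\<^sup>2"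
      unfolding A4 u_def by (simp add: power_mult_distrib mult_ac)
    also have "\<dots> = num + (u * (3 * g\<^sup>2 - 2 * g + 1) - 1) * (1 - 36 * g * u - 276 * g * u ^ 2
        + 756 * g * u ^ 3 + 6 * g ^ 2 * u + 390 * g ^ 2 * u ^ 2 - 654 * g ^ 2 * u ^ 3 - 192 * g ^ 3 * u ^ 2
        - 688 * g ^ 3 * u ^ 3 + 18 * g ^ 4 * u ^ 2 + 1338 * g ^ 4 * u ^ 3 - 612 * g ^ 5 * u ^ 3
        + 54 * g ^ 6 * u ^ 3 + 30 * u + 60 * u ^ 2 - 194 * u ^ 3)"
    proof -
      have "1 + 2 * t - 6 * t * g = \<alpha> + t - 6 * t * g"
        by (simp add: \<alpha>_def)
      also have "\<dots> = g * (3 * g - 1) * u + (g - 1) * u - 6 * ((g - 1) * u) * g"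
        unfolding \<alpha>u[symmetric] tu[symmetric] ..
      finally have r_u: "r = g * (3 * g - 1) * u + (g - 1) * u - 6 * ((g - 1) * u) * g"
        unfolding rr' r'_def .
      show ?thesis
        unfolding num_def N4_def r_u tu by (simp add: algebra_simps eval_nat_numeral)
    qed
    finally have "num = 216 * t\<^sup>2 * \<alpha>\<^sup>2 * A"
      unfolding u by simp
    then have LA: "L num / L (216 * t\<^sup>2 * (1 + t)\<^sup>2) = L A"
      unfolding L \<alpha>_def[symmetric] by (intro fps_to_fls_divide_eqI) (use tnz \<alpha>nz in simp_all)
    have v0: "v $ 0 = 1"
      by (simp add: v_def t0 mult.assoc)
    have "(g * v) * (e * ((3 * g - 1) * k)) = e * v * (k * (g * (3 * g - 1)))"
      by (simp only: mult_ac)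
    moreover have "(g * v) * (e * ((3 * g - 1) * k)) = (\<alpha> * e) * ((3 * g - 1) * k)"
      unfolding gv by (simp only: mult_ac)
    ultimately have ev: "e * v = (3 * g - 1) * k"
      unfolding k e' by simp
    have d\<alpha>: "euler \<alpha> = 2 * t"
      unfolding \<alpha>_def t' by (simp add: euler_simps euler_X_power2)
    have "g * euler v + v * euler g = 2 * t"
      using d\<alpha> unfolding gv[symmetric] by (simp add: euler_simps algebra_simps)
    moreover have "g * euler v = \<alpha> * euler (fps_log v)"
      unfolding gv[symmetric] euler_log[OF v0, symmetric] by (simp only: mult_ac)
    ultimately have "e * (\<alpha> * euler (fps_log v) + v * euler g) = e * (2 * t)"
      by simp
    then have "(\<alpha> * e) * euler (fps_log v) + (e * v) * euler g = 2 * T"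
      unfolding T by (simp add: algebra_simps)
    then have dl: "euler (fps_log v) = 2 * T - (3 * g - 1) * k * euler g"
      unfolding e' ev by (simp add: eq_diff_eq)
    have "e * (\<alpha> * euler (fps_log \<alpha>)) = e * (2 * t)"
      unfolding d\<alpha>[symmetric] by (subst euler_log) (simp_all add: \<alpha>_def t0)
    then have "(\<alpha> * e) * euler (fps_log \<alpha>) = 2 * T"
      unfolding T by (simp only: mult_ac)
    then have dl\<alpha>: "euler (fps_log \<alpha>) = 2 * T"
      unfolding e' by simp
    have F0: "F $ 0 = 0"
      unfolding F by (rule planar_free_energy_nth_0_from)
    \<comment> \<open>Doubled, so that the half-integral coefficient of the logarithm stays integral
      among power series.\<close>
    have "2 * F = 2 * A + fps_log \<alpha> - 2 * fps_log v"
    proof (rule euler_eqI)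
      have "euler (2 * A + fps_log \<alpha> - 2 * fps_log v) = 2 * (euler A + (3 * g - 1) * k * euler g) - 2 * T"
        by (simp add: euler_simps dl dl\<alpha> algebra_simps)
      then show "euler (2 * F) = euler (2 * A + fps_log \<alpha> - 2 * fps_log v)"
        unfolding dA by (simp add: euler_simps algebra_simps)
      show "(2 * F) $ 0 = (2 * A + fps_log \<alpha> - 2 * fps_log v) $ 0"
        by (simp add: F0 fps_log_nth_0 A g0 fps_power_zeroth)
    qed
    then have "L (2 * F) = L (2 * A + fps_log \<alpha> - 2 * fps_log v)"
      by simp
    then have "2 * L F = 2 * L A + L (fps_log \<alpha>) - 2 * L (fps_log v)"
      unfolding L by (simp add: fps_to_fls_hom)
    moreover have "L F = 2 * L F / 2"
      by simp
    ultimately have "L F = (2 * L A + L (fps_log \<alpha>) - 2 * L (fps_log v)) / 2"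
      by (simp only:)
    then have LF: "L F = L num / L (216 * t\<^sup>2 * (1 + t)\<^sup>2) + 1 / 2 * L (fps_log (1 + t)) - L (fps_log v)"
      unfolding LA unfolding \<alpha>_def[symmetric] by (simp add: diff_divide_distrib add_divide_distrib)
    have ap_e: "tapprox e [1, - 1, 1, - 1, 1, - 1, 1, - 1, 1]"
      by (rule tapprox_inverse_1_plus) (use e_eq in \<open>simp only: t' mult_1_left\<close>)
    have g_T: "g = 1 + fps_X\<^sup>2 * e * (3 * (g * g) - g)"
      using g unfolding T t' .
    have ap_g: "tapprox g [1, 2, 8, 44, 272, 1808, 12608, 90992, 673856]"
      using tapprox_from[OF g_T ap_e] by (simp add: eval_nat_numeral from_step_def)
    have "tapprox F (map (\<lambda>i. [0, 0, 2, 9, 47, 278, 1720, 11175, 75149] ! i / (2 * of_nat i)) [0..<9])"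
      by (rule tapprox_free_energy_from[OF ap_g ap_e T[unfolded t'] _ _ dF F0, where d = 1
        and ts = "[0, 1, - 1, 1, - 1, 1, - 1, 1, - 1]"
        and ?g2.0 = "[1, 4, 20, 120, 784, 5408, 38736, 285280, 2146496]"]) simp_all
    then have "tapprox F [0, 0, 1/2, 3/2, 47/8, 139/5, 430/3, 11175/14, 75149/16]"
      by (simp add: upt_rec)
    from tapprox_expansion[OF this t'] have "\<exists>h. F = fps_const (1/2) * t^2 + fps_const (3/2) * t^3 + fps_const (47/8) * t^4
         + fps_const (139/5) * t^5 + fps_const (430/3) * t^6 + fps_const (11175/14) * t^7
         + fps_const (75149/16) * t^8 + t^9 * h"
      by simp
    then show ?thesis
      using LS LR LF unfolding v' num_def by blast
  qed
qed

theorem proposition8p4: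
  shows
    "let s = fps_X :: rat fps; t = s\<^sup>2; L = fps_to_fls :: rat fps \<Rightarrow> rat fls;
         sx = fps_const (L s); tx = fps_const (L t); x = fps_X :: rat fls fps
     in
     (let a = coeffs_even; r = fps_sqrt ((1 + t) * (1 - 7 * t));
          R = msubst a series_R; S = msubst a series_S; F = msubst a planar_free_energy
      in formal_potential a = (1 + tx) * x\<^sup>2 / 2 + fps_log (1 - tx * x\<^sup>2) / 2 \<and>
         S = 0 \<and>
         L R = L (1 + 5 * t - r) / L (8 * t * (1 + t)) \<and>
         L F = L (1 - 22 * t + 49 * t^2 - (1 - 19 * t) * r) / L (128 * t^2)
           - 1 / 8 * L (fps_log (1 + t)) - 3 / 8 * L (fps_log ((1 - 3 * t + r) / 2)) \<and>
         (\<exists>h. F = fps_const (1/2) * t^2 + fps_const (5/6) * t^3 + fps_const (23/8) * t^4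
           + fps_const (51/5) * t^5 + fps_const (124/3) * t^6 + fps_const (2515/14) * t^7
           + fps_const (13245/16) * t^8 + t^9 * h)) \<and>
     (let a = coeffs_from 2; r = fps_sqrt (1 - 10 * t + t^2);
          R = msubst a series_R; S = msubst a series_S; F = msubst a planar_free_energy
      in formal_potential a = x\<^sup>2 / 2 + sx * x + fps_log (1 - sx * x) \<and>
         L S = L (1 - 5 * t - r) / L (6 * s) \<and>
         L R = L (1 + 14 * t + t^2 - (1 + t) * r) / L (18 * t) \<and>
         L F = L (1 - 32 * t + 96 * t^2 + 76 * t^3 + t^4 - (1 - 27 * t - 27 * t^2 + t^3) * r) / L (216 * t^2)
           - L (fps_log ((1 + t + r) / 2)) \<and>
         (\<exists>h. F = fps_const (1/2) * t + fps_const (3/4) * t^2 + fps_const (8/3) * t^3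
           + 12 * t^4 + fps_const (312/5) * t^5 + fps_const (1076/3) * t^6
           + fps_const (15528/7) * t^7 + 14508 * t^8 + t^9 * h)) \<and>
     (let a = coeffs_from 3; r = fps_sqrt (1 - 8 * t - 8 * t^2);
          R = msubst a series_R; S = msubst a series_S; F = msubst a planar_free_energy
      in formal_potential a = (1 + tx) * x\<^sup>2 / 2 + sx * x + fps_log (1 - sx * x) \<and>
         L S = L (1 - 4 * t - r) / L (6 * (1 + t) * s) \<and>
         L R = L (1 + 16 * t + 16 * t^2 - (1 + 2 * t) * r) / L (18 * t * (1 + t)^2) \<and>
         L F = L (1 - 28 * t + 6 * t^2 + 176 * t^3 + 142 * t^4 - (1 - 24 * t - 78 * t^2 - 52 * t^3) * r)
             / L (216 * t^2 * (1 + t)^2)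
           + 1 / 2 * L (fps_log (1 + t)) - L (fps_log ((1 + 2 * t + r) / 2)) \<and>
         (\<exists>h. F = fps_const (1/2) * t^2 + fps_const (3/2) * t^3 + fps_const (47/8) * t^4
           + fps_const (139/5) * t^5 + fps_const (430/3) * t^6 + fps_const (11175/14) * t^7
           + fps_const (75149/16) * t^8 + t^9 * h))"
proof -
  have L: "fps_to_fls (fps_X\<^sup>2) = (fps_to_fls fps_X :: rat fls)\<^sup>2"
    by (simp add: fps_to_fls_power)
  have from_2: "formal_potential (coeffs_from 2) = fps_X\<^sup>2 / 2 + fps_const (fps_to_fls fps_X) * fps_X
      + fps_log (1 - fps_const (fps_to_fls fps_X) * fps_X)"
    using formal_potential_from[OF refl, of 2 0] by simp
  have from_3: "formal_potential (coeffs_from 3) = (1 + fps_const (fps_to_fls (fps_X\<^sup>2))) * fps_X\<^sup>2 / 2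
      + fps_const (fps_to_fls fps_X) * fps_X + fps_log (1 - fps_const (fps_to_fls fps_X) * fps_X)"
    using formal_potential_from[OF refl, of 3 1] unfolding L by simp
  show ?thesis
    unfolding Let_def
    by (intro conjI[OF conjI[OF formal_potential_even[OF refl]] conjI] conjI[OF from_2] conjI[OF from_3]
      even_potential_solution from_2_potential_solution from_3_potential_solution refl)
qed

end
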